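(* There exist $\mathbf{u}_0:\mathbb{R}^3\to\mathbb{R}^3$, a body force $\mathbf{f}:\mathbb{R}_+\times\mathbb{R}^3\to\mathbb{R}^3$, a bounded open domain $D\subset\mathbb{R}^3$ with regular boundary, and a suitable weak solution $(\mathbf{u},P)$ (in the sense defined in the context) of the Navier-Stokes system in $D$ with initial condition $\mathbf{u}_0$ and body force $\mathbf{f}$, such that $$\mathcal{H}^1(S(\mathbf{u}))>0,$$ where $S(\mathbf{u})$ is the singular set of $\mathbf{u}$ and $\mathcal{H}^1$ is the one-dimensional Hausdorff measure.
   Context: Navier-Stokes system. Let $D\subset\mathbb{R}^3$ be a bounded open domain with regular boundary. The Navier-Stokes system with body force $f$ and initial condition $u_0$ is $$\partial_t u-\Delta u+(u\cdot\nabla)u+\nabla P=f,\quad \operatorname{div}u=0,\quad u(0)=u_0,\quad u(t,\cdot)=0\ \text{on }\partial D.$$ Here $f$ is a locally integrable function, and equations are understood in the sense of distributions. Associated Stokes problem. $(z,Q)$ denotes the solution, with $z\in L^\infty_{\mathrm{loc}}([0,\infty);[L^2(D)]^3)\cap L^2_{\mathrm{loc}}([0,\infty);[H^1_0(D)]^3)$, of $$\partial_t z-\Delta z+\nabla Q=f,\quad \operatorname{div}z=0,\quad z(0)=0,\quad z(t,\cdot)=0\ \text{on }\partial D.$$ Modified Navier-Stokes equations: $$\partial_t v-\Delta v+((v+z)\cdot\nabla)(v+z)+\nabla\pi=0,\quad \operatorname{div}v=0,\quad v(0)=u_0,\quad v(t,\cdot)=0\ \text{on }\partial D.$$ Suitable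 weak solution. With $(z,Q)$ the solution of the Stokes problem above, a suitable weak solution of the Navier-Stokes system is a pair $(u,P)$ with $$u\in L^\infty([0,\infty);[L^2(D)]^3)\cap L^2_{\mathrm{loc}}([0,\infty);[H^1_0(D)]^3),\qquad P\in L^{5/3}_{\mathrm{loc}}((0,T)\times D)\ \text{for every }T>0,$$ such that $v=u-z$ and $\pi=P-Q$ satisfy the modified Navier-Stokes equations in the sense of distributions over $(0,\infty)\times D$ and satisfy the local energy inequality $$\int_D|v(t)|^2\varphi+2\int_0^t\!\!\int_D\varphi|\nabla v|^2\le\int_0^t\!\!\int_D|v|^2\Big(\frac{\partial\varphi}{\partial t}+\Delta\varphi\Big)+\int_0^t\!\!\int_D(|v|^2+2v\cdot z)\,((v+z)\cdot\nabla\varphi)$$ $$\qquad+2\int_0^t\!\!\int_D\varphi\, z\cdot((v+z)\cdot\nabla)v+\int_0^t\!\!\int_D 2\pi\, v\cdot\nabla\varphi$$ for every $T>0$, almost every $t\in(0,T]$, and every smooth $\varphi:\mathbb{R}\times D\to\mathbb{R}$ with $\varphi\ge0$ and compact support in $(0,T]\times D$. Singular set. A space-time point $(t,x)$ is regular for a vector field $u$ if $u$ is essentially bounded in some neighbourhood of $(t,x)$; it is singular otherwise. $S(u)$ is the set of all singular points of $u$, a subset of space-time. *)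

theory Defs
  imports "HOL-Analysis.Analysis"
begin

text \<open>Space-time points are pairs \<open>(t, x) :: real \<times> (real^3)\<close>; the instance of class
  \<open>euclidean_space\<close> for products supplies the Euclidean metric and Lebesgue measure on
  \<open>\<real>\<^sup>4\<close>.\<close>

type_synonym spacetime = "real \<times> (real^3)"


section \<open>Smooth functions and test functions\<close>

text \<open>Meant for open \<open>S\<close> only.\<close>

primrec Ck_on :: "nat \<Rightarrow> 'a::euclidean_space set \<Rightarrow> ('a \<Rightarrow> 'b::real_normed_vector) \<Rightarrow> bool" where
  "Ck_on 0 S f \<longleftrightarrow> continuous_on S f"
| "Ck_on (Suc k) S f \<longleftrightarrow> (\<forall>x\<in>S. f differentiable (at x)) \<and>
     (\<forall>b\<in>Basis. Ck_on k S (\<lambda>x. frechet_derivative f (at x) b))"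

definition smooth_on :: "'a::euclidean_space set \<Rightarrow> ('a \<Rightarrow> 'b::real_normed_vector) \<Rightarrow> bool" where
  "smooth_on S f \<longleftrightarrow> (\<forall>k. Ck_on k S f)"

text \<open>Smooth functions with compact support in \<open>\<Omega>\<close>, extended by zero to the whole space.  The set
  \<open>\<Omega>\<close> need not be open: for \<open>\<Omega> = {0<..T} \<times> D\<close> these are the functions admitted in the local
  energy inequality.\<close>

definition test_function :: "'a::euclidean_space set \<Rightarrow> ('a \<Rightarrow> 'b::real_normed_vector) \<Rightarrow> bool" where
  "test_function \<Omega> \<phi> \<longleftrightarrow> smooth_on UNIV \<phi> \<and>
     compact (closure {x. \<phi> x \<noteq> 0}) \<and> closure {x. \<phi> x \<noteq> 0} \<subseteq> \<Omega>"

definition dt :: "(spacetime \<Rightarrow> real) \<Rightarrow> spacetime \<Rightarrow> real" where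
  "dt \<phi> p = frechet_derivative \<phi> (at p) (1, 0)"

definition dx :: "3 \<Rightarrow> (spacetime \<Rightarrow> real) \<Rightarrow> spacetime \<Rightarrow> real" where
  "dx i \<phi> p = frechet_derivative \<phi> (at p) (0, axis i 1)"

definition grad :: "(spacetime \<Rightarrow> real) \<Rightarrow> spacetime \<Rightarrow> real^3" where
  "grad \<phi> p = (\<chi> i. dx i \<phi> p)"

definition laplacian :: "(spacetime \<Rightarrow> real) \<Rightarrow> spacetime \<Rightarrow> real" where
  "laplacian \<phi> p = (\<Sum>i\<in>UNIV. dx i (dx i \<phi>) p)"


section \<open>Domains\<close>

text \<open>Regular boundary is read as: \<open>C\<^sup>\<infinity>\<close> boundary with the domain locally on one side of it.\<close>

definition regular_boundary :: "(real^3) set \<Rightarrow> bool" where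
  "regular_boundary D \<longleftrightarrow>
     (\<forall>p\<in>frontier D. \<exists>U (\<rho> :: real^3 \<Rightarrow> real). open U \<and> p \<in> U \<and> smooth_on U \<rho> \<and>
        (\<forall>x\<in>U. frechet_derivative \<rho> (at x) \<noteq> (\<lambda>h. 0)) \<and>
        D \<inter> U = {x\<in>U. \<rho> x < 0})"

definition regular_bounded_domain :: "(real^3) set \<Rightarrow> bool" where
  "regular_bounded_domain D \<longleftrightarrow>
     D \<noteq> {} \<and> open D \<and> connected D \<and> bounded D \<and> regular_boundary D"


section \<open>Function spaces\<close>

definition locally_integrable_on :: "'a::euclidean_space set \<Rightarrow> ('a \<Rightarrow> 'b::euclidean_space) \<Rightarrow> bool" where
  "locally_integrable_on \<Omega> f \<longleftrightarrow> (\<forall>K. compact K \<and> K \<subseteq> \<Omega> \<longrightarrow> f absolutely_integrable_on K)"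

definition Lp_loc :: "real \<Rightarrow> 'a::euclidean_space set \<Rightarrow> ('a \<Rightarrow> 'b::euclidean_space) \<Rightarrow> bool" where
  "Lp_loc p \<Omega> f \<longleftrightarrow> (\<forall>K. compact K \<and> K \<subseteq> \<Omega> \<longrightarrow>
     set_borel_measurable lebesgue K f \<and> (\<lambda>x. norm (f x) powr p) absolutely_integrable_on K)"

definition L2_on :: "'a::euclidean_space set \<Rightarrow> ('a \<Rightarrow> 'b::euclidean_space) \<Rightarrow> bool" where
  "L2_on D w \<longleftrightarrow>
     set_borel_measurable lebesgue D w \<and> (\<lambda>x. (norm (w x))\<^sup>2) absolutely_integrable_on D"

text \<open>\<open>w\<close> belongs to \<open>[H\<^sup>1\<^sub>0(D)]\<^sup>3\<close>, the closure of the test functions in the \<open>H\<^sup>1\<close> norm, and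
  \<open>G\<close> is its weak Jacobian \<open>G $ i $ j = \<partial>\<^sub>j w\<^sub>i\<close>.  The limit \<open>G\<close> of the Jacobians is determined
  by \<open>w\<close> up to a null set.\<close>

definition H10_with_grad :: "(real^3) set \<Rightarrow> (real^3 \<Rightarrow> real^3) \<Rightarrow> (real^3 \<Rightarrow> real^3^3) \<Rightarrow> bool" where
  "H10_with_grad D w G \<longleftrightarrow> L2_on D w \<and> L2_on D G \<and>
     (\<exists>\<phi> :: nat \<Rightarrow> real^3 \<Rightarrow> real^3. (\<forall>n. test_function D (\<phi> n)) \<and>
        (\<lambda>n. LINT x:D|lebesgue. (norm (\<phi> n x - w x))\<^sup>2) \<longlonglongrightarrow> 0 \<and>
        (\<lambda>n. LINT x:D|lebesgue. (norm (jacobian (\<phi> n) (at x) - G x))\<^sup>2) \<longlonglongrightarrow> 0)"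

text \<open>Bochner spaces are expressed through jointly measurable representatives; since \<open>L\<^sup>2(D)\<close> is
  separable, this is the same as strong measurability of \<open>t \<mapsto> u(t)\<close>.\<close>

definition Linf_L2 :: "real set \<Rightarrow> (real^3) set \<Rightarrow> (spacetime \<Rightarrow> real^3) \<Rightarrow> bool" where
  "Linf_L2 I D u \<longleftrightarrow> set_borel_measurable lebesgue (I \<times> D) u \<and>
     (\<exists>M. AE t in lebesgue. t \<in> I \<longrightarrow>
        L2_on D (\<lambda>x. u (t, x)) \<and> (LINT x:D|lebesgue. (norm (u (t, x)))\<^sup>2) \<le> M)"

definition L2_H10_with_grad ::
  "real set \<Rightarrow> (real^3) set \<Rightarrow> (spacetime \<Rightarrow> real^3) \<Rightarrow> (spacetime \<Rightarrow> real^3^3) \<Rightarrow> bool" where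
  "L2_H10_with_grad I D u G \<longleftrightarrow> L2_on (I \<times> D) u \<and> L2_on (I \<times> D) G \<and>
     (AE t in lebesgue. t \<in> I \<longrightarrow> H10_with_grad D (\<lambda>x. u (t, x)) (\<lambda>x. G (t, x)))"

text \<open>\<open>L\<^sup>2\<^sub>l\<^sub>o\<^sub>c\<close> and \<open>L\<^sup>\<infinity>\<^sub>l\<^sub>o\<^sub>c\<close> on \<open>[0,\<infinity>)\<close>: local only at infinity, hence bounds on each \<open>(0,T)\<close>.\<close>

definition Linf_loc_L2 :: "(real^3) set \<Rightarrow> (spacetime \<Rightarrow> real^3) \<Rightarrow> bool" where
  "Linf_loc_L2 D u \<longleftrightarrow> (\<forall>T>0. Linf_L2 {0<..<T} D u)"

definition L2_loc_H10_with_grad ::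
  "(real^3) set \<Rightarrow> (spacetime \<Rightarrow> real^3) \<Rightarrow> (spacetime \<Rightarrow> real^3^3) \<Rightarrow> bool" where
  "L2_loc_H10_with_grad D u G \<longleftrightarrow> (\<forall>T>0. L2_H10_with_grad {0<..<T} D u G)"


section \<open>The equations in the sense of distributions\<close>

definition div_free :: "spacetime set \<Rightarrow> (spacetime \<Rightarrow> real^3) \<Rightarrow> bool" where
  "div_free \<Omega> u \<longleftrightarrow>
     (\<forall>\<phi> :: spacetime \<Rightarrow> real. test_function \<Omega> \<phi> \<longrightarrow> (LINT p:\<Omega>|lebesgue. u p \<bullet> grad \<phi> p) = 0)"

text \<open>\<open>\<partial>\<^sub>t u - \<Delta>u + \<nabla>P = F\<close> as distributions over \<open>\<Omega>\<close>, component by component.\<close>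

definition momentum_eq ::
  "spacetime set \<Rightarrow> (spacetime \<Rightarrow> real^3) \<Rightarrow> (spacetime \<Rightarrow> real) \<Rightarrow> (spacetime \<Rightarrow> real^3) \<Rightarrow> bool" where
  "momentum_eq \<Omega> u P F \<longleftrightarrow>
     locally_integrable_on \<Omega> u \<and> locally_integrable_on \<Omega> P \<and> locally_integrable_on \<Omega> F \<and>
     (\<forall>i. \<forall>\<phi> :: spacetime \<Rightarrow> real. test_function \<Omega> \<phi> \<longrightarrow>
        (LINT p:\<Omega>|lebesgue. - (u p $ i) * (dt \<phi> p + laplacian \<phi> p) - P p * dx i \<phi> p)
          = (LINT p:\<Omega>|lebesgue. F p $ i * \<phi> p))"

text \<open>\<open>u(0) = u\<^sub>0\<close> as a weak limit in \<open>L\<^sup>2(D)\<close>.  As \<open>u(t)\<close> is defined for almost every \<open>t\<close> only,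
  a null set of times is discarded.  For fields bounded in \<open>L\<^sup>2(D)\<close> it suffices to test with
  \<open>C\<^sub>c\<^sup>\<infinity>(D)\<close>.\<close>

definition initial_value ::
  "(real^3) set \<Rightarrow> (spacetime \<Rightarrow> real^3) \<Rightarrow> (real^3 \<Rightarrow> real^3) \<Rightarrow> bool" where
  "initial_value D u u0 \<longleftrightarrow> L2_on D u0 \<and>
     (\<exists>N. negligible N \<and> (\<forall>\<psi> :: real^3 \<Rightarrow> real^3. test_function D \<psi> \<longrightarrow>
        ((\<lambda>t. LINT x:D|lebesgue. u (t, x) \<bullet> \<psi> x) \<longlongrightarrow> (LINT x:D|lebesgue. u0 x \<bullet> \<psi> x))
          (at 0 within ({0<..} - N))))"

text \<open>In what follows \<open>Gz\<close>, \<open>Gv\<close>, \<open>Gu\<close> are the weak Jacobians of \<open>z\<close>, \<open>v\<close>, \<open>u\<close>, so that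
  \<open>Gw *v w\<close> is \<open>(w \<cdot> \<nabla>)w\<close>.  The boundary condition is contained in \<open>H\<^sup>1\<^sub>0\<close>.\<close>

definition stokes_solution ::
  "(real^3) set \<Rightarrow> (spacetime \<Rightarrow> real^3) \<Rightarrow> (spacetime \<Rightarrow> real^3) \<Rightarrow> (spacetime \<Rightarrow> real^3^3) \<Rightarrow>
     (spacetime \<Rightarrow> real) \<Rightarrow> bool" where
  "stokes_solution D f z Gz Q \<longleftrightarrow>
     Linf_loc_L2 D z \<and> L2_loc_H10_with_grad D z Gz \<and>
     momentum_eq ({0<..} \<times> D) z Q f \<and> div_free ({0<..} \<times> D) z \<and>
     initial_value D z (\<lambda>x. 0)"

definition modified_NS ::
  "(real^3) set \<Rightarrow> (real^3 \<Rightarrow> real^3) \<Rightarrow> (spacetime \<Rightarrow> real^3) \<Rightarrow> (spacetime \<Rightarrow> real^3^3) \<Rightarrow>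
     (spacetime \<Rightarrow> real^3) \<Rightarrow> (spacetime \<Rightarrow> real^3^3) \<Rightarrow> (spacetime \<Rightarrow> real) \<Rightarrow> bool" where
  "modified_NS D u0 z Gz v Gv \<pi> \<longleftrightarrow>
     L2_loc_H10_with_grad D v Gv \<and>
     momentum_eq ({0<..} \<times> D) v \<pi> (\<lambda>p. - ((Gv p + Gz p) *v (v p + z p))) \<and>
     div_free ({0<..} \<times> D) v \<and> initial_value D v u0"

text \<open>The norm on \<open>real^3^3\<close> is the Frobenius norm.  Since the Bochner integral of a non-integrable
  function is \<open>0\<close>, the existence of the integrals has to be demanded explicitly.\<close>

definition local_energy_inequality ::
  "(real^3) set \<Rightarrow> (spacetime \<Rightarrow> real^3) \<Rightarrow> (spacetime \<Rightarrow> real^3) \<Rightarrow> (spacetime \<Rightarrow> real^3^3) \<Rightarrow>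
     (spacetime \<Rightarrow> real) \<Rightarrow> bool" where
  "local_energy_inequality D z v Gv \<pi> \<longleftrightarrow>
     (\<forall>T>0. AE t in lebesgue. t \<in> {0<..T} \<longrightarrow>
       (\<forall>\<phi> :: spacetime \<Rightarrow> real. test_function ({0<..T} \<times> D) \<phi> \<and> (\<forall>p. 0 \<le> \<phi> p) \<longrightarrow>
         (let C = {0<..<t} \<times> D;
              a = (\<lambda>x. (norm (v (t, x)))\<^sup>2 * \<phi> (t, x));
              b = (\<lambda>p. \<phi> p * (norm (Gv p))\<^sup>2);
              c = (\<lambda>p. (norm (v p))\<^sup>2 * (dt \<phi> p + laplacian \<phi> p));
              d = (\<lambda>p. ((norm (v p))\<^sup>2 + 2 * (v p \<bullet> z p)) * ((v p + z p) \<bullet> grad \<phi> p));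
              e = (\<lambda>p. \<phi> p * (z p \<bullet> (Gv p *v (v p + z p))));
              g = (\<lambda>p. 2 * \<pi> p * (v p \<bullet> grad \<phi> p))
          in a absolutely_integrable_on D \<and>
             b absolutely_integrable_on C \<and> c absolutely_integrable_on C \<and>
             d absolutely_integrable_on C \<and> e absolutely_integrable_on C \<and>
             g absolutely_integrable_on C \<and>
             (LINT x:D|lebesgue. a x) + 2 * (LINT p:C|lebesgue. b p)
               \<le> (LINT p:C|lebesgue. c p) + (LINT p:C|lebesgue. d p)
                 + 2 * (LINT p:C|lebesgue. e p) + (LINT p:C|lebesgue. g p))))"

text \<open>In this energy class the field \<open>z\<close> is uniquely determined by \<open>f\<close>, and \<open>Q\<close> up to a function
  of time only, which affects neither the equations nor the energy inequality; hence the
  existential quantifier over \<open>(z, Q)\<close> amounts to a definite description.\<close>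

definition suitable_weak_solution ::
  "(real^3) set \<Rightarrow> (real^3 \<Rightarrow> real^3) \<Rightarrow> (spacetime \<Rightarrow> real^3) \<Rightarrow>
     (spacetime \<Rightarrow> real^3) \<Rightarrow> (spacetime \<Rightarrow> real) \<Rightarrow> bool" where
  "suitable_weak_solution D u0 f u P \<longleftrightarrow>
     (\<exists>z Gz Q Gu. stokes_solution D f z Gz Q \<and>
        Linf_L2 {0<..} D u \<and> L2_loc_H10_with_grad D u Gu \<and>
        (\<forall>T>0. Lp_loc (5/3) ({0<..<T} \<times> D) P) \<and>
        (let v = (\<lambda>p. u p - z p); Gv = (\<lambda>p. Gu p - Gz p); \<pi> = (\<lambda>p. P p - Q p)
         in modified_NS D u0 z Gz v Gv \<pi> \<and> local_energy_inequality D z v Gv \<pi>))"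


section \<open>Singular set and Hausdorff measure\<close>

definition regular_point :: "spacetime set \<Rightarrow> (spacetime \<Rightarrow> real^3) \<Rightarrow> spacetime \<Rightarrow> bool" where
  "regular_point \<Omega> u p \<longleftrightarrow>
     (\<exists>U M. open U \<and> p \<in> U \<and> U \<subseteq> \<Omega> \<and> (AE q in lebesgue. q \<in> U \<longrightarrow> norm (u q) \<le> M))"

definition singular_set :: "spacetime set \<Rightarrow> (spacetime \<Rightarrow> real^3) \<Rightarrow> spacetime set" where
  "singular_set \<Omega> u = {p\<in>\<Omega>. \<not> regular_point \<Omega> u p}"

text \<open>The function \<open>diameter\<close> is \<open>0\<close> on unbounded sets, so boundedness of the covering sets is
  part of the definition.\<close>

definition hausdorff1_pre :: "real \<Rightarrow> 'a::metric_space set \<Rightarrow> ennreal" where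
  "hausdorff1_pre \<delta> A =
     (INF U \<in> {U :: nat \<Rightarrow> 'a set. A \<subseteq> (\<Union>n. U n) \<and> (\<forall>n. bounded (U n) \<and> diameter (U n) \<le> \<delta>)}.
        \<Sum>n. ennreal (diameter (U n)))"

definition hausdorff1 :: "'a::metric_space set \<Rightarrow> ennreal" where
  "hausdorff1 A = (SUP \<delta>\<in>{0<..}. hausdorff1_pre \<delta> A)"

end

theory Submission
  imports Defs "HOL-Computational_Algebra.Polynomial"
begin

text \<open>On the unit ball the solution is axisymmetric swirl without poloidal part:
  \<open>u = h * (- x2, x1, 0)\<close> with \<open>h(t, x) = \<bar>x\<bar> powr (- 5/4)\<close> up to bounded factors near the origin, so \<open>u\<close> is
  singular on the whole segment \<open>{t > 0} \<times> {0}\<close>, which has positive length.  The force acts through \<open>z\<close>,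
  so \<open>v = u - z\<close> can be prescribed: it has to satisfy
  \<open>\<partial>\<^sub>t v - \<Delta> v + \<nabla>\<pi> = - (u * \<nabla>)u = h\<^sup>2 * (x1, x2, 0)\<close>.  For a solenoidal field \<open>v\<close> without swirl, built from a
  profile in the time and the squared radius, this equation defines \<open>\<pi>\<close> and \<open>h\<^sup>2\<close> explicitly.  What remains
  is to choose the profile so that the expression for \<open>h\<^sup>2\<close> is nonnegative, vanishes to second order on the
  sphere, and has the singularity \<open>\<bar>x\<bar> powr (- 5/2)\<close> at the origin.  Then \<open>z = u - v\<close> and \<open>f = \<partial>\<^sub>t z - \<Delta> z\<close>.  Since
  \<open>v\<close> is bounded and the singularities of all fields are weak, integration by parts is legitimate
  and the local energy inequality holds with equality.\<close>

section \<open>Smooth functions\<close>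

text \<open>The components of \<open>x3 * (x2, - x1, 0)\<close> are harmonic polynomials of degree
  2, and \<open>v\<close> is the curl of this field times a radial function; so the heat operator
  acts on the radial profile alone. The pressure cancels the third component, and its free summand
  \<open>24 * ee t^42 * (x1^2 + x2^2)\<close> puts the constant \<open>48 * ee t^42\<close> into
  \<open>h^2\<close>. The obstacle is the sphere: \<open>h\<close> itself has to vanish and stay
  differentiable there, so \<open>h^2\<close> needs a double zero with a positive cofactor. With
  \<open>y = 1 - s\<close> and \<open>e = ee t\<close>, the constant is cancelled there by the
  fourth derivative of a boundary layer \<open>y^4 / (4 * (y^2 + e))\<close> of width
  \<open>sqrt e\<close>; a term in \<open>y^5\<close> removes the first-order remainder. For the
  amplitude \<open>e^43\<close> the viscous term in the layer and the time derivative are both at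
  most of the size \<open>e^42\<close> of the constant, uniformly as \<open>t\<close> tends to 0.
  The singularity has its own summand \<open>s powr (3/4) * (1 - s)^6 / 100\<close>, flat at the
  sphere; its fourth derivative enters \<open>h^2\<close> as a positive multiple of
  \<open>s powr (- (5/4))\<close> near the origin.\<close>

lemma frechet_derivative_cong_open:
  assumes "open S" "x \<in> S" "\<And>y. y \<in> S \<Longrightarrow> f y = g y"
  shows "frechet_derivative f (at x) = frechet_derivative g (at x)"
proof -
  have "(f has_derivative D) (at x) \<longleftrightarrow> (g has_derivative D) (at x)" for D
    using has_derivative_transform_within_open[of f D x UNIV S g]
      has_derivative_transform_within_open[of g D x UNIV S f] assms by auto
  then show ?thesis unfolding frechet_derivative_def by simp
qed

lemma differentiable_cong_open:
  assumes "open S" "x \<in> S" "\<And>y. y \<in> S \<Longrightarrow> f y = g y" "f differentiable (at x)"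
  shows "g differentiable (at x)"
  using assms has_derivative_transform_within_open[of f _ x UNIV S g]
  unfolding differentiable_def by auto

lemma Ck_on_cong:
  assumes "open S" "\<And>y. y \<in> S \<Longrightarrow> f y = g y" "Ck_on k S f"
  shows "Ck_on k S g"
  using assms(2,3)
proof (induction k arbitrary: f g)
  case 0
  then show ?case by (simp cong: continuous_on_cong)
next
  case (Suc k)
  have "Ck_on k S (\<lambda>x. frechet_derivative g (at x) b)" if "b \<in> Basis" for b
    using Suc.IH[of "\<lambda>x. frechet_derivative f (at x) b" "\<lambda>x. frechet_derivative g (at x) b"]
      Suc.prems that frechet_derivative_cong_open[OF assms(1), of _ f g] by auto
  moreover have "g differentiable (at x)" if "x \<in> S" for x
    using differentiable_cong_open[OF assms(1) that] Suc.prems that by auto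
  ultimately show ?case by auto
qed

lemma Ck_on_Un: "open S \<Longrightarrow> open T \<Longrightarrow> Ck_on k S f \<Longrightarrow> Ck_on k T f \<Longrightarrow> Ck_on k (S \<union> T) f"
  by (induction k arbitrary: f) (auto intro: continuous_on_open_Un)

lemma Ck_on_continuous: "Ck_on k S f \<Longrightarrow> continuous_on S f"
  by (cases k) (auto intro!: continuous_at_imp_continuous_on differentiable_imp_continuous_within)

lemma Ck_on_SucD: "Ck_on (Suc k) S f \<Longrightarrow> Ck_on k S f"
proof (induction k arbitrary: f)
  case 0
  then show ?case using Ck_on_continuous[of "Suc 0" S f] by simp
next
  case (Suc k)
  then show ?case by auto
qed

lemma Ck_on_const: "Ck_on k S (\<lambda>x. c)"
  by (induction k arbitrary: c) (auto simp: frechet_derivative_const)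

lemma Ck_on_bounded_linear:
  assumes "bounded_linear f" shows "Ck_on k S f"
proof (cases k)
  case 0
  then show ?thesis using assms by (simp add: linear_continuous_on)
next
  case (Suc n)
  have "(f has_derivative f) (at x)" for x by (rule bounded_linear_imp_has_derivative[OF assms])
  then have "frechet_derivative f (at x) = f" "f differentiable (at x)" for x
    by (metis frechet_derivative_at, auto simp: differentiable_def)
  then show ?thesis using Suc Ck_on_const[where k=n and S=S] by (auto simp: Ck_on_const)
qed

lemma Ck_on_add:
  assumes "open S" "Ck_on k S f" "Ck_on k S g"
  shows "Ck_on k S (\<lambda>x. f x + g x)"
  using assms(2,3)
proof (induction k arbitrary: f g)
  case 0
  then show ?case by (auto intro: continuous_intros)
next
  case (Suc k)
  have fg: "frechet_derivative (\<lambda>x. f x + g x) (at x) =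
    (\<lambda>b. frechet_derivative f (at x) b + frechet_derivative g (at x) b)" if "x \<in> S" for x
    by (rule sym, rule frechet_derivative_at)
      (use Suc.prems that in \<open>auto intro!: has_derivative_add simp: frechet_derivative_works\<close>)
  have "Ck_on k S (\<lambda>x. frechet_derivative (\<lambda>x. f x + g x) (at x) b)" if "b \<in> Basis" for b
    by (rule Ck_on_cong[OF assms(1), of "\<lambda>x. frechet_derivative f (at x) b + frechet_derivative g (at x) b"])
      (use Suc that in \<open>auto simp: fg\<close>)
  then show ?case using Suc by auto
qed

lemma Ck_on_mult:
  fixes f g :: "'a::euclidean_space \<Rightarrow> real"
  assumes "open S" "Ck_on k S f" "Ck_on k S g"
  shows "Ck_on k S (\<lambda>x. f x * g x)"
  using assms(2,3)
proof (induction k arbitrary: f g)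
  case 0
  then show ?case by (auto intro: continuous_intros)
next
  case (Suc k)
  have sub: "Ck_on k S f" "Ck_on k S g" using Suc.prems Ck_on_SucD by blast+
  have fg: "frechet_derivative (\<lambda>x. f x * g x) (at x) =
    (\<lambda>b. f x * frechet_derivative g (at x) b + frechet_derivative f (at x) b * g x)" if "x \<in> S" for x
  proof (rule sym, rule frechet_derivative_at)
    show "((\<lambda>x. f x * g x) has_derivative (\<lambda>b. f x * frechet_derivative g (at x) b + frechet_derivative f (at x) b * g x)) (at x)"
      using Suc.prems that by (intro has_derivative_mult) (auto simp: frechet_derivative_works)
  qed
  have "Ck_on k S (\<lambda>x. frechet_derivative (\<lambda>x. f x * g x) (at x) b)" if "b \<in> Basis" for b
    by (rule Ck_on_cong[OF assms(1), of "\<lambda>x. f x * frechet_derivative g (at x) b + frechet_derivative f (at x) b * g x"])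
      (use that sub Suc.prems in \<open>auto simp: fg intro!: Ck_on_add assms(1) Suc.IH\<close>)
  then show ?case using Suc by auto
qed

text \<open>The outer function comes with the whole sequence \<open>d\<close> of its derivatives, so
  the induction can move from \<open>d n\<close> to \<open>d (Suc n)\<close> while the order
  \<open>k\<close> drops.\<close>

lemma Ck_on_compose_real:
  fixes g :: "'a::euclidean_space \<Rightarrow> real" and d :: "nat \<Rightarrow> real \<Rightarrow> real"
  assumes "open S" "\<And>n x. (d n has_real_derivative d (Suc n) x) (at x)" "Ck_on k S g"
  shows "Ck_on k S (\<lambda>x. d n (g x))"
  using assms(3)
proof (induction k arbitrary: n)
  case 0
  have "continuous_on UNIV (d n)"
    using assms(2) by (intro continuous_at_imp_continuous_on) (auto intro: DERIV_isCont)
  then show ?case using 0 by (auto intro: continuous_on_compose2)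
next
  case (Suc k)
  have D: "((\<lambda>x. d n (g x)) has_derivative (\<lambda>b. frechet_derivative g (at x) b * d (Suc n) (g x))) (at x)"
    if "x \<in> S" for x
  proof -
    have "(g has_derivative frechet_derivative g (at x)) (at x)"
      using Suc.prems that by (auto simp: frechet_derivative_works)
    from DERIV_compose_FDERIV[OF assms(2) this] show ?thesis by simp
  qed
  have "Ck_on k S (\<lambda>x. frechet_derivative (\<lambda>x. d n (g x)) (at x) b)" if "b \<in> Basis" for b
    by (rule Ck_on_cong[OF assms(1), of "\<lambda>x. frechet_derivative g (at x) b * d (Suc n) (g x)"])
      (use Suc that Ck_on_SucD[of k S] frechet_derivative_at[OF D] in
        \<open>auto intro!: Ck_on_mult assms(1) simp: fun_eq_iff\<close>)
  then show ?case using Suc D by (auto simp: differentiable_def)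
qed

lemma has_derivative_vec_lambda_at:
  fixes f :: "'i::finite \<Rightarrow> 'a::euclidean_space \<Rightarrow> real"
  assumes "\<And>i. (f i has_derivative f' i) (at x)"
  shows "((\<lambda>x. \<chi> i. f i x) has_derivative (\<lambda>h. \<chi> i. f' i h)) (at x)"
  using assms unfolding has_derivative_componentwise_within[of "\<lambda>x. \<chi> i. f i x"]
  by (auto simp: Basis_vec_def inner_axis)

lemma Ck_on_vec:
  fixes f :: "'i::finite \<Rightarrow> 'a::euclidean_space \<Rightarrow> real"
  assumes "open S" "\<And>i. Ck_on k S (f i)"
  shows "Ck_on k S (\<lambda>x. \<chi> i. f i x)"
  using assms(2)
proof (induction k arbitrary: f)
  case 0
  then show ?case by (auto intro: continuous_on_vec_lambda)
next
  case (Suc k)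
  have D: "((\<lambda>x. \<chi> i. f i x) has_derivative (\<lambda>h. \<chi> i. frechet_derivative (f i) (at x) h)) (at x)"
    if "x \<in> S" for x
    using Suc.prems that by (intro has_derivative_vec_lambda_at) (auto simp: frechet_derivative_works)
  have "Ck_on k S (\<lambda>x. frechet_derivative (\<lambda>x. \<chi> i. f i x) (at x) b)" if "b \<in> Basis" for b
    by (rule Ck_on_cong[OF assms(1), of "\<lambda>x. \<chi> i. frechet_derivative (f i) (at x) b"])
      (use Suc that frechet_derivative_at[OF D] in \<open>auto simp: fun_eq_iff\<close>)
  then show ?case using D by (auto simp: differentiable_def)
qed

section \<open>The unit ball as a domain with smooth boundary\<close>

lemma smooth_on_inner_self: "smooth_on S (\<lambda>x::'a::euclidean_space. x \<bullet> x - 1)"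
proof -
  have D: "((\<lambda>x::'a. x \<bullet> x - 1) has_derivative (\<lambda>h. 2 * (x \<bullet> h))) (at x)" for x
    by (auto intro!: derivative_eq_intros simp: inner_commute)
  have "Ck_on k S (\<lambda>x::'a. x \<bullet> x - 1)" for k
  proof (cases k)
    case 0 then show ?thesis by (auto intro!: continuous_intros)
  next
    case (Suc n)
    have "Ck_on n S (\<lambda>x. 2 * (x \<bullet> b))" for b :: 'a
      by (rule Ck_on_bounded_linear) (auto intro!: bounded_linear_intros)
    then show ?thesis using Suc D frechet_derivative_at[OF D]
      by (auto simp: differentiable_def fun_eq_iff)
  qed
  then show ?thesis by (simp add: smooth_on_def)
qed

lemma regular_bounded_domain_ball: "regular_bounded_domain (ball 0 1 :: (real^3) set)"
  unfolding regular_bounded_domain_def regular_boundary_def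
proof (intro conjI ballI)
  fix p :: "real^3" assume "p \<in> frontier (ball 0 1)"
  then have p: "norm p = 1" by simp
  have D: "((\<lambda>x::real^3. x \<bullet> x - 1) has_derivative (\<lambda>h. 2 * (x \<bullet> h))) (at x)" for x
    by (auto intro!: derivative_eq_intros simp: inner_commute)
  \<comment> \<open>The gradient \<open>2 * x\<close> vanishes at 0 only, so the complement of
    \<open>{0}\<close> serves as one neighbourhood for all boundary points.\<close>
  have "frechet_derivative (\<lambda>x::real^3. x \<bullet> x - 1) (at x) \<noteq> (\<lambda>h. 0)" if "x \<noteq> 0" for x
    using frechet_derivative_at[OF D, of x] that by (metis inner_eq_zero_iff mult_eq_0_iff zero_neq_numeral)
  moreover have "ball 0 1 \<inter> (- {0}) = {x \<in> - {0::real^3}. x \<bullet> x - 1 < 0}"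
    by (auto simp: dot_square_norm power_less_one_iff)
  ultimately show "\<exists>U (\<rho> :: real^3 \<Rightarrow> real). open U \<and> p \<in> U \<and> smooth_on U \<rho> \<and>
        (\<forall>x\<in>U. frechet_derivative \<rho> (at x) \<noteq> (\<lambda>h. 0)) \<and> ball 0 1 \<inter> U = {x\<in>U. \<rho> x < 0}"
    using p smooth_on_inner_self
    by (intro exI[of _ "- {0::real^3}"] exI[of _ "\<lambda>x. x \<bullet> x - 1"]) auto
qed auto

section \<open>A flat cutoff function\<close>

text \<open>The functions \<open>p(1/x) * exp(- 1/x)\<close> form a family closed under
  differentiation, so smoothness at 0 reduces to a single difference quotient. The member
  \<open>flat 1\<close> rises from 0 to its limit 1 at infinity: composed with
  \<open>n * (x \<bullet> x) - 1\<close> it cuts off the origin, with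
  \<open>n * (1 - x \<bullet> x) - 1\<close> the sphere.\<close>

definition flat :: "real poly \<Rightarrow> real \<Rightarrow> real" where
  "flat p x = (if x > 0 then poly p (1 / x) * exp (- (1 / x)) else 0)"

lemma power_le_fact_exp:
  fixes u :: real assumes "u \<ge> 0" shows "u ^ n \<le> fact n * exp u"
proof -
  have "(\<lambda>k. u ^ k /\<^sub>R fact k) sums exp u" by (rule exp_converges)
  then have "(\<Sum>k\<in>{n}. u ^ k /\<^sub>R fact k) \<le> exp u"
    using assms by (intro sum_le_suminf[THEN order_trans]) (auto simp: sums_iff)
  then show ?thesis by (simp add: field_simps)
qed

lemma flat_bounded: "\<exists>C\<ge>0. \<forall>x. \<bar>flat p x\<bar> \<le> C"
proof -
  let ?C = "\<Sum>i\<le>degree p. \<bar>coeff p i\<bar> * fact i"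
  have "\<bar>poly p u * exp (-u)\<bar> \<le> ?C" if "u > 0" for u
  proof -
    have "\<bar>poly p u\<bar> \<le> (\<Sum>i\<le>degree p. \<bar>coeff p i\<bar> * u ^ i)"
      unfolding poly_altdef using that
      by (intro order_trans[OF sum_abs]) (auto simp: abs_mult)
    also have "\<dots> \<le> (\<Sum>i\<le>degree p. \<bar>coeff p i\<bar> * (fact i * exp u))"
      using that by (intro sum_mono mult_left_mono power_le_fact_exp) auto
    also have "\<dots> = ?C * exp u" by (subst sum_distrib_right) (simp add: mult_ac)
    finally show ?thesis by (simp add: abs_mult exp_minus divide_simps)
  qed
  moreover have "0 \<le> ?C" by (auto intro!: sum_nonneg)
  ultimately show ?thesis by (intro exI[of _ ?C]) (auto simp: flat_def)
qed

text \<open>Trades a factor \<open>x\<close> for one power of \<open>1/x\<close>; this is how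
  growing factors are absorbed into bounded members of the family.\<close>

lemma flat_mult_X: "x * flat (p * [:0, 1:]) x = flat p x"
  by (auto simp: flat_def)

text \<open>With \<open>u = 1/x\<close>, the derivative in \<open>x\<close> is \<open>- u^2\<close>
  times the derivative in \<open>u\<close>, and the latter sends \<open>p(u) * exp(- u)\<close> to
  \<open>(p' - p)(u) * exp(- u)\<close>.\<close>

definition flat_next :: "real poly \<Rightarrow> real poly" where
  "flat_next p = (p - pderiv p) * [:0, 1:] * [:0, 1:]"

lemma flat_has_real_derivative: "(flat p has_real_derivative flat (flat_next p) x) (at x)"
proof -
  consider "x > 0" | "x < 0" | "x = 0" by linarith
  then show ?thesis
  proof cases
    case 1
    have "((\<lambda>x. poly p (1 / x) * exp (- (1 / x))) has_real_derivative flat (flat_next p) x) (at x)"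
      using 1 unfolding flat_def flat_next_def
      by (auto intro!: derivative_eq_intros DERIV_chain2[OF poly_DERIV] simp: field_simps power2_eq_square)
    then show ?thesis
      by (rule has_field_derivative_transform_within_open[of _ _ _ "{0<..}"]) (use 1 in \<open>auto simp: flat_def\<close>)
  next
    case 2
    have "((\<lambda>x. 0) has_real_derivative 0) (at x)" by simp
    then have "(flat p has_real_derivative 0) (at x)"
      by (rule has_field_derivative_transform_within_open[of _ _ _ "{..<0}"]) (use 2 in \<open>auto simp: flat_def\<close>)
    then show ?thesis using 2 by (simp add: flat_def)
  next
    case 3
    obtain C where C: "\<And>x. \<bar>flat (p * [:0, 1:] * [:0, 1:]) x\<bar> \<le> C" using flat_bounded by blast
    \<comment> \<open>The difference quotient at 0 is \<open>h\<close> times a bounded member of the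
      family, hence tends to 0.\<close>
    have q: "flat p h / h = h * flat (p * [:0, 1:] * [:0, 1:]) h" for h
      using flat_mult_X[of h p] flat_mult_X[of h "p * [:0, 1:]"] by (cases "h = 0") (auto simp: field_simps flat_def)
    have "((\<lambda>h. flat p h / h) \<longlongrightarrow> 0) (at 0)"
    proof (rule Lim_null_comparison)
      show "\<forall>\<^sub>F h in at 0. norm (flat p h / h) \<le> C * \<bar>h\<bar>"
        unfolding q using C by (intro always_eventually) (auto simp: abs_mult mult.commute[of C] intro!: mult_left_mono simp del: mult_pCons_right)
      show "((\<lambda>h. C * \<bar>h\<bar>) \<longlongrightarrow> 0) (at 0)" by (auto intro!: tendsto_eq_intros)
    qed
    then show ?thesis unfolding DERIV_def 3 by (simp add: flat_def)
  qed
qed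

lemma Ck_on_flat:
  fixes g :: "'a::euclidean_space \<Rightarrow> real"
  assumes "open S" "Ck_on k S g"
  shows "Ck_on k S (\<lambda>x. flat p (g x))"
proof -
  have "(flat ((flat_next ^^ n) p) has_real_derivative flat ((flat_next ^^ Suc n) p) x) (at x)" for n x
    using flat_has_real_derivative by simp
  from Ck_on_compose_real[where n=0 and d="\<lambda>n. flat ((flat_next ^^ n) p)", OF assms(1) this assms(2)]
  show ?thesis by simp
qed

lemma flat_1_bounds: "0 \<le> flat 1 x" "flat 1 x \<le> 1"
  by (auto simp: flat_def)

lemma flat_1_tendsto: "(flat 1 \<longlongrightarrow> 1) at_top"
proof -
  have "((\<lambda>x::real. exp (- (1 / x))) \<longlongrightarrow> exp (- 0)) at_top"
    by (intro tendsto_intros tendsto_divide_0[OF tendsto_const] filterlim_at_top_imp_at_infinity filterlim_ident)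
  then have "((\<lambda>x::real. exp (- (1 / x))) \<longlongrightarrow> 1) at_top" by simp
  moreover have "\<forall>\<^sub>F x in at_top. exp (- (1 / x)) = flat 1 x"
    using eventually_gt_at_top[of 0] by eventually_elim (simp add: flat_def)
  ultimately show ?thesis by (rule Lim_transform_eventually)
qed

text \<open>At radius \<open>r\<close> the cutoff has the argument \<open>x = n * r^2 - 1\<close>,
  so \<open>x + 1 = n * r^2\<close>. Its gradient, \<open>2 * n * r\<close> times
  \<open>flat (flat_next 1) x\<close> in absolute value, is therefore at most
  \<open>2 * C / r\<close>, uniformly in \<open>n\<close>.\<close>

lemma flat_next_1_bound: "\<exists>C\<ge>0. \<forall>x. \<bar>(x + 1) * flat (flat_next 1) x\<bar> \<le> C"
proof -
  obtain C1 C2 where C: "C1 \<ge> 0" "C2 \<ge> 0" "\<And>x. \<bar>flat [:0, 1:] x\<bar> \<le> C1" "\<And>x. \<bar>flat (flat_next 1) x\<bar> \<le> C2"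
    using flat_bounded by meson
  have "flat (flat_next 1) x = flat ([:0, 1:] * [:0, 1:]) x" for x by (simp add: flat_next_def)
  then have "(x + 1) * flat (flat_next 1) x = flat [:0, 1:] x + flat (flat_next 1) x" for x
    using flat_mult_X[of x "[:0, 1:]"] by (metis distrib_right mult_1)
  then have "\<bar>(x + 1) * flat (flat_next 1) x\<bar> \<le> C1 + C2" for x
    using C(3)[of x] C(4)[of x] abs_triangle_ineq[of "flat [:0, 1:] x" "flat (flat_next 1) x"]
    by (metis add_mono order_trans)
  then show ?thesis using C by (intro exI[of _ "C1 + C2"]) auto
qed

section \<open>Integration by parts\<close>

text \<open>The difference quotients of \<open>h\<close> in the direction \<open>b\<close> have
  integral 0 by translation invariance, and the mean value theorem gives them a common integrable
  majorant; dominated convergence passes this on to \<open>h'\<close>.\<close>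

lemma integral_directional_derivative_eq_0:
  fixes h h' :: "'a::euclidean_space \<Rightarrow> real"
  assumes D: "\<And>x. ((\<lambda>r. h (x + r *\<^sub>R b)) has_real_derivative h' x) (at 0)"
    and bd: "\<And>x. \<bar>h' x\<bar> \<le> C" and b: "norm b \<le> 1"
    and int: "integrable lborel h" and supp: "\<And>x. norm x > R \<Longrightarrow> h x = 0"
  shows "(LINT x|lborel. h' x) = 0"
proof -
  have Dr: "((\<lambda>r. h (x + r *\<^sub>R b)) has_real_derivative h' (x + r *\<^sub>R b)) (at r)" for x r
  proof -
    have "((\<lambda>\<tau>. h ((x + r *\<^sub>R b) + (- r + \<tau>) *\<^sub>R b)) has_real_derivative h' (x + r *\<^sub>R b)) (at r)"
      using D[of "x + r *\<^sub>R b"] DERIV_shift[of "\<lambda>\<tau>. h ((x + r *\<^sub>R b) + \<tau> *\<^sub>R b)" _ r "-r"]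
      by (simp add: add.commute)
    then show ?thesis by (simp add: algebra_simps)
  qed
  define q where "q n x = real (Suc n) * (h (x + (1 / real (Suc n)) *\<^sub>R b) - h x)" for n x
  have [measurable]: "h \<in> borel_measurable borel" using int by auto
  have qlim: "(\<lambda>n. q n x) \<longlonglongrightarrow> h' x" for x
  proof -
    have "((\<lambda>r. (h (x + r *\<^sub>R b) - h x) / r) \<longlongrightarrow> h' x) (at 0)"
      using D[of x] by (simp add: DERIV_def)
    moreover have "filterlim (\<lambda>n. 1 / real (Suc n)) (at 0) sequentially"
      by (intro filterlim_atI LIMSEQ_Suc lim_1_over_n) auto
    ultimately show ?thesis
      using filterlim_compose[of "\<lambda>r. (h (x + r *\<^sub>R b) - h x) / r"] unfolding q_def
      by (fastforce simp: field_simps)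
  qed
  \<comment> \<open>The step length \<open>1 / Suc n\<close> is at most 1 and \<open>b\<close> has
    norm at most 1, so both values of \<open>h\<close> vanish outside the ball of radius
    \<open>R + 1\<close>.\<close>
  have qb: "norm (q n x) \<le> C * indicator (cball 0 (R + 1)) x" for n x
  proof (cases "norm x \<le> R + 1")
    case True
    obtain z where "h (x + (1 / real (Suc n)) *\<^sub>R b) - h (x + 0 *\<^sub>R b) = (1 / real (Suc n) - 0) * h' (x + z *\<^sub>R b)"
      using MVT2[of 0 "1 / real (Suc n)" "\<lambda>r. h (x + r *\<^sub>R b)" "\<lambda>r. h' (x + r *\<^sub>R b)"] Dr by auto
    then have "q n x = h' (x + z *\<^sub>R b)" unfolding q_def by (simp add: field_simps)
    then show ?thesis using True bd by simp
  next
    case False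
    have "norm x \<le> norm (x + (1 / real (Suc n)) *\<^sub>R b) + norm ((1 / real (Suc n)) *\<^sub>R b)"
      by (metis add_diff_cancel_right' norm_triangle_ineq4)
    moreover have "norm ((1 / real (Suc n)) *\<^sub>R b) \<le> 1" using b by (simp add: divide_simps)
    ultimately have "norm (x + (1 / real (Suc n)) *\<^sub>R b) > R" using False by linarith
    then show ?thesis using False supp[of x] supp[of "x + (1 / real (Suc n)) *\<^sub>R b"] by (simp add: q_def)
  qed
  have shift: "(LINT x|lborel. h (x + c)) = (LINT x|lborel. h x)" "integrable lborel (\<lambda>x. h (x + c))" for c
    using lborel_distr_plus[of c] int
      integral_distr[of "(+) c" lborel borel h] integrable_distr_eq[of "(+) c" lborel borel h]
    by (simp_all add: add.commute)
  have "(\<lambda>n. LINT x|lborel. q n x) \<longlonglongrightarrow> (LINT x|lborel. h' x)"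
  proof (rule integral_dominated_convergence[where w="\<lambda>x. C * indicator (cball 0 (R + 1)) x"])
    have [measurable]: "q n \<in> borel_measurable lborel" for n unfolding q_def by measurable
    show "h' \<in> borel_measurable lborel"
      by (rule borel_measurable_LIMSEQ_real[where u=q]) (rule qlim, measurable)
    show "q n \<in> borel_measurable lborel" for n by measurable
    have "emeasure lborel (cball (0::'a) (R + 1)) < \<infinity>" by (rule emeasure_bounded_finite) auto
    then show "integrable lborel (\<lambda>x::'a. C * indicator (cball 0 (R + 1)) x)"
      by (intro integrable_mult_right) (auto simp: integrable_indicator_iff)
  qed (use qlim qb in auto)
  moreover have "(LINT x|lborel. q n x) = 0" for n
    unfolding q_def integral_mult_right_zero Bochner_Integration.integral_diff[OF shift(2) int] shift(1) by simp
  ultimately show ?thesis by (simp add: LIMSEQ_const_iff)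
qed

section \<open>Integrability of powers of the norm\<close>

text \<open>Dyadic comparison with \<open>r n = (1/2)^n\<close>: a point with
  \<open>r (Suc N) \<le> norm x < r N\<close> is charged to the summand number \<open>N\<close>. The
  integrals of the summands are multiples of \<open>2 powr (- (d - p) * n)\<close> with the
  dimension \<open>d\<close>, a geometric series because \<open>p < d\<close>.\<close>

lemma nn_integral_norm_powr_ball:
  fixes p :: real
  assumes p: "0 \<le> p" "p < DIM('a::euclidean_space)"
  shows "(\<integral>\<^sup>+x\<in>ball (0::'a) 1. ennreal (norm x powr (- p)) \<partial>lborel) < \<infinity>"
proof -
  let ?d = "DIM('a)"
  define r :: "nat \<Rightarrow> real" where "r n = (1 / 2) ^ n" for n
  have r: "r n > 0" for n by (simp add: r_def)
  have bound: "ennreal (norm x powr (- p)) * indicator (ball 0 1) x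
      \<le> (\<Sum>n. ennreal (r (Suc n) powr (- p)) * indicator (ball 0 (r n)) x)" for x :: 'a
  proof (cases "x \<in> ball 0 1 \<and> x \<noteq> 0")
    case True
    then have x: "0 < norm x" "norm x < 1" by auto
    define n where "n = (LEAST n. r n \<le> norm x)"
    have "\<exists>n. r n \<le> norm x"
      using real_arch_pow_inv[of "norm x" "1 / 2"] x unfolding r_def by (auto intro: less_imp_le)
    then have n: "r n \<le> norm x" unfolding n_def by (rule LeastI_ex)
    have "n \<noteq> 0" using n x by (cases n) (auto simp: r_def)
    then obtain N where N: "n = Suc N" by (cases n) auto
    have "\<not> r N \<le> norm x" using not_less_Least[of N "\<lambda>n. r n \<le> norm x"] N by (simp add: n_def)
    then have xN: "x \<in> ball 0 (r N)" by simp
    have "norm x powr (- p) \<le> r (Suc N) powr (- p)"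
      using n N r p by (intro powr_mono2') auto
    then have "ennreal (norm x powr (- p)) * indicator (ball 0 1) x
        \<le> ennreal (r (Suc N) powr (- p)) * indicator (ball 0 (r N)) x"
      using True xN by (simp add: ennreal_leI)
    also have "\<dots> \<le> (\<Sum>n. ennreal (r (Suc n) powr (- p)) * indicator (ball 0 (r n)) x)"
    proof -
      have "(\<Sum>n\<in>{N}. ennreal (r (Suc n) powr (- p)) * indicator (ball 0 (r n)) x)
        \<le> (\<Sum>n. ennreal (r (Suc n) powr (- p)) * indicator (ball 0 (r n)) x)"
        by (rule sum_le_suminf) auto
      then show ?thesis by (simp only: sum.insert[OF finite.emptyI] sum.empty empty_iff not_False_eq_True add_0_right)
    qed
    finally show ?thesis .
  qed auto
  define q :: real where "q = (1 / 2) powr (?d - p)"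
  have q: "0 < q" "q < 1"
    using p powr_less_mono'[of "1/2" 0 "?d - p"] by (auto simp: q_def)
  have t: "r (Suc n) powr (- p) * r n ^ ?d = 2 powr p * q ^ n" for n
  proof -
    have half: "(1 / 2 :: real) = 2 powr (- 1)" by (simp add: powr_minus_divide)
    have rn: "r n = 2 powr (- real n)" for n
    proof -
      have "(1 / 2 :: real) ^ n = (2 powr (- 1)) ^ n" using half by (rule arg_cong)
      also have "\<dots> = 2 powr (real n * (- 1))" by (rule powr_power) simp
      finally show ?thesis by (simp add: r_def)
    qed
    have "q = (2 powr (- 1)) powr (?d - p)" unfolding q_def using half by (rule arg_cong)
    then have "q = 2 powr (- 1 * (?d - p))" by (simp only: powr_powr)
    then have qn: "q ^ n = 2 powr (real n * (- 1 * (?d - p)))" by (simp only: powr_power[where z="2::real", simplified])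
    have rd: "r n ^ ?d = 2 powr (real ?d * (- real n))" unfolding rn by (rule powr_power) simp
    show ?thesis
      unfolding qn rd unfolding rn powr_powr powr_add[symmetric]
      by (rule arg_cong[where f="\<lambda>a. 2 powr a"]) (simp add: algebra_simps)
  qed
  have "(\<integral>\<^sup>+x\<in>ball (0::'a) 1. ennreal (norm x powr (- p)) \<partial>lborel)
      \<le> (\<integral>\<^sup>+x. (\<Sum>n. ennreal (r (Suc n) powr (- p)) * indicator (ball 0 (r n)) (x::'a)) \<partial>lborel)"
    by (intro nn_integral_mono) (use bound in \<open>simp add: mult.commute\<close>)
  also have "\<dots> = (\<Sum>n. \<integral>\<^sup>+x. ennreal (r (Suc n) powr (- p)) * indicator (ball 0 (r n)) (x::'a) \<partial>lborel)"
    by (rule nn_integral_suminf) (intro borel_measurable_times_ennreal borel_measurable_const borel_measurable_indicator, simp)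
  also have "\<dots> = (\<Sum>n. ennreal (unit_ball_vol ?d * 2 powr p * q ^ n))"
  proof (rule suminf_cong)
    fix n
    have "(\<integral>\<^sup>+x. ennreal (r (Suc n) powr (- p)) * indicator (ball 0 (r n)) (x::'a) \<partial>lborel)
      = ennreal (r (Suc n) powr (- p)) * ennreal (unit_ball_vol ?d * r n ^ ?d)"
      using r[of n] by (subst nn_integral_cmult_indicator) (auto simp: emeasure_ball less_imp_le)
    also have "\<dots> = ennreal (unit_ball_vol ?d * (r (Suc n) powr (- p) * r n ^ ?d))"
      using r[of n] by (subst ennreal_mult[symmetric]) (auto simp: mult_ac unit_ball_vol_nonneg less_imp_le)
    finally show "(\<integral>\<^sup>+x. ennreal (r (Suc n) powr (- p)) * indicator (ball 0 (r n)) (x::'a) \<partial>lborel)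
      = ennreal (unit_ball_vol ?d * 2 powr p * q ^ n)" by (simp only: t mult.assoc)
  qed
  also have "\<dots> < \<infinity>"
    using q by (subst suminf_ennreal2) (auto intro!: summable_mult summable_geometric unit_ball_vol_nonneg simp: mult_nonneg_nonneg)
  finally show ?thesis .
qed

text \<open>A negative \<open>p\<close> is reduced to 0 by comparison with \<open>max p 0\<close>,
  since the norm is below 1.\<close>

lemma integrable_norm_powr_ball:
  fixes p :: real
  assumes p: "p < DIM('a::euclidean_space)"
  shows "integrable lborel (\<lambda>x::'a. indicator (ball 0 1) x * norm x powr (- p))"
proof -
  have "(\<integral>\<^sup>+x. ennreal (norm (indicator (ball 0 1) x * norm (x::'a) powr (- p))) \<partial>lborel)
    \<le> (\<integral>\<^sup>+x\<in>ball (0::'a) 1. ennreal (norm x powr (- max p 0)) \<partial>lborel)"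
  proof (rule nn_integral_mono)
    fix x :: 'a
    show "ennreal (norm (indicator (ball 0 1) x * norm x powr (- p))) \<le> ennreal (norm x powr (- max p 0)) * indicator (ball 0 1) x"
    proof (cases "x \<in> ball 0 1 \<and> x \<noteq> 0")
      case True
      then have "norm x powr (- p) \<le> norm x powr (- max p 0)"
        by (intro powr_mono') auto
      then show ?thesis using True by (auto intro!: ennreal_leI)
    qed auto
  qed
  also have "\<dots> < \<infinity>" using p by (intro nn_integral_norm_powr_ball) (auto simp: max_def)
  finally have "(\<integral>\<^sup>+x. ennreal (norm (indicator (ball 0 1) x * norm (x::'a) powr (- p))) \<partial>lborel) < \<infinity>" .
  moreover have "(\<lambda>x::'a. indicator (ball 0 1) x * norm x powr (- p)) \<in> borel_measurable lborel"
    unfolding measurable_lborel1 by (intro borel_measurable_times borel_measurable_indicator powr_real_measurable borel_measurable_norm measurable_const) auto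
  ultimately show ?thesis by (intro integrableI_bounded)
qed

lemma integrable_slab_norm_powr:
  fixes p :: real
  assumes p: "p < 3"
  shows "integrable lborel (\<lambda>q::spacetime. indicator ({0<..<T} \<times> ball 0 1) q * norm (snd q) powr (- p))"
proof -
  let ?g = "\<lambda>x::real^3. indicator (ball 0 1) x * norm x powr (- p)"
  have "integrable (lborel \<Otimes>\<^sub>M lborel) (\<lambda>q::spacetime. indicator {0<..<T} (fst q) * ?g (snd q))"
    using integrable_norm_powr_ball[where 'a="real^3", of p] p emeasure_bounded_finite[of "{0<..<T}"]
    by (intro lborel_pair.Fubini_integrable) (auto simp: abs_mult intro!: integrable_real_indicator)
  then show ?thesis unfolding lborel_prod
    by (rule Bochner_Integration.integrable_cong[THEN iffD1, rotated -1]) (auto simp: indicator_times)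
qed

section \<open>Hausdorff measure of a segment\<close>

text \<open>Projection to the time axis does not increase distances: a covering set projects into an
  interval around one of its points, of length twice its diameter, and these intervals cover
  \<open>{1..2}\<close>. Already the scale 1 gives the lower bound 1/2, and
  \<open>hausdorff1\<close> is a supremum over all scales.\<close>

lemma hausdorff1_segment_pos:
  assumes "\<And>t. t \<in> {1..2} \<Longrightarrow> (t, a) \<in> S"
  shows "hausdorff1 (S :: (real \<times> 'a::euclidean_space) set) > 0"
proof -
  have "ennreal (1 / 2) \<le> hausdorff1_pre 1 S"
    unfolding hausdorff1_pre_def
  proof (rule INF_greatest, elim CollectE conjE)
    fix U :: "nat \<Rightarrow> (real \<times> 'a) set"
    assume U: "S \<subseteq> (\<Union>n. U n)" "\<forall>n. bounded (U n) \<and> diameter (U n) \<le> 1"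
    \<comment> \<open>For an empty \<open>U n\<close> the centre is arbitrary, which is harmless: no
      point of the segment lies in it.\<close>
    define c where "c n = fst (SOME p. p \<in> U n)" for n
    let ?I = "\<lambda>n. cball (c n) (diameter (U n))"
    have "{1..2} \<subseteq> (\<Union>n. ?I n)"
    proof
      fix t :: real assume "t \<in> {1..2}"
      then obtain n where n: "(t, a) \<in> U n" using assms U(1) by blast
      then have "(SOME p. p \<in> U n) \<in> U n" by (metis someI)
      then have "dist (SOME p. p \<in> U n) (t, a) \<le> diameter (U n)"
        using n U(2) diameter_bounded_bound by blast
      then have "dist (c n) t \<le> diameter (U n)"
        using dist_fst_le[of "SOME p. p \<in> U n" "(t, a)"] by (simp add: c_def)
      then show "t \<in> (\<Union>n. ?I n)" by auto
    qed
    then have "emeasure lborel {1..2::real} \<le> (\<Sum>n. emeasure lborel (?I n))"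
      by (intro order_trans[OF emeasure_mono emeasure_subadditive_countably]) auto
    also have "(\<Sum>n. emeasure lborel (?I n)) = (\<Sum>n. 2 * ennreal (diameter (U n)))"
    proof (rule suminf_cong)
      fix n
      show "emeasure lborel (?I n) = 2 * ennreal (diameter (U n))"
        using U(2) diameter_ge_0[of "U n"]
        by (simp add: cball_eq_atLeastAtMost ennreal_mult'[symmetric] flip: ennreal_numeral)
    qed
    also have "\<dots> = 2 * (\<Sum>n. ennreal (diameter (U n)))" by (rule ennreal_suminf_cmult)
    finally have "1 \<le> 2 * (\<Sum>n. ennreal (diameter (U n)))" by simp
    then have "ennreal (1/2) * 1 \<le> ennreal (1/2) * (2 * (\<Sum>n. ennreal (diameter (U n))))"
      by (rule mult_left_mono) simp
    also have "\<dots> = (ennreal (1/2) * ennreal 2) * (\<Sum>n. ennreal (diameter (U n)))"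
      by (simp add: mult.assoc)
    also have "ennreal (1/2) * ennreal 2 = 1" by (subst ennreal_mult'[symmetric]) auto
    finally show "ennreal (1 / 2) \<le> (\<Sum>n. ennreal (diameter (U n)))" by simp
  qed
  also have "\<dots> \<le> hausdorff1 S" unfolding hausdorff1_def by (rule SUP_upper) simp
  finally have "ennreal (1 / 2) \<le> hausdorff1 S" .
  moreover have "0 < ennreal (1 / 2)" by (subst ennreal_less_zero_iff) auto
  ultimately show ?thesis by (rule less_le_trans[rotated])
qed

section \<open>Partial derivatives\<close>

lemma dt_eq: "(F has_derivative F') (at q) \<Longrightarrow> dt F q = F' (1, 0)"
  unfolding dt_def using frechet_derivative_at by metis

lemma dx_eq: "(F has_derivative F') (at q) \<Longrightarrow> dx i F q = F' (0, axis i 1)"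
  unfolding dx_def using frechet_derivative_at by metis

lemma frechet_derivative_dt_dx:
  assumes "F differentiable (at q)"
  shows "frechet_derivative F (at q) h = dt F q * fst h + (\<Sum>i\<in>UNIV. dx i F q * snd h $ i)"
proof -
  let ?D = "frechet_derivative F (at q)"
  interpret linear ?D using linear_frechet_derivative[OF assms] .
  have "snd h = (\<Sum>i\<in>UNIV. (snd h $ i) *\<^sub>R axis i 1)"
    using basis_expansion[of "snd h"] by (simp add: scalar_mult_eq_scaleR)
  moreover have "h = fst h *\<^sub>R (1, 0) + (0, snd h)" by (simp add: prod_eq_iff)
  moreover have "(0::real, \<Sum>i\<in>UNIV. (snd h $ i) *\<^sub>R axis i 1) = (\<Sum>i\<in>UNIV. (snd h $ i) *\<^sub>R (0, axis i (1::real)))"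
    by (simp add: prod_eq_iff fst_sum snd_sum)
  ultimately have e: "h = fst h *\<^sub>R (1, 0) + (\<Sum>i\<in>UNIV. (snd h $ i) *\<^sub>R (0, axis i 1))"
    by (metis (no_types, lifting))
  then have "?D h = ?D (fst h *\<^sub>R (1, 0) + (\<Sum>i\<in>UNIV. (snd h $ i) *\<^sub>R (0, axis i 1)))" by (rule arg_cong)
  then show ?thesis unfolding add scale sum dt_def dx_def by (simp add: mult.commute)
qed

text \<open>The axis \<open>x = 0\<close> is left out: the profiles are singular there, and
  integrals do not see it. The field equations are verified pointwise on this set only.\<close>

definition cyl :: "spacetime set" where "cyl = {0<..} \<times> (ball 0 1 - {0})"

lemma open_cyl: "open cyl"
  unfolding cyl_def by (intro open_Times open_Diff) auto

lemma in_cyl: "(t, x) \<in> cyl \<longleftrightarrow> 0 < t \<and> 0 < norm x \<and> norm x < 1"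
  by (auto simp: cyl_def)

lemma dt_cong: "q \<in> cyl \<Longrightarrow> (\<And>q. q \<in> cyl \<Longrightarrow> F q = G q) \<Longrightarrow> dt F q = dt G q"
  unfolding dt_def using frechet_derivative_cong_open[OF open_cyl] by metis

lemma dx_cong: "q \<in> cyl \<Longrightarrow> (\<And>q. q \<in> cyl \<Longrightarrow> F q = G q) \<Longrightarrow> dx i F q = dx i G q"
  unfolding dx_def using frechet_derivative_cong_open[OF open_cyl] by metis

lemma differentiable_cong_cyl:
  "q \<in> cyl \<Longrightarrow> (\<And>q. q \<in> cyl \<Longrightarrow> F q = G q) \<Longrightarrow> F differentiable (at q) \<Longrightarrow> G differentiable (at q)"
  using differentiable_cong_open[OF open_cyl] by metis

lemma
  assumes "F differentiable (at q)" "G differentiable (at q)"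
  shows dt_add: "dt (\<lambda>q. F q + G q) q = dt F q + dt G q"
    and dx_add: "dx i (\<lambda>q. F q + G q) q = dx i F q + dx i G q"
    and dt_diff: "dt (\<lambda>q. F q - G q) q = dt F q - dt G q"
    and dx_diff: "dx i (\<lambda>q. F q - G q) q = dx i F q - dx i G q"
    and dt_mult: "dt (\<lambda>q. F q * G q) q = dt F q * G q + F q * dt G q"
    and dx_mult: "dx i (\<lambda>q. F q * G q) q = dx i F q * G q + F q * dx i G q"
proof -
  note d = assms[THEN frechet_derivative_works[THEN iffD1]]
  note r = has_derivative_add[OF d] has_derivative_diff[OF d] has_derivative_mult[OF d]
  show "dt (\<lambda>q. F q + G q) q = dt F q + dt G q" "dx i (\<lambda>q. F q + G q) q = dx i F q + dx i G q"
    "dt (\<lambda>q. F q - G q) q = dt F q - dt G q" "dx i (\<lambda>q. F q - G q) q = dx i F q - dx i G q"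
    "dt (\<lambda>q. F q * G q) q = dt F q * G q + F q * dt G q"
    "dx i (\<lambda>q. F q * G q) q = dx i F q * G q + F q * dx i G q"
    unfolding r[THEN dt_eq] r[THEN dx_eq] by (simp_all add: dt_def dx_def)
qed

lemma dt_const [simp]: "dt (\<lambda>_. c) q = 0" and dx_const [simp]: "dx i (\<lambda>_. c) q = 0"
  by (simp_all add: dt_def dx_def)

lemma coord_has_derivative: "((\<lambda>q::spacetime. snd q $ i) has_derivative (\<lambda>h. snd h $ i)) (at q)"
  by (intro bounded_linear_imp_has_derivative bounded_linear_compose[OF bounded_linear_vec_nth] bounded_linear_snd)

lemma dt_coord [simp]: "dt (\<lambda>q. snd q $ i) q = 0"
  and dx_coord [simp]: "dx j (\<lambda>q. snd q $ i) q = (if i = j then 1 else 0)"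
  by (simp_all add: dt_eq[OF coord_has_derivative] dx_eq[OF coord_has_derivative] axis_def)

lemma coord_differentiable: "(\<lambda>q::spacetime. snd q $ i) differentiable (at q)"
  using coord_has_derivative differentiable_def by blast

lemma radial_has_derivative:
  fixes f :: "real \<Rightarrow> real"
  assumes "(f has_real_derivative f') (at (x \<bullet> x))"
  shows "((\<lambda>q::spacetime. f (snd q \<bullet> snd q)) has_derivative (\<lambda>h. f' * (2 * (x \<bullet> snd h)))) (at (t, x))"
proof -
  have "((\<lambda>q::spacetime. snd q \<bullet> snd q) has_derivative (\<lambda>h. 2 * (x \<bullet> snd h))) (at (t, x))"
    by (auto intro!: derivative_eq_intros simp: inner_commute)
  from DERIV_compose_FDERIV[OF _ this, of f f'] assms show ?thesis by (simp add: mult.commute)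
qed

lemma time_has_derivative:
  fixes f :: "real \<Rightarrow> real"
  assumes "(f has_real_derivative f') (at t)"
  shows "((\<lambda>q::spacetime. f (fst q)) has_derivative (\<lambda>h. f' * fst h)) (at (t, x))"
proof -
  have "((\<lambda>q::spacetime. fst q) has_derivative fst) (at (t, x))" by (auto intro!: derivative_eq_intros)
  from DERIV_compose_FDERIV[OF _ this, of f f'] assms show ?thesis by (simp add: mult.commute)
qed

section \<open>A graded differential algebra of functions on the punctured cylinder\<close>

text \<open>A high power of \<open>ee t\<close> in the amplitudes yields the zero initial value and compensates
  the blow-up of \<open>1 / ((1 - s)\<^sup>2 + ee t)\<close> as \<open>t \<rightarrow> 0\<close> near the sphere.\<close>

definition ee :: "real \<Rightarrow> real" where "ee t = (1 - exp (- t)) / 100"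

lemma ee_bounds: "t > 0 \<Longrightarrow> 0 < ee t" "ee t < 1 / 100"
  by (auto simp: ee_def)

lemma ee_neq: "t > 0 \<Longrightarrow> ee t \<noteq> 0"
  using ee_bounds(1)[of t] by simp

lemma ee_deriv: "(ee has_real_derivative (1 / 100 - ee t)) (at t)"
  unfolding ee_def by (auto intro!: derivative_eq_intros simp: field_simps)

text \<open>The grade \<open>(p, N)\<close> of \<open>F\<close> stands for the bound \<open>\<bar>F (t, x)\<bar> \<le> C * \<bar>x\<bar> powr (- p) * ee t powr (- N)\<close>.\<close>

inductive alg :: "(real \<times> real \<times> (spacetime \<Rightarrow> real)) set \<Rightarrow> real \<Rightarrow> real \<Rightarrow> (spacetime \<Rightarrow> real) \<Rightarrow> bool"
  for Gen where
  alg_gen: "(p, N, F) \<in> Gen \<Longrightarrow> alg Gen p N F"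
| alg_zero: "alg Gen p N (\<lambda>_. 0)"
| alg_const: "alg Gen 0 0 (\<lambda>_. c)"
| alg_coord: "alg Gen (-1) 0 (\<lambda>q. snd q $ i)"
| alg_radius: "alg Gen (- a) 0 (\<lambda>q. norm (snd q) powr a)"
| alg_ee: "alg Gen 0 (-1) (\<lambda>q. ee (fst q))"
| alg_add: "alg Gen p N F \<Longrightarrow> alg Gen p N G \<Longrightarrow> alg Gen p N (\<lambda>q. F q + G q)"
| alg_mult: "alg Gen p N F \<Longrightarrow> alg Gen p' N' G \<Longrightarrow> alg Gen (p + p') (N + N') (\<lambda>q. F q * G q)"
| alg_weaken: "alg Gen p N F \<Longrightarrow> p \<le> p' \<Longrightarrow> N \<le> N' \<Longrightarrow> alg Gen p' N' F"
| alg_cong: "alg Gen p N F \<Longrightarrow> (\<And>q. q \<in> cyl \<Longrightarrow> F q = G q) \<Longrightarrow> alg Gen p N G"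

lemma alg_mono: "alg Gen p N F \<Longrightarrow> Gen \<subseteq> Gen' \<Longrightarrow> alg Gen' p N F"
proof (induction rule: alg.induct)
  case (alg_cong p N F G)
  show ?case by (rule alg.alg_cong[OF alg_cong.IH[OF alg_cong.prems] alg_cong.hyps(2)])
qed (auto intro: alg.intros)

definition graded_bound :: "real \<Rightarrow> real \<Rightarrow> (spacetime \<Rightarrow> real) \<Rightarrow> bool" where
  "graded_bound p N F \<longleftrightarrow>
     (\<exists>C\<ge>0. \<forall>t x. (t, x) \<in> cyl \<longrightarrow> \<bar>F (t, x)\<bar> \<le> C * (norm x powr (- p) * ee t powr (- N)))"

lemma alg_bound:
  assumes gens: "\<And>p N F. (p, N, F) \<in> Gen \<Longrightarrow> graded_bound p N F" and F: "alg Gen p N F"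
  shows "graded_bound p N F"
  using F
proof (induction rule: alg.induct)
  case (alg_gen p N F)
  then show ?case by (rule gens)
next
  case (alg_zero p N)
  show ?case unfolding graded_bound_def by (auto intro!: exI[of _ 0])
next
  case (alg_const c)
  show ?case unfolding graded_bound_def
    using ee_bounds by (intro exI[of _ "\<bar>c\<bar>"]) (auto simp: in_cyl ee_neq less_imp_le[OF ee_bounds(1)] powr_one)
next
  case (alg_coord i)
  show ?case unfolding graded_bound_def
    using component_le_norm_cart by (intro exI[of _ 1]) (auto simp: in_cyl ee_neq less_imp_le[OF ee_bounds(1)] powr_one)
next
  case (alg_radius a)
  show ?case unfolding graded_bound_def
    by (intro exI[of _ 1]) (auto simp: in_cyl ee_neq less_imp_le[OF ee_bounds(1)] powr_one)
next
  case alg_ee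
  show ?case unfolding graded_bound_def
    by (intro exI[of _ 1]) (auto simp: in_cyl ee_neq less_imp_le[OF ee_bounds(1)] powr_one)
next
  case (alg_add p N F G)
  then obtain C C' where "C \<ge> 0" "C' \<ge> 0"
    and C: "\<And>t x. (t, x) \<in> cyl \<Longrightarrow> \<bar>F (t, x)\<bar> \<le> C * (norm x powr (- p) * ee t powr (- N))"
    "\<And>t x. (t, x) \<in> cyl \<Longrightarrow> \<bar>G (t, x)\<bar> \<le> C' * (norm x powr (- p) * ee t powr (- N))"
    unfolding graded_bound_def by blast
  moreover have "\<bar>F (t, x) + G (t, x)\<bar> \<le> (C + C') * (norm x powr (- p) * ee t powr (- N))" if "(t, x) \<in> cyl" for t x
    using C[OF that] unfolding distrib_right by (rule order_trans[OF abs_triangle_ineq add_mono])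
  ultimately show ?case unfolding graded_bound_def by (intro exI[of _ "C + C'"]) auto
next
  case (alg_mult p N F p' N' G)
  then obtain C C' where "C \<ge> 0" "C' \<ge> 0"
    and C: "\<And>t x. (t, x) \<in> cyl \<Longrightarrow> \<bar>F (t, x)\<bar> \<le> C * (norm x powr (- p) * ee t powr (- N))"
    "\<And>t x. (t, x) \<in> cyl \<Longrightarrow> \<bar>G (t, x)\<bar> \<le> C' * (norm x powr (- p') * ee t powr (- N'))"
    unfolding graded_bound_def by blast
  moreover have "\<bar>F (t, x) * G (t, x)\<bar> \<le> (C * C') * (norm x powr (- (p + p')) * ee t powr (- (N + N')))" if "(t, x) \<in> cyl" for t x
  proof -
    have "\<bar>F (t, x) * G (t, x)\<bar> \<le> (C * (norm x powr (- p) * ee t powr (- N))) * (C' * (norm x powr (- p') * ee t powr (- N')))"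
      unfolding abs_mult using C[OF that] \<open>C \<ge> 0\<close> by (intro mult_mono) auto
    also have "\<dots> = (C * C') * (norm x powr (- (p + p')) * ee t powr (- (N + N')))"
      by (simp add: powr_add powr_diff powr_minus field_simps)
    finally show ?thesis .
  qed
  ultimately show ?case unfolding graded_bound_def by (intro exI[of _ "C * C'"]) auto
next
  case (alg_weaken p N F p' N')
  then obtain C where C: "C \<ge> 0" "\<And>t x. (t, x) \<in> cyl \<Longrightarrow> \<bar>F (t, x)\<bar> \<le> C * (norm x powr (- p) * ee t powr (- N))"
    unfolding graded_bound_def by blast
  have "\<bar>F (t, x)\<bar> \<le> C * (norm x powr (- p') * ee t powr (- N'))" if "(t, x) \<in> cyl" for t x
  proof -
    \<comment> \<open>Both bases are below 1, so larger grades mean weaker bounds.\<close>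
    have "norm x powr (- p) * ee t powr (- N) \<le> norm x powr (- p') * ee t powr (- N')"
      using that alg_weaken.hyps ee_bounds[of t] by (intro mult_mono powr_mono') (auto simp: in_cyl)
    then show ?thesis using C(1) C(2)[OF that] by (meson mult_left_mono order_trans)
  qed
  then show ?case using C(1) unfolding graded_bound_def by blast
next
  case (alg_cong p N F G)
  then show ?case unfolding graded_bound_def by auto
qed

text \<open>The number \<open>r\<close> is the price, in powers of \<open>1 / ee t\<close>, of one
  derivative in time or in space; a space derivative costs one power of \<open>1 / norm x\<close> in
  addition.\<close>

definition dclosed :: "(real \<times> real \<times> (spacetime \<Rightarrow> real)) set \<Rightarrow> real \<Rightarrow> real \<Rightarrow> real \<Rightarrow> (spacetime \<Rightarrow> real) \<Rightarrow> bool" where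
  "dclosed Gen r p N F \<longleftrightarrow> (\<forall>q\<in>cyl. F differentiable (at q)) \<and> alg Gen p (N + r) (dt F) \<and>
     (\<forall>i. alg Gen (p + 1) (N + r) (dx i F))"

lemma dclosedI:
  assumes "\<And>q. q \<in> cyl \<Longrightarrow> F differentiable (at q)"
    "alg Gen p (N + r) Ft" "\<And>q. q \<in> cyl \<Longrightarrow> dt F q = Ft q"
    "\<And>i. alg Gen (p + 1) (N + r) (Fx i)" "\<And>i q. q \<in> cyl \<Longrightarrow> dx i F q = Fx i q"
  shows "dclosed Gen r p N F"
  unfolding dclosed_def
  using assms(1) alg_cong[OF assms(2), of "dt F"] alg_cong[OF assms(4), of _ "dx _ F"] assms(3,5) by auto

lemma norm_powr_has_derivative:
  assumes "x \<noteq> 0"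
  shows "((\<lambda>q::spacetime. norm (snd q) powr a) has_derivative (\<lambda>h. a * norm x powr (a - 2) * (x \<bullet> snd h))) (at (t, x))"
proof -
  have "((\<lambda>s. s powr (a / 2)) has_real_derivative (a / 2 * (x \<bullet> x) powr (a / 2 - 1))) (at (x \<bullet> x))"
    using assms by (auto intro!: derivative_eq_intros)
  from radial_has_derivative[OF this, of t]
  have "((\<lambda>q::spacetime. (snd q \<bullet> snd q) powr (a / 2)) has_derivative
      (\<lambda>h. a / 2 * (x \<bullet> x) powr (a / 2 - 1) * (2 * (x \<bullet> snd h)))) (at (t, x))" .
  moreover have "(y \<bullet> y) powr b = norm y powr (2 * b)" for y :: "real^3" and b
  proof -
    have "(y \<bullet> y) powr b = (norm y powr 2) powr b" by (simp add: dot_square_norm)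
    then show ?thesis by (simp only: powr_powr)
  qed
  ultimately show ?thesis by (simp add: right_diff_distrib mult.assoc)
qed

text \<open>Sum and product rule carry the closure under derivatives from the generators to the
  algebra. The condition \<open>r \<ge> 1\<close> reflects \<open>ee\<close> itself, of grade -1
  with a derivative of grade 0.\<close>

lemma alg_dclosed:
  assumes r: "r \<ge> 1" and gens: "\<And>p N F. (p, N, F) \<in> Gen \<Longrightarrow> dclosed Gen r p N F" and F: "alg Gen p N F"
  shows "dclosed Gen r p N F"
  using F
proof (induction rule: alg.induct)
  case (alg_gen p N F)
  then show ?case by (rule gens)
next
  case (alg_zero p N)
  show ?case by (rule dclosedI[OF _ alg.alg_zero _ alg.alg_zero]) auto
next
  case (alg_const c)
  show ?case by (rule dclosedI[OF _ alg.alg_zero _ alg.alg_zero]) auto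
next
  case (alg_coord i)
  have *: "alg Gen (- 1 + 1) (0 + r) (\<lambda>_. if i = j then 1 else 0)" for j
    using alg_weaken[OF alg.alg_const[of Gen "if i = j then 1 else 0"], of 0 r] r by simp
  show ?case
    by (rule dclosedI[OF coord_differentiable alg.alg_zero _ *]) auto
next
  case (alg_radius a)
  have D: "((\<lambda>q::spacetime. norm (snd q) powr a) has_derivative (\<lambda>h. a * norm (snd q) powr (a - 2) * (snd q \<bullet> snd h))) (at q)"
    if "q \<in> cyl" for q
    using norm_powr_has_derivative[of "snd q" a "fst q"] that by (cases q) (simp add: cyl_def)
  have "alg Gen (0 + (- (a - 2) + - 1)) (0 + (0 + 0)) (\<lambda>q. a * (norm (snd q) powr (a - 2) * (snd q $ i)))" for i
    by (rule alg.alg_mult[OF alg.alg_const alg.alg_mult[OF alg.alg_radius alg.alg_coord]])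
  then have *: "alg Gen (- a + 1) (0 + r) (\<lambda>q. a * (norm (snd q) powr (a - 2) * (snd q $ i)))" for i
    by (rule alg.alg_weaken) (use r in auto)
  show ?case
    by (rule dclosedI[OF _ alg.alg_zero _ *])
      (use D in \<open>auto simp: differentiable_def dt_eq[OF D] dx_eq[OF D] inner_axis\<close>)
next
  case alg_ee
  have D: "((\<lambda>q::spacetime. ee (fst q)) has_derivative (\<lambda>h. (1 / 100 - ee (fst q)) * fst h)) (at q)" for q
    using time_has_derivative[OF ee_deriv, of "fst q" "snd q"] by simp
  have "alg Gen 0 0 (\<lambda>q. 1 / 100 + (- 1) * ee (fst q))"
    using alg.alg_weaken[OF alg.alg_mult[OF alg.alg_const[of Gen "- 1"] alg.alg_ee], of 0 0]
    by (intro alg.alg_add alg.alg_const) auto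
  then have *: "alg Gen 0 (- 1 + r) (\<lambda>q. 1 / 100 + (- 1) * ee (fst q))"
    by (rule alg.alg_weaken) (use r in auto)
  show ?case
    by (rule dclosedI[OF _ * _ alg.alg_zero])
      (use D in \<open>auto simp: differentiable_def dt_eq[OF D] dx_eq[OF D]\<close>)
next
  case (alg_add p N F G)
  then show ?case unfolding dclosed_def[of _ _ _ _ F] dclosed_def[of _ _ _ _ G]
    by (intro dclosedI[of _ Gen p N r "\<lambda>q. dt F q + dt G q" "\<lambda>i q. dx i F q + dx i G q"])
      (auto simp: dt_add dx_add intro: alg.alg_add)
next
  case (alg_mult p N F p' N' G)
  then have IH: "\<And>q. q \<in> cyl \<Longrightarrow> F differentiable (at q)" "\<And>q. q \<in> cyl \<Longrightarrow> G differentiable (at q)"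
    "alg Gen p (N + r) (dt F)" "alg Gen p' (N' + r) (dt G)"
    "\<And>i. alg Gen (p + 1) (N + r) (dx i F)" "\<And>i. alg Gen (p' + 1) (N' + r) (dx i G)"
    unfolding dclosed_def by auto
  have "alg Gen (p + p') (N + N' + r) (\<lambda>q. dt F q * G q + F q * dt G q)"
    using alg.alg_mult[OF IH(3) alg_mult.hyps(2)] alg.alg_mult[OF alg_mult.hyps(1) IH(4)]
    by (intro alg.alg_add) (simp_all add: algebra_simps)
  moreover have "alg Gen (p + p' + 1) (N + N' + r) (\<lambda>q. dx i F q * G q + F q * dx i G q)" for i
    using alg.alg_mult[OF IH(5)[of i] alg_mult.hyps(2)] alg.alg_mult[OF alg_mult.hyps(1) IH(6)[of i]]
    by (intro alg.alg_add) (simp_all add: algebra_simps)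
  ultimately show ?case using IH(1,2)
    by (intro dclosedI[of _ Gen _ _ r "\<lambda>q. dt F q * G q + F q * dt G q" "\<lambda>i q. dx i F q * G q + F q * dx i G q"])
      (auto simp: dt_mult dx_mult)
next
  case (alg_weaken p N F p' N')
  then show ?case unfolding dclosed_def by (auto intro: alg.alg_weaken)
next
  case (alg_cong p N F G)
  then have IH: "\<And>q. q \<in> cyl \<Longrightarrow> F differentiable (at q)" "alg Gen p (N + r) (dt F)"
    "\<And>i. alg Gen (p + 1) (N + r) (dx i F)"
    unfolding dclosed_def by auto
  show ?case
    by (rule dclosedI[OF differentiable_cong_cyl[OF _ alg_cong.hyps(2) IH(1)] IH(2)
          dt_cong[OF _ alg_cong.hyps(2), symmetric] IH(3) dx_cong[OF _ alg_cong.hyps(2), symmetric]])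
qed

lemma slice_has_derivative:
  fixes F :: "spacetime \<Rightarrow> real"
  assumes "F differentiable (at (t, x))"
  shows "((\<lambda>x. F (t, x)) has_derivative (\<lambda>h. frechet_derivative F (at (t, x)) (0, h))) (at x)"
proof -
  have "((\<lambda>x. (t, x)) has_derivative (\<lambda>h. (0, h))) (at x)" by (auto intro!: derivative_eq_intros)
  from has_derivative_compose[OF this, of F "frechet_derivative F (at (t, x))"] assms
  show ?thesis by (simp add: frechet_derivative_works)
qed

lemma slice_frechet_derivative:
  assumes "F differentiable (at (t, x))"
  shows "frechet_derivative (\<lambda>x. F (t, x)) (at x) (axis i 1) = dx i F (t, x)"
  using frechet_derivative_at[OF slice_has_derivative[OF assms]] by (metis dx_def)

text \<open>Partial derivatives stay in the algebra, so differentiability of all its members yields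
  every order of smoothness by induction.\<close>

lemma alg_Ck_on_slice:
  assumes gens: "\<And>p N F. alg Gen p N F \<Longrightarrow> dclosed Gen r p N F" and F: "alg Gen p N F"
    and t: "t > 0"
  shows "Ck_on k (ball 0 1 - {0}) (\<lambda>x. F (t, x))"
  using F
proof (induction k arbitrary: p N F)
  case 0
  have "(\<lambda>x. F (t, x)) differentiable (at x)" if "x \<in> ball 0 1 - {0}" for x
    using slice_has_derivative[of F t x] gens[OF 0] that t
    unfolding dclosed_def differentiable_def[of "\<lambda>x. F (t, x)"] by (auto simp: cyl_def)
  then show ?case unfolding Ck_on.simps
    by (intro continuous_at_imp_continuous_on ballI differentiable_imp_continuous_within)
next
  case (Suc k)
  have D: "F differentiable (at (t, x))" if "x \<in> ball 0 1 - {0}" for x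
    using gens[OF Suc.prems] that t unfolding dclosed_def by (auto simp: cyl_def)
  then have "(\<lambda>x. F (t, x)) differentiable (at x)" if "x \<in> ball 0 1 - {0}" for x
    using slice_has_derivative[of F t x] that differentiable_def[of "\<lambda>x. F (t, x)"] by blast
  moreover have "Ck_on k (ball 0 1 - {0}) (\<lambda>x. frechet_derivative (\<lambda>x. F (t, x)) (at x) b)" if b: "b \<in> Basis" for b
  proof -
    obtain i where i: "b = axis i 1" using b by (auto simp: Basis_vec_def)
    have "Ck_on k (ball 0 1 - {0}) (\<lambda>x. dx i F (t, x))"
      using Suc.IH gens[OF Suc.prems] unfolding dclosed_def by blast
    then show ?thesis
      by (rule Ck_on_cong[rotated 2]) (use i D slice_frechet_derivative in \<open>auto intro: open_delete\<close>)
  qed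
  ultimately show ?case by simp
qed

section \<open>Tame functions\<close>

text \<open>What remains of the grading once the powers of \<open>ee t\<close> are absorbed: a bound
  uniform in time. For integrability over bounded slabs and over slices \<open>p < 3\<close>
  suffices, as space has dimension three.\<close>

definition tame :: "real \<Rightarrow> (spacetime \<Rightarrow> real) \<Rightarrow> bool" where
  "tame p F \<longleftrightarrow> continuous_on cyl F \<and>
     (\<exists>C\<ge>0. \<forall>t x. (t, x) \<in> cyl \<longrightarrow> \<bar>F (t, x)\<bar> \<le> C * norm x powr (- p))"

definition tame1 :: "real \<Rightarrow> (spacetime \<Rightarrow> real) \<Rightarrow> bool" where
  "tame1 p F \<longleftrightarrow> tame p F \<and> (\<forall>q\<in>cyl. F differentiable (at q)) \<and> tame p (dt F) \<and>
     (\<forall>i. tame (p + 1) (dx i F))"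

lemma tame_cong: "tame p F \<Longrightarrow> (\<And>q. q \<in> cyl \<Longrightarrow> F q = G q) \<Longrightarrow> tame p G"
  unfolding tame_def by (auto cong: continuous_on_cong)

lemma tame_add: "tame p F \<Longrightarrow> tame p G \<Longrightarrow> tame p (\<lambda>q. F q + G q)"
proof -
  assume a: "tame p F" "tame p G"
  then obtain C C' where "C \<ge> 0" "C' \<ge> 0"
    and C: "\<And>t x. (t, x) \<in> cyl \<Longrightarrow> \<bar>F (t, x)\<bar> \<le> C * norm x powr (- p)"
    "\<And>t x. (t, x) \<in> cyl \<Longrightarrow> \<bar>G (t, x)\<bar> \<le> C' * norm x powr (- p)"
    unfolding tame_def by blast
  moreover have "\<bar>F (t, x) + G (t, x)\<bar> \<le> (C + C') * norm x powr (- p)" if "(t, x) \<in> cyl" for t x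
    using C[OF that] unfolding distrib_right by (rule order_trans[OF abs_triangle_ineq add_mono])
  ultimately show ?thesis using a unfolding tame_def
    by (auto intro!: exI[of _ "C + C'"] continuous_on_add)
qed

lemma tame_mult: "tame p F \<Longrightarrow> tame p' G \<Longrightarrow> tame (p + p') (\<lambda>q. F q * G q)"
proof -
  assume a: "tame p F" "tame p' G"
  then obtain C C' where "C \<ge> 0" "C' \<ge> 0"
    and C: "\<And>t x. (t, x) \<in> cyl \<Longrightarrow> \<bar>F (t, x)\<bar> \<le> C * norm x powr (- p)"
    "\<And>t x. (t, x) \<in> cyl \<Longrightarrow> \<bar>G (t, x)\<bar> \<le> C' * norm x powr (- p')"
    unfolding tame_def by blast
  moreover have "\<bar>F (t, x) * G (t, x)\<bar> \<le> (C * C') * norm x powr (- (p + p'))" if "(t, x) \<in> cyl" for t x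
  proof -
    have "\<bar>F (t, x) * G (t, x)\<bar> \<le> (C * norm x powr (- p)) * (C' * norm x powr (- p'))"
      unfolding abs_mult using C[OF that] \<open>C \<ge> 0\<close> by (intro mult_mono) auto
    also have "\<dots> = (C * C') * norm x powr (- (p + p'))" by (simp add: powr_diff powr_minus field_simps powr_add)
    finally show ?thesis .
  qed
  ultimately show ?thesis using a unfolding tame_def
    by (auto intro!: exI[of _ "C * C'"] continuous_on_mult)
qed

lemma tame_weaken: "tame p F \<Longrightarrow> p \<le> p' \<Longrightarrow> tame p' F"
proof -
  assume a: "tame p F" "p \<le> p'"
  then obtain C where C: "C \<ge> 0" "\<And>t x. (t, x) \<in> cyl \<Longrightarrow> \<bar>F (t, x)\<bar> \<le> C * norm x powr (- p)"
    unfolding tame_def by blast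
  have "\<bar>F (t, x)\<bar> \<le> C * norm x powr (- p')" if "(t, x) \<in> cyl" for t x
  proof -
    have "norm x powr (- p) \<le> norm x powr (- p')"
      using that a(2) by (intro powr_mono') (auto simp: in_cyl)
    then show ?thesis using C(1) C(2)[OF that] by (meson mult_left_mono order_trans)
  qed
  then show ?thesis using C(1) a unfolding tame_def by blast
qed

lemma tame_const: "tame 0 (\<lambda>_. c)"
  unfolding tame_def by (auto simp: in_cyl intro!: exI[of _ "\<bar>c\<bar>"])

lemma tame_cmult: "tame p F \<Longrightarrow> tame p (\<lambda>q. c * F q)"
  using tame_mult[OF tame_const, of p F c] by simp

lemma tame_minus: "tame p F \<Longrightarrow> tame p (\<lambda>q. - F q)"
  using tame_cmult[of p F "- 1"] by simp

lemma tame_diff: "tame p F \<Longrightarrow> tame p G \<Longrightarrow> tame p (\<lambda>q. F q - G q)"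
  using tame_add[OF _ tame_minus, of p F G] by simp

lemma tame_sum: "(\<And>i. i \<in> I \<Longrightarrow> tame p (F i)) \<Longrightarrow> p \<ge> 0 \<Longrightarrow> tame p (\<lambda>q. \<Sum>i\<in>I. F i q)"
  by (induction I rule: infinite_finite_induct) (auto intro: tame_add tame_weaken[OF tame_const])

lemma tame1D:
  assumes "tame1 p F"
  shows "tame p F" "q \<in> cyl \<Longrightarrow> F differentiable (at q)" "tame p (dt F)" "tame (p + 1) (dx i F)"
  using assms by (auto simp: tame1_def)

lemma tame1_add:
  assumes "tame1 p F" "tame1 p G" shows "tame1 p (\<lambda>q. F q + G q)"
  unfolding tame1_def
proof (intro conjI ballI allI)
  note D = assms[THEN tame1D(2)]
  show "tame p (dt (\<lambda>q. F q + G q))"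
    by (rule tame_cong[OF tame_add[OF assms[THEN tame1D(3)]]]) (simp add: dt_add D)
  show "tame (p + 1) (dx i (\<lambda>q. F q + G q))" for i
    by (rule tame_cong[OF tame_add[OF assms[THEN tame1D(4)]]]) (simp add: dx_add D)
qed (use assms[THEN tame1D(1)] assms[THEN tame1D(2)] in \<open>auto intro: tame_add\<close>)

lemma tame1_mult:
  assumes "tame1 p F" "tame1 p' G" shows "tame1 (p + p') (\<lambda>q. F q * G q)"
  unfolding tame1_def
proof (intro conjI ballI allI)
  note D = assms[THEN tame1D(2)]
  show "tame (p + p') (dt (\<lambda>q. F q * G q))"
    by (rule tame_cong[OF tame_add[OF tame_mult[OF tame1D(3)[OF assms(1)] tame1D(1)[OF assms(2)]]
          tame_mult[OF tame1D(1)[OF assms(1)] tame1D(3)[OF assms(2)]]]]) (simp add: dt_mult D)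
  have "tame (p + p' + 1) (\<lambda>q. dx i F q * G q + F q * dx i G q)" for i
    using tame_mult[OF tame1D(4)[OF assms(1), of i] tame1D(1)[OF assms(2)]]
      tame_mult[OF tame1D(1)[OF assms(1)] tame1D(4)[OF assms(2), of i]]
    by (intro tame_add) (simp_all add: algebra_simps)
  then show "tame (p + p' + 1) (dx i (\<lambda>q. F q * G q))" for i
    by (rule tame_cong) (simp add: dx_mult D)
qed (use assms[THEN tame1D(1)] assms[THEN tame1D(2)] in \<open>auto intro: tame_mult\<close>)

lemma tame1_weaken: "tame1 p F \<Longrightarrow> p \<le> p' \<Longrightarrow> tame1 p' F"
  unfolding tame1_def by (auto intro: tame_weaken)

lemma tame1_const: "tame1 0 (\<lambda>_. c)"
  unfolding tame1_def using tame_const[of c] tame_const[of 0]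
  by (auto intro: tame_weaken tame_cong[OF tame_const[of 0]] tame_cong[OF tame_weaken[OF tame_const[of 0]]])

lemma tame1_cmult: "tame1 p F \<Longrightarrow> tame1 p (\<lambda>q. c * F q)"
  using tame1_mult[OF tame1_const, of p F c] by simp

lemma tame1_minus: "tame1 p F \<Longrightarrow> tame1 p (\<lambda>q. - F q)"
  using tame1_cmult[of p F "- 1"] by simp

lemma tame1_diff: "tame1 p F \<Longrightarrow> tame1 p G \<Longrightarrow> tame1 p (\<lambda>q. F q - G q)"
  using tame1_add[OF _ tame1_minus, of p F G] by simp

lemma tame1_sum: "(\<And>i. i \<in> I \<Longrightarrow> tame1 p (F i)) \<Longrightarrow> p \<ge> 0 \<Longrightarrow> tame1 p (\<lambda>q. \<Sum>i\<in>I. F i q)"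
  by (induction I rule: infinite_finite_induct) (auto intro: tame1_add tame1_weaken[OF tame1_const])

text \<open>If the grade in \<open>ee t\<close> is still nonpositive after the price
  \<open>r\<close> of one derivative, it can be weakened to 0, and the bounds of the function and of
  its first derivatives are uniform in time.\<close>

lemma alg_imp_tame1:
  assumes bd: "\<And>p N F. alg Gen p N F \<Longrightarrow> graded_bound p N F"
    and dc: "\<And>p N F. alg Gen p N F \<Longrightarrow> dclosed Gen r p N F" and r: "r \<ge> 0"
    and F: "alg Gen p N F" and N: "N + r \<le> 0"
  shows "tame1 p F"
proof -
  have *: "tame p' G" if G: "alg Gen p' N' G" and N': "N' \<le> 0" for p' N' G
  proof -
    have "graded_bound p' 0 G" by (rule bd[OF alg_weaken[OF G order_refl N']])
    then obtain C where "C \<ge> 0" "\<And>t x. (t, x) \<in> cyl \<Longrightarrow> \<bar>G (t, x)\<bar> \<le> C * (norm x powr - p' * ee t powr - 0)"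
      unfolding graded_bound_def by auto
    moreover have "ee t powr - 0 = 1" if "(t, x) \<in> cyl" for t and x :: "real^3"
      using that ee_bounds[of t] by (simp add: in_cyl)
    moreover have "continuous_on cyl G"
      using dc[OF G] unfolding dclosed_def
      by (auto intro!: continuous_at_imp_continuous_on differentiable_imp_continuous_within)
    ultimately show ?thesis unfolding tame_def by (intro conjI exI[of _ C]) auto
  qed
  have d: "\<forall>q\<in>cyl. F differentiable (at q)" "alg Gen p (N + r) (dt F)" "\<And>i. alg Gen (p + 1) (N + r) (dx i F)"
    using dc[OF F] unfolding dclosed_def by auto
  show ?thesis unfolding tame1_def
    using d *[OF F] *[OF d(2)] *[OF d(3)] N r by auto
qed

section \<open>Integration of tame functions\<close>

text \<open>Extension by zero turns a function controlled on \<open>cyl\<close> alone into a Borel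
  function on all of space-time.\<close>

definition zcut :: "(spacetime \<Rightarrow> real) \<Rightarrow> spacetime \<Rightarrow> real" where
  "zcut F q = (if q \<in> cyl then F q else 0)"

lemma zcut_simps [simp]: "q \<in> cyl \<Longrightarrow> zcut F q = F q" "q \<notin> cyl \<Longrightarrow> zcut F q = 0"
  by (auto simp: zcut_def)

lemma zcut_cong: "(\<And>q. q \<in> cyl \<Longrightarrow> F q = G q) \<Longrightarrow> zcut F = zcut G"
  by (auto simp: zcut_def fun_eq_iff)

lemma tame_zcut_measurable [measurable]: "tame p F \<Longrightarrow> zcut F \<in> borel_measurable borel"
proof -
  assume "tame p F"
  then have "(\<lambda>q. indicator cyl q *\<^sub>R F q) \<in> borel_measurable borel"
    using open_cyl unfolding tame_def by (intro borel_measurable_continuous_on_indicator) auto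
  moreover have "(\<lambda>q. indicator cyl q *\<^sub>R F q) = zcut F" by (auto simp: zcut_def fun_eq_iff)
  ultimately show ?thesis by simp
qed

lemma tame_zcut_bound:
  assumes "tame p F"
  obtains C where "C \<ge> 0" "\<And>t x. \<bar>zcut F (t, x)\<bar> \<le> C * (indicator (ball 0 1) x * norm x powr (- p))"
proof -
  obtain C where C: "C \<ge> 0" "\<And>t x. (t, x) \<in> cyl \<Longrightarrow> \<bar>F (t, x)\<bar> \<le> C * norm x powr (- p)"
    using assms unfolding tame_def by blast
  have "\<bar>zcut F (t, x)\<bar> \<le> C * (indicator (ball 0 1) x * norm x powr (- p))" for t x
    using C by (cases "(t, x) \<in> cyl") (auto simp: in_cyl zcut_def)
  then show ?thesis using C(1) that by blast
qed

abbreviation slab :: "real \<Rightarrow> spacetime set" where "slab T \<equiv> {0<..<T} \<times> ball 0 1"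

lemma tame_slab_integrable:
  assumes F: "tame p F" and p: "p < 3"
  shows "integrable lborel (\<lambda>q. indicator (slab T) q * zcut F q)"
proof -
  obtain C where C: "C \<ge> 0" "\<And>t x. \<bar>zcut F (t, x)\<bar> \<le> C * (indicator (ball 0 1) x * norm x powr (- p))"
    using tame_zcut_bound[OF F] by blast
  show ?thesis
  proof (rule Bochner_Integration.integrable_bound)
    show "integrable lborel (\<lambda>q. C * (indicator (slab T) q * norm (snd q) powr (- p)))"
      by (intro integrable_mult_right integrable_slab_norm_powr p)
    have "zcut F \<in> borel_measurable borel" by (rule tame_zcut_measurable[OF F])
    moreover have "open (slab T)" by (intro open_Times) auto
    ultimately show "(\<lambda>q. indicator (slab T) q * zcut F q) \<in> borel_measurable lborel"
      by (auto intro!: borel_measurable_times borel_measurable_indicator)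
    show "AE q in lborel. norm (indicator (slab T) q * zcut F q) \<le> norm (C * (indicator (slab T) q * norm (snd q) powr (- p)))"
    proof (rule AE_I2)
      fix q :: spacetime
      show "norm (indicator (slab T) q * zcut F q) \<le> norm (C * (indicator (slab T) q * norm (snd q) powr (- p)))"
        using C(2)[of "fst q" "snd q"] C(1) by (cases q) (auto simp: indicator_def abs_mult)
    qed
  qed
qed

lemma tame_slice_integrable:
  assumes F: "tame p F" and p: "p < 3"
  shows "integrable lborel (\<lambda>x. zcut F (t, x))"
proof -
  obtain C where C: "C \<ge> 0" "\<And>t x. \<bar>zcut F (t, x)\<bar> \<le> C * (indicator (ball 0 1) x * norm x powr (- p))"
    using tame_zcut_bound[OF F] by blast
  have [measurable]: "zcut F \<in> borel_measurable borel" by (rule tame_zcut_measurable[OF F])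
  show ?thesis
  proof (rule Bochner_Integration.integrable_bound)
    show "integrable lborel (\<lambda>x::real^3. C * (indicator (ball 0 1) x * norm x powr (- p)))"
      using integrable_norm_powr_ball[where 'a="real^3", of p] p by (intro integrable_mult_right) simp
    have "Pair t \<in> borel \<rightarrow>\<^sub>M borel"
      by (intro borel_measurable_continuous_onI continuous_intros)
    from measurable_compose[OF this tame_zcut_measurable[OF F]]
    show "(\<lambda>x. zcut F (t, x)) \<in> borel_measurable lborel" by simp
  qed (use C in \<open>auto simp: abs_mult\<close>)
qed

text \<open>All integrands below vanish off \<open>cyl\<close>, hence no restriction to the ball is needed.\<close>

definition slab_integral :: "real \<Rightarrow> (spacetime \<Rightarrow> real) \<Rightarrow> real" where
  "slab_integral T F = (LINT q|lborel. indicator (slab T) q * zcut F q)"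

definition slice_integral :: "real \<Rightarrow> (spacetime \<Rightarrow> real) \<Rightarrow> real" where
  "slice_integral t F = (LINT x|lborel. zcut F (t, x))"

lemma slab_integral_cong: "(\<And>q. q \<in> cyl \<Longrightarrow> F q = G q) \<Longrightarrow> slab_integral T F = slab_integral T G"
  unfolding slab_integral_def using zcut_cong[of F G] by simp

lemma zcut_add: "zcut (\<lambda>q. F q + G q) q = zcut F q + zcut G q"
  and zcut_zero: "zcut (\<lambda>q. 0) q = 0"
  and zcut_cmult: "zcut (\<lambda>q. c * F q) q = c * zcut F q"
  by (auto simp: zcut_def)

lemma slab_integral_add:
  assumes "tame p F" "tame p G" "p < 3"
  shows "slab_integral T (\<lambda>q. F q + G q) = slab_integral T F + slab_integral T G"
  unfolding slab_integral_def zcut_add distrib_left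
  by (rule Bochner_Integration.integral_add[OF tame_slab_integrable[OF assms(1,3)] tame_slab_integrable[OF assms(2,3)]])

lemma slab_integral_cmult: "slab_integral T (\<lambda>q. c * F q) = c * slab_integral T F"
  unfolding slab_integral_def zcut_cmult mult.left_commute[of _ c] by simp

lemma slab_integral_sum:
  "(\<And>i. i \<in> I \<Longrightarrow> tame p (F i)) \<Longrightarrow> 0 \<le> p \<Longrightarrow> p < 3 \<Longrightarrow> slab_integral T (\<lambda>q. \<Sum>i\<in>I. F i q) = (\<Sum>i\<in>I. slab_integral T (F i))"
proof (induction I rule: infinite_finite_induct)
  case (insert i I)
  then show ?case by (simp add: slab_integral_add[of p] tame_sum)
qed (simp_all add: slab_integral_def zcut_zero)

lemma slab_fubini:
  assumes F: "tame p F" and p: "p < 3"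
  shows "slab_integral T F = (LINT t|lborel. indicator {0<..<T} t * slice_integral t F)"
    and "slab_integral T F = (LINT x|lborel. LINT t|lborel. indicator {0<..<T} t * zcut F (t, x))"
proof -
  have e: "indicator (slab T) q * zcut F q = indicator {0<..<T} (fst q) * zcut F q" for q
    by (cases q) (auto simp: indicator_def zcut_def in_cyl)
  have i: "integrable (lborel \<Otimes>\<^sub>M lborel) (\<lambda>q. indicator {0<..<T} (fst q) * zcut F q)"
    using tame_slab_integrable[OF F p, of T] unfolding lborel_prod e .
  have "slab_integral T F = (LINT q|(lborel \<Otimes>\<^sub>M lborel). indicator {0<..<T} (fst q) * zcut F q)"
    unfolding slab_integral_def e lborel_prod ..
  then show "slab_integral T F = (LINT t|lborel. indicator {0<..<T} t * slice_integral t F)"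
    and "slab_integral T F = (LINT x|lborel. LINT t|lborel. indicator {0<..<T} t * zcut F (t, x))"
    using lborel_pair.integral_fst'[OF i] lborel_pair.integral_snd[of "\<lambda>t x. indicator {0<..<T} t * zcut F (t, x)"] i
    by (simp_all add: slice_integral_def split_beta')
qed

section \<open>Integration by parts across the singular axis\<close>

lemma flat_tendsto: "(flat p \<longlongrightarrow> poly p 0) at_top"
proof -
  have "((\<lambda>x::real. poly p (1 / x) * exp (- (1 / x))) \<longlongrightarrow> poly p 0 * exp (- 0)) at_top"
    by (intro tendsto_intros tendsto_divide_0[OF tendsto_const] filterlim_at_top_imp_at_infinity filterlim_ident)
  then have "((\<lambda>x::real. poly p (1 / x) * exp (- (1 / x))) \<longlongrightarrow> poly p 0) at_top" by simp
  moreover have "\<forall>\<^sub>F x in at_top. poly p (1 / x) * exp (- (1 / x)) = flat p x"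
    using eventually_gt_at_top[of 0] by eventually_elim (simp add: flat_def)
  ultimately show ?thesis by (rule Lim_transform_eventually)
qed

lemma flat_next_1_tendsto: "((\<lambda>x. (x + 1) * flat (flat_next 1) x) \<longlongrightarrow> 0) at_top"
proof -
  have "flat (flat_next 1) x = flat ([:0, 1:] * [:0, 1:]) x" for x by (simp add: flat_next_def)
  then have "(x + 1) * flat (flat_next 1) x = flat [:0, 1:] x + flat (flat_next 1) x" for x
    using flat_mult_X[of x "[:0, 1:]"] by (metis distrib_right mult_1)
  moreover have "((\<lambda>x. flat [:0, 1:] x + flat (flat_next 1) x) \<longlongrightarrow> 0) at_top"
    using tendsto_add[OF flat_tendsto[of "[:0, 1:]"] flat_tendsto[of "flat_next 1"]] by (simp add: flat_next_def)
  ultimately show ?thesis by presburger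
qed

lemma flat_continuous: "continuous_on UNIV (\<lambda>x::'a::euclidean_space. flat q (real n * (x \<bullet> x) - 1))"
proof -
  have "continuous_on UNIV (flat q)"
    using flat_has_real_derivative by (intro continuous_at_imp_continuous_on) (blast intro: DERIV_isCont)
  then show ?thesis
    by (rule continuous_on_compose2[of UNIV "flat q"]) (auto intro!: continuous_intros)
qed

lemmas flat_measurable = borel_measurable_continuous_onI[OF flat_continuous]

lemma filterlim_real_mult_minus_at_top:
  assumes "s > 0" shows "filterlim (\<lambda>n. real n * s - 1) at_top sequentially"
proof -
  have "filterlim (\<lambda>n. - 1 + s * real n) at_top sequentially"
    by (intro filterlim_tendsto_add_at_top[OF tendsto_const] filterlim_tendsto_pos_mult_at_top[OF tendsto_const assms]
        filterlim_real_sequentially)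
  then show ?thesis by (simp add: algebra_simps)
qed

lemma slice_DERIV:
  fixes F :: "spacetime \<Rightarrow> real"
  assumes "F differentiable (at (t, x))"
  shows "((\<lambda>r. F (t, x + r *\<^sub>R axis i 1)) has_real_derivative dx i F (t, x)) (at 0)"
proof -
  have "((\<lambda>r. (t, x + r *\<^sub>R axis i 1)) has_derivative (\<lambda>r. (0, r *\<^sub>R axis i 1))) (at (0::real))"
    by (auto intro!: derivative_eq_intros)
  moreover have F: "(F has_derivative frechet_derivative F (at (t, x))) (at (t, x + 0 *\<^sub>R axis i 1))"
    using assms by (simp add: frechet_derivative_works)
  ultimately have "((\<lambda>r. F (t, x + r *\<^sub>R axis i 1)) has_derivative (\<lambda>r. frechet_derivative F (at (t, x)) (0, r *\<^sub>R axis i 1))) (at 0)"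
    by (rule has_derivative_compose)
  moreover have "frechet_derivative F (at (t, x)) (0, r *\<^sub>R axis i 1) = dx i F (t, x) * r" for r
    using linear_cmul[OF linear_frechet_derivative[OF assms], of r "(0, axis i 1)"] by (simp add: dx_def mult.commute)
  ultimately show ?thesis by (simp add: has_field_derivative_def mult_commute_abs)
qed

lemma time_DERIV:
  fixes F :: "spacetime \<Rightarrow> real"
  assumes "F differentiable (at (t, x))"
  shows "((\<lambda>r. F (r, x)) has_real_derivative dt F (t, x)) (at t)"
proof -
  have "((\<lambda>r. (r, x)) has_derivative (\<lambda>r. (r, 0))) (at t)"
    by (auto intro!: derivative_eq_intros)
  moreover have F: "(F has_derivative frechet_derivative F (at (t, x))) (at (t, x))"
    using assms by (simp add: frechet_derivative_works)
  ultimately have "((\<lambda>r. F (r, x)) has_derivative (\<lambda>r. frechet_derivative F (at (t, x)) (r, 0))) (at t)"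
    by (rule has_derivative_compose)
  moreover have "frechet_derivative F (at (t, x)) (r, 0) = dt F (t, x) * r" for r
    using linear_cmul[OF linear_frechet_derivative[OF assms], of r "(1, 0)"] by (simp add: dt_def mult.commute)
  ultimately show ?thesis by (simp add: has_field_derivative_def mult_commute_abs)
qed

text \<open>A singularity of order below 2 has no flux through the origin. The cutoff
  \<open>flat 1 (n * (x \<bullet> x) - 1)\<close> removes the origin; its gradient is bounded by a
  multiple of \<open>1 / norm x\<close> uniformly in \<open>n\<close> and tends to 0 pointwise.
  Hence the error term tends to 0 under the majorant \<open>norm x powr (- (p + 1))\<close>,
  integrable because \<open>p + 1 < 3\<close>.\<close>

lemma slice_integral_dx_eq_0:
  assumes P: "tame1 p P" and p: "0 \<le> p" "p < 2" and \<rho>: "\<rho> < 1"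
    and supp: "\<And>q. q \<in> cyl \<Longrightarrow> norm (snd q) > \<rho> \<Longrightarrow> P q = 0"
  shows "slice_integral t (dx i P) = 0"
proof (cases "t > 0")
  case False
  then have "zcut (dx i P) (t, x) = 0" for x by (simp add: zcut_def in_cyl)
  then show ?thesis by (simp add: slice_integral_def)
next
  case t: True
  define k where "k = flat (flat_next 1)"
  define h where "h n x = flat 1 (real n * (x \<bullet> x) - 1) * zcut P (t, x)" for n and x :: "real^3"
  define h' where "h' n x = flat 1 (real n * (x \<bullet> x) - 1) * zcut (dx i P) (t, x)
    + (2 * real n * x $ i * k (real n * (x \<bullet> x) - 1)) * zcut P (t, x)" for n and x :: "real^3"
  obtain C where C: "C \<ge> 0" "\<And>t x. \<bar>zcut P (t, x)\<bar> \<le> C * (indicator (ball 0 1) x * norm x powr (- p))"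
    using tame_zcut_bound[OF tame1D(1)[OF P]] by blast
  obtain C' where C': "C' \<ge> 0" "\<And>t x. \<bar>zcut (dx i P) (t, x)\<bar> \<le> C' * (indicator (ball 0 1) x * norm x powr (- (p + 1)))"
    using tame_zcut_bound[OF tame1D(4)[OF P]] by blast
  obtain K where K: "K \<ge> 0" "\<And>x. \<bar>(x + 1) * k x\<bar> \<le> K" using flat_next_1_bound unfolding k_def by blast
  have fl: "((\<lambda>r. flat 1 (real n * ((x + r *\<^sub>R axis i 1) \<bullet> (x + r *\<^sub>R axis i 1)) - 1)) has_real_derivative
      2 * real n * x $ i * k (real n * (x \<bullet> x) - 1)) (at 0)" for n and x :: "real^3"
  proof -
    have "((\<lambda>r. real n * ((x + r *\<^sub>R axis i 1) \<bullet> (x + r *\<^sub>R axis i 1)) - 1) has_real_derivative 2 * real n * x $ i) (at 0)"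
      by (auto intro!: derivative_eq_intros simp: inner_axis inner_axis' algebra_simps)
    from DERIV_chain2[OF flat_has_real_derivative this, of 1]
    show ?thesis unfolding k_def by (simp add: mult_ac)
  qed
  have D: "((\<lambda>r. h n (x + r *\<^sub>R axis i 1)) has_real_derivative h' n x) (at 0)" for n x
  proof -
    have lim: "((\<lambda>r::real. x + r *\<^sub>R axis i 1) \<longlongrightarrow> x) (at 0)" by (auto intro!: tendsto_eq_intros)
    have ev0: "(\<forall>\<^sub>F r in at 0. x + r *\<^sub>R axis i 1 \<in> U)" if "open U" "x \<in> U" for U
      using topological_tendstoD[OF lim that] .
    consider "x = 0" | "norm x \<ge> 1" | "x \<in> ball 0 1 - {0}" by force
    then show ?thesis
    proof cases
      case 1
      \<comment> \<open>Near the origin the argument of the cutoff is negative, so the product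
        vanishes identically there, whatever the singularity of \<open>P\<close>.\<close>
      have "open {y::real^3. real n * (y \<bullet> y) < 1}" by (intro open_Collect_less continuous_intros)
      from ev0[OF this] have "\<forall>\<^sub>F r in at 0. h n (x + r *\<^sub>R axis i 1) = 0"
        using 1 by (auto elim!: eventually_mono simp: h_def flat_def)
      moreover have "h n (x + 0 *\<^sub>R axis i 1) = 0" "h' n x = 0" using 1 by (auto simp: h_def h'_def zcut_def in_cyl)
      ultimately have "((\<lambda>r. h n (x + r *\<^sub>R axis i 1)) has_real_derivative h' n x) (at 0) \<longleftrightarrow> ((\<lambda>r::real. 0::real) has_real_derivative 0) (at 0)"
        by (intro DERIV_cong_ev) (auto simp: eventually_at_filter elim: eventually_mono)
      then show ?thesis by simp
    next
      case 2
      have z: "zcut P (t, y) = 0" if "norm y > \<rho>" for y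
        using supp[of "(t, y)"] that by (cases "(t, y) \<in> cyl") auto
      have "open {y::real^3. \<rho> < norm y}" by (intro open_Collect_less continuous_intros)
      from ev0[OF this] have "\<forall>\<^sub>F r in at 0. h n (x + r *\<^sub>R axis i 1) = 0"
        using 2 \<rho> by (auto elim!: eventually_mono simp: h_def z)
      moreover have "h n (x + 0 *\<^sub>R axis i 1) = 0" "h' n x = 0" using 2 by (auto simp: h_def h'_def zcut_def in_cyl)
      ultimately have "((\<lambda>r. h n (x + r *\<^sub>R axis i 1)) has_real_derivative h' n x) (at 0) \<longleftrightarrow> ((\<lambda>r::real. 0::real) has_real_derivative 0) (at 0)"
        by (intro DERIV_cong_ev) (auto simp: eventually_at_filter elim: eventually_mono)
      then show ?thesis by simp
    next
      case 3
      then have q: "(t, x) \<in> cyl" using t by (simp add: cyl_def)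
      have "((\<lambda>r. flat 1 (real n * ((x + r *\<^sub>R axis i 1) \<bullet> (x + r *\<^sub>R axis i 1)) - 1) * P (t, x + r *\<^sub>R axis i 1))
         has_real_derivative h' n x) (at 0)"
        using DERIV_mult[OF fl[of n x] slice_DERIV[OF tame1D(2)[OF P q], of i]] q by (simp add: h'_def algebra_simps)
      moreover have "\<forall>\<^sub>F r in at 0. h n (x + r *\<^sub>R axis i 1) =
         flat 1 (real n * ((x + r *\<^sub>R axis i 1) \<bullet> (x + r *\<^sub>R axis i 1)) - 1) * P (t, x + r *\<^sub>R axis i 1)"
        using ev0[of "ball 0 1 - {0}"] 3 t by (auto elim!: eventually_mono simp: h_def zcut_def cyl_def open_delete)
      moreover have "h n (x + 0 *\<^sub>R axis i 1) =
         flat 1 (real n * ((x + 0 *\<^sub>R axis i 1) \<bullet> (x + 0 *\<^sub>R axis i 1)) - 1) * P (t, x + 0 *\<^sub>R axis i 1)"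
        using q by (simp add: h_def)
      ultimately show ?thesis
        by (subst DERIV_cong_ev[OF refl _ refl]) (auto simp: eventually_at_filter elim: eventually_mono)
    qed
  qed
  have kn: "\<bar>2 * real n * x $ i * k (real n * (x \<bullet> x) - 1)\<bar> \<le> 2 * K * norm x powr (- 1)" if "x \<noteq> 0" for n x
  proof -
    have "\<bar>real n * (x \<bullet> x) * k (real n * (x \<bullet> x) - 1)\<bar> \<le> K" using K(2)[of "real n * (x \<bullet> x) - 1"] by simp
    then have "norm x * (real n * norm x * \<bar>k (real n * (x \<bullet> x) - 1)\<bar>) \<le> K"
      by (simp add: abs_mult dot_square_norm power2_eq_square mult_ac)
    then have "real n * norm x * \<bar>k (real n * (x \<bullet> x) - 1)\<bar> \<le> K / norm x"
      using that by (simp add: field_simps)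
    moreover have "real n * \<bar>x $ i\<bar> * \<bar>k (real n * (x \<bullet> x) - 1)\<bar> \<le> real n * norm x * \<bar>k (real n * (x \<bullet> x) - 1)\<bar>"
      using component_le_norm_cart by (intro mult_right_mono mult_left_mono) auto
    ultimately show ?thesis using that by (simp add: abs_mult powr_minus_divide)
  qed
  define B where "B = C' + 2 * K * C"
  have dom: "norm (h' n x) \<le> B * (indicator (ball 0 1) x * norm x powr (- (p + 1)))" for n x
  proof (cases "x \<in> ball 0 1 - {0}")
    case True
    have "\<bar>flat 1 (real n * (x \<bullet> x) - 1) * zcut (dx i P) (t, x)\<bar> \<le> 1 * (C' * norm x powr (- (p + 1)))"
      unfolding abs_mult using C'(2)[of t x] True flat_1_bounds C'(1) by (intro mult_mono) auto
    moreover have "\<bar>(2 * real n * x $ i * k (real n * (x \<bullet> x) - 1)) * zcut P (t, x)\<bar> \<le> (2 * K * norm x powr (- 1)) * (C * norm x powr (- p))"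
      unfolding abs_mult[of _ "zcut P (t, x)"] using C(2)[of t x] True kn[of x n] K by (intro mult_mono) auto
    moreover have "norm x powr (- (p + 1)) = norm x powr (- 1) * norm x powr (- p)"
      unfolding powr_add[symmetric] by (rule arg_cong[where f="\<lambda>a. norm x powr a"]) simp
    then have "(2 * K * norm x powr (- 1)) * (C * norm x powr (- p)) = 2 * K * C * norm x powr (- (p + 1))"
      by (simp only: mult_ac)
    ultimately have "\<bar>h' n x\<bar> \<le> 1 * (C' * norm x powr (- (p + 1))) + 2 * K * C * norm x powr (- (p + 1))"
      unfolding h'_def by (intro order_trans[OF abs_triangle_ineq]) linarith
    then show ?thesis using True by (simp add: B_def distrib_right)
  next
    case False
    then have "zcut (dx i P) (t, x) = 0" "zcut P (t, x) = 0" by (auto simp: zcut_def in_cyl)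
    then show ?thesis using C(1) C'(1) K(1) by (simp add: h'_def B_def)
  qed
  have "(LINT x|lborel. h' n x) = 0" for n
  proof (rule integral_directional_derivative_eq_0[where h="h n" and R=1 and b="axis i 1"])
    show "integrable lborel (h n)"
    proof (rule Bochner_Integration.integrable_bound)
      show "integrable lborel (\<lambda>x. zcut P (t, x))" using tame_slice_integrable[OF tame1D(1)[OF P]] p by simp
      show "h n \<in> borel_measurable lborel"
      proof -
        have "(\<lambda>x. zcut P (t, x)) \<in> borel_measurable borel"
          using borel_measurable_integrable[OF \<open>integrable lborel (\<lambda>x. zcut P (t, x))\<close>] by simp
        from borel_measurable_times[OF flat_measurable this] show ?thesis by (simp add: h_def[abs_def])
      qed
      show "AE x in lborel. norm (h n x) \<le> norm (zcut P (t, x))"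
        using flat_1_bounds by (intro AE_I2) (auto simp: h_def abs_mult intro: mult_left_le_one_le)
    qed
    \<comment> \<open>Inside radius \<open>a\<close> the cutoff and its gradient vanish; outside,
      \<open>dom\<close> bounds \<open>h' n\<close>. The bound may depend on \<open>n\<close>, as
      only one \<open>n\<close> is considered here.\<close>
    define a where "a = 1 / sqrt (real n + 1)"
    have a: "a > 0" by (simp add: a_def)
    show "\<bar>h' n x\<bar> \<le> B * a powr (- (p + 1))" for x
    proof (cases "x \<in> ball 0 1 \<and> norm x \<ge> a")
      case True
      then have "norm x powr (- (p + 1)) \<le> a powr (- (p + 1))" using a p by (intro powr_mono2') auto
      then have "B * (indicator (ball 0 1) x * norm x powr (- (p + 1))) \<le> B * a powr (- (p + 1))"
        using True C(1) C'(1) K(1) by (intro mult_left_mono) (auto simp: B_def)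
      then show ?thesis using dom[of n x] by simp
    next
      case False
      have "h' n x = 0"
      proof (cases "x \<in> ball 0 1")
        case True
        then have "norm x < a" using False by auto
        then have "(norm x)\<^sup>2 < a\<^sup>2" by (intro power_strict_mono) auto
        then have "(real n + 1) * (x \<bullet> x) < 1" by (simp add: a_def dot_square_norm power_divide field_simps)
        then have "real n * (x \<bullet> x) - 1 \<le> 0" using inner_ge_zero[of x] unfolding distrib_right by linarith
        then show ?thesis unfolding h'_def k_def by (simp add: flat_def)
      qed (auto simp: h'_def zcut_def in_cyl)
      then show ?thesis using C(1) C'(1) K(1) by (simp add: B_def)
    qed
    show "h n x = 0" if "norm x > 1" for x using that by (simp add: h_def zcut_def in_cyl)
  qed (use D in auto)
  moreover have "(\<lambda>n. LINT x|lborel. h' n x) \<longlonglongrightarrow> (LINT x|lborel. zcut (dx i P) (t, x))"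
  proof (rule integral_dominated_convergence[where w="\<lambda>x. B * (indicator (ball 0 1) x * norm x powr (- (p + 1)))"])
    show "(\<lambda>x. zcut (dx i P) (t, x)) \<in> borel_measurable lborel"
      using tame_slice_integrable[OF tame1D(4)[OF P]] p by (intro borel_measurable_integrable) simp
    show "integrable lborel (\<lambda>x::real^3. B * (indicator (ball 0 1) x * norm x powr (- (p + 1))))"
      using integrable_norm_powr_ball[where 'a="real^3", of "p + 1"] p by (intro integrable_mult_right) simp
    have "(\<lambda>x. zcut (dx i P) (t, x)) \<in> borel_measurable borel" "(\<lambda>x. zcut P (t, x)) \<in> borel_measurable borel"
      using borel_measurable_integrable[OF tame_slice_integrable[OF tame1D(4)[OF P]]]
        borel_measurable_integrable[OF tame_slice_integrable[OF tame1D(1)[OF P]]] p by auto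
    then show "h' n \<in> borel_measurable lborel" for n
      unfolding h'_def[abs_def] k_def measurable_lborel1
      by (intro borel_measurable_add borel_measurable_times flat_measurable borel_measurable_const)
        (auto intro!: borel_measurable_continuous_onI continuous_intros flat_continuous)
    show "AE x in lborel. (\<lambda>n. h' n x) \<longlonglongrightarrow> zcut (dx i P) (t, x)"
    proof (rule AE_I2)
      fix x :: "real^3"
      show "(\<lambda>n. h' n x) \<longlonglongrightarrow> zcut (dx i P) (t, x)"
      proof (cases "x \<in> ball 0 1 - {0}")
        case True
        then have s: "x \<bullet> x > 0" by simp
        have "(\<lambda>n. flat 1 (real n * (x \<bullet> x) - 1)) \<longlonglongrightarrow> 1"
          by (rule filterlim_compose[OF flat_1_tendsto filterlim_real_mult_minus_at_top[OF s]])
        moreover have "(\<lambda>n. 2 * real n * x $ i * k (real n * (x \<bullet> x) - 1)) \<longlonglongrightarrow> 0"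
        proof -
          have "(\<lambda>n. (2 * x $ i / (x \<bullet> x)) * (((real n * (x \<bullet> x) - 1) + 1) * k (real n * (x \<bullet> x) - 1))) \<longlonglongrightarrow> (2 * x $ i / (x \<bullet> x)) * 0"
            unfolding k_def by (intro tendsto_intros filterlim_compose[OF flat_next_1_tendsto filterlim_real_mult_minus_at_top[OF s]])
          moreover have "(2 * x $ i / (x \<bullet> x)) * (((real n * (x \<bullet> x) - 1) + 1) * k (real n * (x \<bullet> x) - 1)) = 2 * real n * x $ i * k (real n * (x \<bullet> x) - 1)" for n
            using s by (simp add: field_simps)
          ultimately show ?thesis by simp
        qed
        ultimately have "(\<lambda>n. h' n x) \<longlonglongrightarrow> 1 * zcut (dx i P) (t, x) + 0 * zcut P (t, x)"
          unfolding h'_def by (intro tendsto_intros)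
        then show ?thesis by simp
      next
        case False
        then show ?thesis by (auto simp: h'_def zcut_def in_cyl)
      qed
    qed
  qed (use dom in auto)
  ultimately show ?thesis unfolding slice_integral_def by (simp add: LIMSEQ_const_iff)
qed

text \<open>The fundamental theorem of calculus on each line of constant \<open>x\<close>, started
  at a positive time \<open>a\<close> before the support of \<open>P\<close>, because continuity of
  \<open>dt P\<close> is available for positive times only.\<close>

lemma slab_integral_dt:
  assumes P: "tame1 p P" and p: "p < 3" and t0: "t0 > 0" and T: "T > 0"
    and supp: "\<And>q. q \<in> cyl \<Longrightarrow> fst q < t0 \<Longrightarrow> P q = 0"
  shows "slab_integral T (dt P) = slice_integral T P"
proof -
  have inner: "(LINT t|lborel. indicator {0<..<T} t * zcut (dt P) (t, x)) = zcut P (T, x)" for x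
  proof (cases "x \<in> ball 0 1 - {0}")
    case False
    then have "zcut F (t, x) = 0" for t F by (auto simp: zcut_def in_cyl)
    then show ?thesis by simp
  next
    case True
    then have q: "(t, x) \<in> cyl" if "t > 0" for t using that by (simp add: cyl_def)
    define a where "a = min t0 T / 2"
    have a: "0 < a" "a < t0" "a < T" using t0 T by (auto simp: a_def)
    have dz: "dt P (t, x) = 0" if "0 < t" "t < t0" for t
    proof -
      have "((\<lambda>r. P (r, x)) has_real_derivative 0) (at t)"
      proof (rule has_field_derivative_transform_within_open[of "\<lambda>_. 0" _ _ "{0<..<t0}"])
        show "0 = P (r, x)" if "r \<in> {0<..<t0}" for r using supp[OF q] that by auto
      qed (use that in auto)
      then show ?thesis using time_DERIV[OF tame1D(2)[OF P q[OF that(1)]]] DERIV_unique by blast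
    qed
    have cont: "continuous_on {a..T} (\<lambda>t. dt P (t, x))"
      using tame1D(3)[OF P] unfolding tame_def
      by (intro continuous_on_compose2[where f="\<lambda>t. (t, x)" and g="dt P" and t=cyl])
        (use q a in \<open>auto intro!: continuous_intros\<close>)
    have "(LINT t|lborel. indicator {0<..<T} t * zcut (dt P) (t, x)) = (LINT t|lborel. indicator {a..T} t *\<^sub>R dt P (t, x))"
    proof (rule integral_cong_AE)
      have "AE t in lborel. t \<noteq> T" using AE_lborel_singleton by blast
      then show "AE t in lborel. indicator {0<..<T} t * zcut (dt P) (t, x) = indicator {a..T} t *\<^sub>R dt P (t, x)"
      proof (eventually_elim)
        case (elim t)
        show ?case using q[of t] dz[of t] a elim by (auto simp: indicator_def not_le)
      qed
      have "zcut (dt P) \<in> borel_measurable borel" by (rule tame_zcut_measurable[OF tame1D(3)[OF P]])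
      then have "(\<lambda>t. zcut (dt P) (t, x)) \<in> borel_measurable borel"
        by (rule measurable_compose[rotated]) (auto intro!: borel_measurable_continuous_onI continuous_intros)
      then show "(\<lambda>t. indicator {0<..<T} t * zcut (dt P) (t, x)) \<in> borel_measurable lborel"
        unfolding measurable_lborel1 by (intro borel_measurable_times borel_measurable_indicator) auto
      show "(\<lambda>t. indicator {a..T} t *\<^sub>R dt P (t, x)) \<in> borel_measurable lborel"
        using borel_measurable_continuous_on_indicator[OF _ cont] by simp
    qed
    also have "\<dots> = P (T, x) - P (a, x)"
    proof (rule integral_FTC_Icc)
      show "((\<lambda>t. P (t, x)) has_vector_derivative dt P (t, x)) (at t within {a..T})" if "a \<le> t" "t \<le> T" for t
        using time_DERIV[OF tame1D(2)[OF P q[of t]]] that a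
        by (auto simp: has_real_derivative_iff_has_vector_derivative[symmetric] intro: has_field_derivative_at_within)
    qed (use a cont in auto)
    also have "\<dots> = zcut P (T, x)" using supp[OF q[of a]] q[of T] a T by simp
    finally show ?thesis .
  qed
  show ?thesis
    unfolding slab_fubini(2)[OF tame1D(3)[OF P] p] inner slice_integral_def ..
qed

text \<open>Compact support in the open cylinder \<open>(0,\<infinity>) \<times> ball\<close> up to the final time.\<close>

definition supported :: "(spacetime \<Rightarrow> real) \<Rightarrow> bool" where
  "supported P \<longleftrightarrow> (\<exists>t0>0. \<exists>\<rho><1. \<forall>q\<in>cyl. P q \<noteq> 0 \<longrightarrow> t0 \<le> fst q \<and> norm (snd q) \<le> \<rho>)"

lemma supported_mult_left: "supported P \<Longrightarrow> supported (\<lambda>q. F q * P q)"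
  and supported_mult_right: "supported P \<Longrightarrow> supported (\<lambda>q. P q * F q)"
  unfolding supported_def by (fastforce)+

lemma supported_add:
  assumes "supported P" "supported Q" shows "supported (\<lambda>q. P q + Q q)"
proof -
  obtain t0 t1 r0 r1 where "t0 > 0" "t1 > 0" "r0 < 1" "r1 < 1"
    "\<forall>q\<in>cyl. P q \<noteq> 0 \<longrightarrow> t0 \<le> fst q \<and> norm (snd q) \<le> r0"
    "\<forall>q\<in>cyl. Q q \<noteq> 0 \<longrightarrow> t1 \<le> fst q \<and> norm (snd q) \<le> r1"
    using assms unfolding supported_def by blast
  then show ?thesis unfolding supported_def
    by (intro exI[of _ "min t0 t1"] conjI exI[of _ "max r0 r1"]) (simp, simp, fastforce simp: min_le_iff_disj le_max_iff_disj)
qed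

lemma supported_minus: "supported P \<Longrightarrow> supported (\<lambda>q. - P q)"
  unfolding supported_def by simp

lemma supported_diff: "supported P \<Longrightarrow> supported Q \<Longrightarrow> supported (\<lambda>q. P q - Q q)"
  using supported_add[OF _ supported_minus, of P Q] by simp

text \<open>Divergence theorem in space-time: the sphere and the initial time contribute nothing
  because of the supports, the axis nothing because of \<open>p < 2\<close>. The weak equations and
  the energy balance are all instances of it.\<close>

lemma slab_divergence:
  assumes P0: "tame1 p P0" "supported P0" and P: "\<And>i. tame1 p (P i)" "\<And>i. supported (P i)"
    and p: "0 \<le> p" "p < 2" and T: "T > 0"
    and J: "\<And>q. q \<in> cyl \<Longrightarrow> J q = dt P0 q + (\<Sum>i\<in>UNIV. dx i (P i) q)"
  shows "slab_integral T J = slice_integral T P0"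
proof -
  have z: "slab_integral T (dx i (P i)) = 0" for i
  proof -
    obtain \<rho> where \<rho>: "\<rho> < 1" "\<forall>q\<in>cyl. P i q \<noteq> 0 \<longrightarrow> norm (snd q) \<le> \<rho>"
      using P(2)[of i] unfolding supported_def by blast
    have "slice_integral t (dx i (P i)) = 0" for t
      by (rule slice_integral_dx_eq_0[OF P(1) p \<rho>(1)]) (use \<rho>(2) in force)
    then show ?thesis
      using slab_fubini(1)[OF tame1D(4)[OF P(1)], where T=T] p by simp
  qed
  obtain t0 where t0: "t0 > 0" "\<forall>q\<in>cyl. P0 q \<noteq> 0 \<longrightarrow> t0 \<le> fst q"
    using P0(2) unfolding supported_def by blast
  have "slab_integral T J = slab_integral T (\<lambda>q. dt P0 q + (\<Sum>i\<in>UNIV. dx i (P i) q))"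
    by (rule slab_integral_cong) (rule J)
  also have "\<dots> = slab_integral T (dt P0) + slab_integral T (\<lambda>q. \<Sum>i\<in>UNIV. dx i (P i) q)"
    using p by (intro slab_integral_add[of "p + 1"] tame_sum tame1D(4) P tame_weaken[OF tame1D(3)[OF P0(1)]]) auto
  also have "slab_integral T (\<lambda>q. \<Sum>i\<in>UNIV. dx i (P i) q) = 0"
    using p by (subst slab_integral_sum[of _ "p + 1"]) (auto intro: tame1D(4) P simp: z)
  also have "slab_integral T (dt P0) = slice_integral T P0"
    by (rule slab_integral_dt[OF P0(1) _ t0(1) T]) (use p t0(2) in force)+
  finally show ?thesis by simp
qed

section \<open>Test functions\<close>

lemma test_function_frechet:
  assumes "test_function S \<phi>" "b \<in> Basis"
  shows "test_function S (\<lambda>x. frechet_derivative \<phi> (at x) b)"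
proof -
  let ?\<psi> = "\<lambda>x. frechet_derivative \<phi> (at x) b"
  let ?K = "closure {x. \<phi> x \<noteq> 0}"
  have "?\<psi> x = 0" if "x \<notin> ?K" for x
  proof -
    have z: "\<phi> y = 0" if "y \<in> - ?K" for y using that closure_subset[of "{x. \<phi> x \<noteq> 0}"] by blast
    have "frechet_derivative \<phi> (at x) = frechet_derivative (\<lambda>_. 0) (at x)"
      by (rule frechet_derivative_cong_open[OF open_Compl[OF closed_closure] _ z]) (use that in \<open>simp_all only: Compl_iff, simp\<close>)
    then show ?thesis by simp
  qed
  then have "{x. ?\<psi> x \<noteq> 0} \<subseteq> ?K" by blast
  then have sub: "closure {x. ?\<psi> x \<noteq> 0} \<subseteq> ?K" by (simp add: closure_minimal)
  have "Ck_on (Suc k) UNIV \<phi>" for k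
    using assms(1) unfolding test_function_def smooth_on_def by blast
  then have "smooth_on UNIV ?\<psi>" using assms(2) by (auto simp: smooth_on_def)
  moreover have "compact (closure {x. ?\<psi> x \<noteq> 0})"
    using assms(1) compact_Int_closed[of ?K "closure {x. ?\<psi> x \<noteq> 0}"] sub
    unfolding test_function_def by (simp add: Int_absorb1)
  ultimately show ?thesis using assms(1) sub unfolding test_function_def by blast
qed

lemma test_function_dt: "test_function S \<phi> \<Longrightarrow> test_function S (dt \<phi>)"
  and test_function_dx: "test_function S \<phi> \<Longrightarrow> test_function S (dx i \<phi>)"
  unfolding dt_def dx_def by (rule test_function_frechet; simp add: Basis_prod_def axis_in_Basis_iff)+

lemma test_function_differentiable: "test_function S \<phi> \<Longrightarrow> \<phi> differentiable (at q)"
  using Ck_on.simps(2)[of 0 UNIV \<phi>] unfolding test_function_def smooth_on_def by blast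

lemma test_function_continuous: "test_function S \<phi> \<Longrightarrow> continuous_on UNIV \<phi>"
  using Ck_on.simps(1)[of UNIV \<phi>] unfolding test_function_def smooth_on_def by blast

lemma test_function_bounded:
  fixes \<phi> :: "'a::euclidean_space \<Rightarrow> 'b::real_normed_vector"
  assumes "test_function S \<phi>"
  obtains C where "C \<ge> 0" "\<And>x. norm (\<phi> x) \<le> C"
proof -
  let ?K = "closure {x. \<phi> x \<noteq> 0}"
  have "compact ?K" using assms by (simp add: test_function_def)
  then have "bounded (\<phi> ` ?K)"
    using test_function_continuous[OF assms]
    by (intro compact_imp_bounded compact_continuous_image) (auto intro: continuous_on_subset)
  then obtain C where C: "C > 0" "\<And>x. x \<in> ?K \<Longrightarrow> norm (\<phi> x) \<le> C" unfolding bounded_pos by auto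
  moreover have "norm (\<phi> x) \<le> C" if "x \<notin> ?K" for x
  proof -
    have "\<phi> x = 0" using that closure_subset[of "{x. \<phi> x \<noteq> 0}"] by blast
    then show ?thesis using C(1) by simp
  qed
  ultimately show ?thesis using that[of C] by (meson less_imp_le)
qed

lemma test_function_tame: "test_function S \<phi> \<Longrightarrow> tame 0 \<phi>"
proof -
  assume a: "test_function S \<phi>"
  obtain C where "C \<ge> 0" "\<And>q. norm (\<phi> q) \<le> C" using test_function_bounded[OF a] by blast
  then show ?thesis unfolding tame_def
    using continuous_on_subset[OF test_function_continuous[OF a]] by (auto simp: in_cyl intro!: exI[of _ C])
qed

lemma test_function_tame1: "test_function S \<phi> \<Longrightarrow> tame1 0 \<phi>"
  unfolding tame1_def
  by (auto intro: test_function_tame test_function_dt tame_weaken[OF test_function_tame[OF test_function_dx]]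
      test_function_differentiable)

text \<open>Time and radius attain their extrema on the compact support, which therefore keeps a
  positive distance from the initial time and from the sphere.\<close>

lemma test_function_support:
  fixes \<phi> :: "spacetime \<Rightarrow> real"
  assumes "test_function S \<phi>" "S \<subseteq> {0<..} \<times> ball (0::real^3) 1"
  obtains t0 T \<rho> where "t0 > 0" "T > 0" "\<rho> < 1" "\<And>q. \<phi> q \<noteq> 0 \<Longrightarrow> t0 \<le> fst q \<and> fst q < T \<and> norm (snd q) \<le> \<rho>"
proof -
  let ?K = "closure {q. \<phi> q \<noteq> 0}"
  have K: "compact ?K" "?K \<subseteq> {0<..} \<times> ball 0 1" and sub: "{q. \<phi> q \<noteq> 0} \<subseteq> ?K"
    using assms closure_subset[of "{q. \<phi> q \<noteq> 0}"] unfolding test_function_def by blast+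
  show ?thesis
  proof (cases "?K = {}")
    case True
    then show ?thesis using that[of 1 1 0] sub by auto
  next
    case False
    obtain a where a: "a \<in> ?K" "\<And>q. q \<in> ?K \<Longrightarrow> fst a \<le> fst q"
      using continuous_attains_inf[OF K(1) False, of fst] continuous_on_fst[OF continuous_on_id] by blast
    obtain b where b: "b \<in> ?K" "\<And>q. q \<in> ?K \<Longrightarrow> fst q \<le> fst b"
      using continuous_attains_sup[OF K(1) False, of fst] continuous_on_fst[OF continuous_on_id] by blast
    obtain c where c: "c \<in> ?K" "\<And>q. q \<in> ?K \<Longrightarrow> norm (snd q) \<le> norm (snd c)"
      using continuous_attains_sup[OF K(1) False, of "\<lambda>q. norm (snd q)"] continuous_on_norm[OF continuous_on_snd[OF continuous_on_id]] by blast
    have "fst a > 0" "fst b > 0" "norm (snd c) < 1" using a(1) b(1) c(1) K(2) by auto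
    then show ?thesis using that[of "fst a" "fst b + 1" "norm (snd c)"] a(2) b(2) c(2) sub by fastforce
  qed
qed

lemma test_function_supported:
  assumes "test_function S \<phi>" "S \<subseteq> {0<..} \<times> ball (0::real^3) 1" shows "supported \<phi>"
proof -
  obtain t0 T \<rho> where "t0 > 0" "T > 0" "\<rho> < 1" "\<And>q. \<phi> q \<noteq> 0 \<Longrightarrow> t0 \<le> fst q \<and> fst q < T \<and> norm (snd q) \<le> \<rho>"
    using test_function_support[OF assms] by blast
  then show ?thesis unfolding supported_def by blast
qed

section \<open>Fields supported in the cylinder\<close>

definition vfield :: "(3 \<Rightarrow> spacetime \<Rightarrow> real) \<Rightarrow> spacetime \<Rightarrow> real^3" where
  "vfield W q = (\<chi> i. zcut (W i) q)"

definition mfield :: "(3 \<Rightarrow> 3 \<Rightarrow> spacetime \<Rightarrow> real) \<Rightarrow> spacetime \<Rightarrow> real^3^3" where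
  "mfield G q = (\<chi> i j. zcut (G i j) q)"

lemma power2_norm_vec: "(norm (x :: real^'n))\<^sup>2 = (\<Sum>i\<in>UNIV. (x $ i)\<^sup>2)"
  unfolding power2_norm_eq_inner inner_vec_def by (simp add: power2_eq_square)

lemma power2_norm_mat: "(norm (A :: real^'n^'m))\<^sup>2 = (\<Sum>i\<in>UNIV. \<Sum>j\<in>UNIV. (A $ i $ j)\<^sup>2)"
  unfolding power2_norm_eq_inner inner_vec_def by (simp add: power2_eq_square)

lemma zcut_sum: "zcut (\<lambda>q. \<Sum>i\<in>I. F i q) q = (\<Sum>i\<in>I. zcut (F i) q)"
  by (auto simp: zcut_def)

lemma zcut_mult: "zcut (\<lambda>q. F q * G q) q = zcut F q * zcut G q"
  by (auto simp: zcut_def)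

lemma norm_vfield: "(norm (vfield W q))\<^sup>2 = zcut (\<lambda>q. \<Sum>i\<in>UNIV. W i q * W i q) q"
  unfolding power2_norm_vec by (simp add: vfield_def zcut_sum zcut_mult power2_eq_square)

lemma norm_mfield: "(norm (mfield G q))\<^sup>2 = zcut (\<lambda>q. \<Sum>i\<in>UNIV. \<Sum>j\<in>UNIV. G i j q * G i j q) q"
  unfolding power2_norm_mat by (simp add: mfield_def zcut_sum zcut_mult power2_eq_square)

text \<open>The notions to be verified integrate against \<open>lebesgue\<close>, the calculations
  against \<open>lborel\<close>; for Borel integrands the completion makes no difference.\<close>

lemma lebesgue_set_integrable_iff:
  fixes f :: "'a::euclidean_space \<Rightarrow> 'b::euclidean_space"
  assumes "f \<in> borel_measurable borel" "S \<in> sets borel"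
  shows "f absolutely_integrable_on S \<longleftrightarrow> integrable lborel (\<lambda>x. indicator S x *\<^sub>R f x)"
    and "(LINT x:S|lebesgue. f x) = (LINT x|lborel. indicator S x *\<^sub>R f x)"
proof -
  have m: "(\<lambda>x. indicator S x *\<^sub>R f x) \<in> borel_measurable lborel"
    using assms by (auto intro!: borel_measurable_scaleR borel_measurable_indicator)
  show "f absolutely_integrable_on S \<longleftrightarrow> integrable lborel (\<lambda>x. indicator S x *\<^sub>R f x)"
    unfolding set_integrable_def using integrable_completion[OF m] .
  show "(LINT x:S|lebesgue. f x) = (LINT x|lborel. indicator S x *\<^sub>R f x)"
    unfolding set_lebesgue_integral_def using integral_completion[OF m] .
qed

lemma set_borel_measurable_lebesgue:
  fixes f :: "'a::euclidean_space \<Rightarrow> 'b::euclidean_space"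
  assumes "f \<in> borel_measurable borel" "S \<in> sets borel"
  shows "set_borel_measurable lebesgue S f"
proof -
  have "(\<lambda>x. indicator S x *\<^sub>R f x) \<in> borel_measurable lborel"
    using assms by (auto intro!: borel_measurable_scaleR borel_measurable_indicator)
  then show ?thesis unfolding set_borel_measurable_def by (rule measurable_completion)
qed

lemma open_slab: "open (slab T)"
  by (intro open_Times) auto

lemma Pair_measurable: "Pair t \<in> borel \<rightarrow>\<^sub>M (borel :: spacetime measure)"
  by (intro borel_measurable_continuous_onI continuous_intros)

lemma tame_slab:
  assumes "tame p F" "p < 3"
  shows "zcut F absolutely_integrable_on slab T" "(LINT q:slab T|lebesgue. zcut F q) = slab_integral T F"
  using lebesgue_set_integrable_iff[OF tame_zcut_measurable[OF assms(1)], of "slab T"] open_slab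
    tame_slab_integrable[OF assms, of T]
  by (simp_all add: slab_integral_def)

lemma zcut_slice_measurable: "tame p F \<Longrightarrow> (\<lambda>x. zcut F (t, x)) \<in> borel_measurable borel"
  using measurable_compose[OF Pair_measurable tame_zcut_measurable] .

lemma tame_slice:
  assumes "tame p F" "p < 3"
  shows "(\<lambda>x. zcut F (t, x)) absolutely_integrable_on ball 0 1"
    "(LINT x:ball 0 1|lebesgue. zcut F (t, x)) = slice_integral t F"
proof -
  have e: "indicator (ball 0 1) x * zcut F (t, x) = zcut F (t, x)" for x
    by (auto simp: indicator_def zcut_def in_cyl)
  show "(\<lambda>x. zcut F (t, x)) absolutely_integrable_on ball 0 1"
    "(LINT x:ball 0 1|lebesgue. zcut F (t, x)) = slice_integral t F"
    using lebesgue_set_integrable_iff[OF zcut_slice_measurable[OF assms(1)], of "ball 0 1" t]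
      tame_slice_integrable[OF assms, of t]
    by (simp_all add: slice_integral_def e)
qed

lemma compact_in_slab:
  assumes "compact K" "K \<subseteq> {0<..} \<times> ball (0::real^3) 1"
  obtains T where "T > 0" "K \<subseteq> slab T"
proof (cases "K = {}")
  case False
  obtain b where "b \<in> K" "\<And>q. q \<in> K \<Longrightarrow> fst q \<le> fst b"
    using continuous_attains_sup[OF assms(1) False, of fst] continuous_on_fst[OF continuous_on_id] by blast
  then show ?thesis using that[of "fst b + 1"] assms(2) by fastforce
qed (use that[of 1] in auto)

lemma tame_locally_integrable:
  assumes "tame p F" "p < 3"
  shows "locally_integrable_on ({0<..} \<times> ball 0 1) (zcut F)"
  unfolding locally_integrable_on_def
proof (intro allI impI, elim conjE)
  fix K :: "spacetime set" assume K: "compact K" "K \<subseteq> {0<..} \<times> ball 0 1"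
  then obtain T where "K \<subseteq> slab T" by (rule compact_in_slab)
  then show "zcut F absolutely_integrable_on K"
    using set_integrable_subset[OF tame_slab(1)[OF assms]] K(1) by (auto simp: compact_imp_closed)
qed

lemma vfield_component: "vfield W q \<bullet> axis i 1 = zcut (W i) q"
  by (simp add: vfield_def inner_axis)

lemma vfield_locally_integrable:
  assumes "\<And>i. tame p (W i)" "p < 3"
  shows "locally_integrable_on ({0<..} \<times> ball 0 1) (vfield W)"
  unfolding locally_integrable_on_def
proof (intro allI impI)
  fix K :: "spacetime set" assume K: "compact K \<and> K \<subseteq> {0<..} \<times> ball 0 1"
  show "vfield W absolutely_integrable_on K"
    unfolding absolutely_integrable_componentwise_iff[where f="vfield W"]
    using tame_locally_integrable[OF assms] K unfolding locally_integrable_on_def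
    by (auto simp: Basis_vec_def vfield_component)
qed

lemma vfield_measurable:
  assumes "\<And>i. tame p (W i)" shows "vfield W \<in> borel_measurable borel"
  unfolding borel_measurable_euclidean_space[of "vfield W"]
  using tame_zcut_measurable[OF assms] by (auto simp: Basis_vec_def vfield_component)

lemma mfield_measurable:
  assumes "\<And>i j. tame p (G i j)" shows "mfield G \<in> borel_measurable borel"
  unfolding borel_measurable_euclidean_space[of "mfield G"]
  using tame_zcut_measurable[OF assms] by (auto simp: Basis_vec_def mfield_def inner_axis)

lemma vfield_L2_slab:
  assumes W: "\<And>i. tame p (W i)" and p: "0 \<le> p" "p < 3 / 2"
  shows "L2_on (slab T) (vfield W)"
proof -
  have "tame (p + p) (\<lambda>q. \<Sum>i\<in>UNIV. W i q * W i q)" using W p by (intro tame_sum tame_mult) auto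
  then show ?thesis unfolding L2_on_def norm_vfield
    using p set_borel_measurable_lebesgue[OF vfield_measurable[OF W], of "slab T"] open_slab
    by (auto intro!: tame_slab)
qed

lemma mfield_L2_slab:
  assumes W: "\<And>i j. tame p (G i j)" and p: "0 \<le> p" "p < 3 / 2"
  shows "L2_on (slab T) (mfield G)"
proof -
  have "tame (p + p) (\<lambda>q. \<Sum>i\<in>UNIV. \<Sum>j\<in>UNIV. G i j q * G i j q)" using W p by (intro tame_sum tame_mult) auto
  then show ?thesis unfolding L2_on_def norm_mfield
    using p set_borel_measurable_lebesgue[OF mfield_measurable[OF W], of "slab T"] open_slab
    by (auto intro!: tame_slab)
qed

lemma vfield_L2_slice:
  assumes W: "\<And>i. tame p (W i)" and p: "0 \<le> p" "p < 3 / 2"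
  shows "L2_on (ball 0 1) (\<lambda>x. vfield W (t, x))"
    and "(LINT x:ball 0 1|lebesgue. (norm (vfield W (t, x)))\<^sup>2) = slice_integral t (\<lambda>q. \<Sum>i\<in>UNIV. W i q * W i q)"
proof -
  have "tame (p + p) (\<lambda>q. \<Sum>i\<in>UNIV. W i q * W i q)" using W p by (intro tame_sum tame_mult) auto
  then show "L2_on (ball 0 1) (\<lambda>x. vfield W (t, x))"
    and "(LINT x:ball 0 1|lebesgue. (norm (vfield W (t, x)))\<^sup>2) = slice_integral t (\<lambda>q. \<Sum>i\<in>UNIV. W i q * W i q)"
    unfolding L2_on_def norm_vfield
    using p set_borel_measurable_lebesgue[OF measurable_compose[OF Pair_measurable[of t] vfield_measurable[OF W]], of "ball 0 1"]
    by (auto intro!: tame_slice)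
qed

lemma mfield_L2_slice:
  assumes W: "\<And>i j. tame p (G i j)" and p: "0 \<le> p" "p < 3 / 2"
  shows "L2_on (ball 0 1) (\<lambda>x. mfield G (t, x))"
proof -
  have "tame (p + p) (\<lambda>q. \<Sum>i\<in>UNIV. \<Sum>j\<in>UNIV. G i j q * G i j q)" using W p by (intro tame_sum tame_mult) auto
  then show ?thesis unfolding L2_on_def norm_mfield
    using p set_borel_measurable_lebesgue[OF measurable_compose[OF Pair_measurable[of t] mfield_measurable[OF W]], of "ball 0 1"]
    by (auto intro!: tame_slice)
qed

lemma slice_integral_bounded:
  assumes F: "tame p F" and p: "p < 3"
  obtains M where "\<And>t. \<bar>slice_integral t F\<bar> \<le> M"
proof -
  obtain C where C: "C \<ge> 0" "\<And>t x. \<bar>zcut F (t, x)\<bar> \<le> C * (indicator (ball 0 1) x * norm x powr (- p))"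
    using tame_zcut_bound[OF F] by blast
  have "norm (slice_integral t F) \<le> (LINT x|lborel. C * (indicator (ball 0 1) (x::real^3) * norm x powr (- p)))" for t
    unfolding slice_integral_def
    by (rule Bochner_Integration.integral_norm_bound_integral)
      (use tame_slice_integrable[OF F p] integrable_norm_powr_ball[where 'a="real^3", of p] p C in auto)
  then show ?thesis using that by (metis real_norm_def)
qed

text \<open>Tame bounds do not depend on time, so one constant serves even for the whole half-line;
  \<open>p < 3/2\<close> makes the square integrable.\<close>

lemma vfield_Linf_L2:
  assumes W: "\<And>i. tame p (W i)" and p: "0 \<le> p" "p < 3 / 2" and I: "I \<in> sets borel"
  shows "Linf_L2 I (ball 0 1) (vfield W)"
proof -
  have t: "tame (p + p) (\<lambda>q. \<Sum>i\<in>UNIV. W i q * W i q)" using W p by (intro tame_sum tame_mult) auto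
  obtain M where M: "\<And>t. \<bar>slice_integral t (\<lambda>q. \<Sum>i\<in>UNIV. W i q * W i q)\<bar> \<le> M"
    using slice_integral_bounded[OF t] p by auto
  have "I \<times> ball 0 1 \<in> sets (borel \<Otimes>\<^sub>M (borel :: (real^3) measure))" using I by auto
  then have "I \<times> ball (0::real^3) 1 \<in> sets borel" unfolding borel_prod .
  then show ?thesis unfolding Linf_L2_def
    using set_borel_measurable_lebesgue[OF vfield_measurable[where W=W, OF W]] order_trans[OF abs_ge_self M]
      vfield_L2_slice[where W=W, OF W p]
    by (auto intro!: exI[of _ M] AE_I2)
qed

section \<open>Approximation in the Sobolev norm\<close>

lemma integral_square_tendsto_0:
  fixes c :: "nat \<Rightarrow> real^3 \<Rightarrow> real"
  assumes m: "\<And>n. c n \<in> borel_measurable borel"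
    and b: "\<And>n x. \<bar>c n x\<bar> \<le> B * (indicator (ball 0 1) x * norm x powr (- a))" and a: "a < 3 / 2"
    and l: "\<And>x. (\<lambda>n. c n x) \<longlonglongrightarrow> 0"
  shows "(\<lambda>n. LINT x|lborel. (c n x)\<^sup>2) \<longlonglongrightarrow> 0" "integrable lborel (\<lambda>x. (c n x)\<^sup>2)"
proof -
  have B: "(c n x)\<^sup>2 \<le> B\<^sup>2 * (indicator (ball 0 1) x * norm x powr (- (2 * a)))" for n x
  proof -
    have "\<bar>c n x\<bar>\<^sup>2 \<le> (B * (indicator (ball 0 1) x * norm x powr (- a)))\<^sup>2"
      using b by (intro power_mono) auto
    also have "\<dots> = B\<^sup>2 * (indicator (ball 0 1) x * norm x powr (- (2 * a)))"
    proof -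
      have "(norm x powr (- a))\<^sup>2 = norm x powr (- (2 * a))"
        unfolding power2_eq_square powr_add[symmetric] by simp
      then show ?thesis by (auto simp: indicator_def power_mult_distrib)
    qed
    finally show ?thesis by simp
  qed
  have i: "integrable lborel (\<lambda>x::real^3. B\<^sup>2 * (indicator (ball 0 1) x * norm x powr (- (2 * a))))"
    using integrable_norm_powr_ball[where 'a="real^3", of "2 * a"] a by (intro integrable_mult_right) simp
  have ms: "(\<lambda>x. (c n x)\<^sup>2) \<in> borel_measurable lborel" for n using m by simp
  have "(\<lambda>n. LINT x|lborel. (c n x)\<^sup>2) \<longlonglongrightarrow> (LINT x|(lborel::(real^3) measure). 0)"
  proof (rule integral_dominated_convergence[OF _ ms i])
    show "AE x in lborel. (\<lambda>n. (c n x)\<^sup>2) \<longlonglongrightarrow> 0"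
      using tendsto_power[OF l, of _ 2] by (intro AE_I2) simp
  qed (use B in auto)
  then show "(\<lambda>n. LINT x|lborel. (c n x)\<^sup>2) \<longlonglongrightarrow> 0" by simp
  show "integrable lborel (\<lambda>x. (c n x)\<^sup>2)"
    by (rule Bochner_Integration.integrable_bound[OF i ms]) (use B in \<open>auto intro: order_trans\<close>)
qed

lemma cutoff_DERIV:
  fixes x :: "real^3"
  shows "((\<lambda>r. flat 1 (n * ((x + r *\<^sub>R axis j 1) \<bullet> (x + r *\<^sub>R axis j 1)) - 1) *
      flat 1 (n * (1 - (x + r *\<^sub>R axis j 1) \<bullet> (x + r *\<^sub>R axis j 1)) - 1)) has_real_derivative
    2 * n * x $ j * (flat (flat_next 1) (n * (x \<bullet> x) - 1) * flat 1 (n * (1 - x \<bullet> x) - 1)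
      - flat 1 (n * (x \<bullet> x) - 1) * flat (flat_next 1) (n * (1 - x \<bullet> x) - 1))) (at 0)"
proof -
  have 1: "((\<lambda>r. n * ((x + r *\<^sub>R axis j 1) \<bullet> (x + r *\<^sub>R axis j 1)) - 1) has_real_derivative 2 * n * x $ j) (at 0)"
    by (auto intro!: derivative_eq_intros simp: inner_axis inner_axis' algebra_simps)
  have 2: "((\<lambda>r. n * (1 - (x + r *\<^sub>R axis j 1) \<bullet> (x + r *\<^sub>R axis j 1)) - 1) has_real_derivative - 2 * n * x $ j) (at 0)"
    by (auto intro!: derivative_eq_intros simp: inner_axis inner_axis' algebra_simps)
  from DERIV_mult[OF DERIV_chain2[OF flat_has_real_derivative 1, of 1] DERIV_chain2[OF flat_has_real_derivative 2, of 1]]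
  show ?thesis by (simp add: algebra_simps)
qed

lemma has_derivative_imp_axis_DERIV:
  fixes f :: "real^3 \<Rightarrow> real"
  assumes "(f has_derivative f') (at x)"
  shows "((\<lambda>r. f (x + r *\<^sub>R axis j 1)) has_real_derivative f' (axis j 1)) (at 0)"
proof -
  have "((\<lambda>r. x + r *\<^sub>R axis j 1) has_derivative (\<lambda>r. r *\<^sub>R axis j 1)) (at (0::real))"
    by (auto intro!: derivative_eq_intros)
  from has_derivative_compose[OF this, of f f'] assms
  have "((\<lambda>r. f (x + r *\<^sub>R axis j 1)) has_derivative (\<lambda>r. f' (r *\<^sub>R axis j 1))) (at 0)" by simp
  moreover have "f' (r *\<^sub>R axis j 1) = f' (axis j 1) * r" for r
    using linear_cmul[OF has_derivative_linear[OF assms]] by simp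
  ultimately show ?thesis by (simp add: has_field_derivative_def mult_commute_abs)
qed

lemma tame_zcut_bound_family:
  fixes F :: "'i::finite \<Rightarrow> spacetime \<Rightarrow> real"
  assumes "\<And>i. tame p (F i)"
  shows "\<exists>C\<ge>0. \<forall>i t x. \<bar>zcut (F i) (t, x)\<bar> \<le> C * (indicator (ball 0 1) x * norm x powr (- p))"
proof -
  have "\<forall>i. \<exists>C\<ge>0. \<forall>t x. \<bar>zcut (F i) (t, x)\<bar> \<le> C * (indicator (ball 0 1) x * norm x powr (- p))"
    using tame_zcut_bound[OF assms] by metis
  then obtain C where C: "\<And>i. C i \<ge> 0"
    "\<And>i t x. \<bar>zcut (F i) (t, x)\<bar> \<le> C i * (indicator (ball 0 1) x * norm x powr (- p))" by metis
  have "C i \<le> sum C UNIV" for i using C(1) by (intro member_le_sum) auto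
  then have "\<bar>zcut (F i) (t, x)\<bar> \<le> sum C UNIV * (indicator (ball 0 1) x * norm x powr (- p))" for i t x
    by (intro order_trans[OF C(2)] mult_right_mono) auto
  then show ?thesis using C(1) by (intro exI[of _ "sum C UNIV"]) (auto intro: sum_nonneg)
qed

text \<open>The approximating test functions are \<open>W\<close> times cutoffs at the origin and at
  the sphere. The gradient of the inner cutoff is controlled by \<open>1 / norm x\<close>, that of
  the outer one by \<open>1 / (1 - s)\<close> with \<open>s = x \<bullet> x\<close>, and the latter
  is paid for by the factor \<open>1 - s\<close> of \<open>W\<close>. So the error of the Jacobian
  is dominated by \<open>norm x powr (- (p + 1))\<close>, which is square integrable for
  \<open>p < 1/2\<close>.\<close>

lemma H10_vfield:
  assumes W: "\<And>i. tame1 p (W i)" and p: "0 \<le> p" "p < 1 / 2" and t: "t > 0"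
    and smooth: "\<And>i k. Ck_on k (ball 0 1 - {0}) (\<lambda>x. W i (t, x))"
    and V: "\<And>i. tame p (V i)" "\<And>i q. q \<in> cyl \<Longrightarrow> W i q = (1 - snd q \<bullet> snd q) * V i q"
  shows "H10_with_grad (ball 0 1) (\<lambda>x. vfield W (t, x)) (\<lambda>x. mfield (\<lambda>i j. dx j (W i)) (t, x))"
proof -
  define k where "k = flat (flat_next 1)"
  define \<eta> where "\<eta> n x = flat 1 (real (Suc n) * (x \<bullet> x) - 1) * flat 1 (real (Suc n) * (1 - x \<bullet> x) - 1)" for n and x :: "real^3"
  define \<eta>' where "\<eta>' n j x = 2 * real (Suc n) * x $ j * (k (real (Suc n) * (x \<bullet> x) - 1) * flat 1 (real (Suc n) * (1 - x \<bullet> x) - 1)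
      - flat 1 (real (Suc n) * (x \<bullet> x) - 1) * k (real (Suc n) * (1 - x \<bullet> x) - 1))" for n j and x :: "real^3"
  define \<phi> where "\<phi> n x = (\<chi> i. \<eta> n x * zcut (W i) (t, x))" for n x
  define c where "c n i j x = (\<eta> n x - 1) * zcut (dx j (W i)) (t, x) + \<eta>' n j x * zcut (W i) (t, x)" for n i j x
  obtain K where K: "K \<ge> 0" "\<And>x. \<bar>(x + 1) * k x\<bar> \<le> K" using flat_next_1_bound unfolding k_def by blast
  have \<eta>01: "0 \<le> \<eta> n x" "\<eta> n x \<le> 1" for n x
    using flat_1_bounds by (auto simp: \<eta>_def intro!: mult_nonneg_nonneg mult_le_one)
  have zc: "zcut F (t, x) = (if x \<in> ball 0 1 - {0} then F (t, x) else 0)" for F x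
    using t by (auto simp: zcut_def in_cyl)
  have outer: "\<eta> n x = 0" if "real (Suc n) * (x \<bullet> x) < 1 \<or> real (Suc n) * (1 - x \<bullet> x) < 1" for n x
    using that by (auto simp: \<eta>_def flat_def)
  \<comment> \<open>On \<open>U n\<close> the cut field is identically 0. Together with the
    punctured ball this open set covers the space, so smoothness can be checked on the two
    pieces.\<close>
  define U where "U n = {x::real^3. real (Suc n) * (x \<bullet> x) < 1} \<union> {x. real (Suc n) * (1 - x \<bullet> x) < 1}" for n
  have openU: "open (U n)" for n unfolding U_def by (intro open_Un open_Collect_less continuous_intros)
  have cover: "U n \<union> (ball 0 1 - {0}) = UNIV" for n
  proof -
    have "real (Suc n) * (1 - x \<bullet> x) < 1" if "norm x \<ge> 1" for x :: "real^3"
    proof -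
      have "x \<bullet> x \<ge> 1" using that by (simp add: dot_square_norm)
      then have "real (Suc n) * (1 - x \<bullet> x) \<le> 0" by (intro mult_nonneg_nonpos) auto
      then show ?thesis by linarith
    qed
    then show ?thesis unfolding U_def by force
  qed
  have opB: "open (ball 0 1 - {0::real^3})" by (intro open_delete) auto
  have smooth_\<phi>: "Ck_on m UNIV (\<phi> n)" for m n
  proof -
    have i: "Ck_on m S (\<lambda>x::real^3. real (Suc n) * (x \<bullet> x) - 1)" "Ck_on m S (\<lambda>x::real^3. real (Suc n) * (1 - x \<bullet> x) - 1)" if "open S" for S
    proof -
      have s: "Ck_on m S (\<lambda>x::real^3. x \<bullet> x - 1)" using smooth_on_inner_self unfolding smooth_on_def by blast
      show "Ck_on m S (\<lambda>x::real^3. real (Suc n) * (x \<bullet> x) - 1)"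
        by (rule Ck_on_cong[OF that _ Ck_on_add[OF that Ck_on_mult[OF that Ck_on_const s] Ck_on_const], of "real (Suc n)" "real (Suc n) - 1"])
          (simp add: algebra_simps)
      show "Ck_on m S (\<lambda>x::real^3. real (Suc n) * (1 - x \<bullet> x) - 1)"
        by (rule Ck_on_cong[OF that _ Ck_on_add[OF that Ck_on_mult[OF that Ck_on_const s] Ck_on_const], of "- real (Suc n)" "- 1"])
          (simp add: algebra_simps)
    qed
    have "Ck_on m (ball 0 1 - {0}) (\<phi> n)" unfolding \<phi>_def
      by (rule Ck_on_vec[OF opB], rule Ck_on_cong[OF opB, of "\<lambda>x. \<eta> n x * W _ (t, x)"])
        (auto simp: zc \<eta>_def simp del: of_nat_Suc intro!: Ck_on_mult[OF opB] Ck_on_flat[OF opB] i opB smooth)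
    moreover have "Ck_on m (U n) (\<phi> n)"
      by (rule Ck_on_cong[OF openU _ Ck_on_const[of _ _ 0]]) (auto simp: \<phi>_def U_def outer vec_eq_iff)
    ultimately show ?thesis using Ck_on_Un[OF openU opB] cover[of n] by metis
  qed
  have test: "test_function (ball 0 1) (\<phi> n)" for n
  proof -
    let ?S = "{x::real^3. 1 \<le> real (Suc n) * (1 - x \<bullet> x)}"
    have "closed ?S" by (intro closed_Collect_le continuous_intros)
    moreover have "{x. \<phi> n x \<noteq> 0} \<subseteq> ?S" using outer by (force simp: \<phi>_def vec_eq_iff not_less[symmetric])
    ultimately have cs: "closure {x. \<phi> n x \<noteq> 0} \<subseteq> ?S" by (rule closure_minimal[rotated])
    have "?S \<subseteq> ball 0 1" using cover[of n]
    proof (intro subsetI)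
      fix x :: "real^3" assume x: "x \<in> ?S"
      then have "0 < real (Suc n) * (1 - x \<bullet> x)" by auto
      then have "x \<bullet> x < 1" by (simp add: zero_less_mult_iff)
      then show "x \<in> ball 0 1" by (simp add: dot_square_norm power_less_one_iff)
    qed
    then have cb: "closure {x. \<phi> n x \<noteq> 0} \<subseteq> ball 0 1" using cs by blast
    then have "compact (closure {x. \<phi> n x \<noteq> 0})"
      by (meson bounded_ball bounded_subset closed_closure compact_eq_bounded_closed)
    then show ?thesis using smooth_\<phi> cb unfolding test_function_def smooth_on_def by blast
  qed
  have jac: "jacobian (\<phi> n) (at x) $ i $ j - zcut (dx j (W i)) (t, x) = c n i j x" for n x i j
  proof -
    have dif: "\<phi> n differentiable (at x)" using smooth_\<phi>[of "Suc 0" n] by simp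
    have J: "jacobian (\<phi> n) (at x) $ i $ j = frechet_derivative (\<phi> n) (at x) (axis j 1) $ i"
      by (simp add: jacobian_def matrix_def)
    show ?thesis
    proof (cases "x \<in> ball 0 1 - {0}")
      case True
      have "((\<lambda>x. \<phi> n x $ i) has_derivative (\<lambda>h. frechet_derivative (\<phi> n) (at x) h $ i)) (at x)"
        by (intro bounded_linear.has_derivative[OF bounded_linear_vec_nth]) (use dif frechet_derivative_works in blast)
      from has_derivative_imp_axis_DERIV[OF this, of j]
      have A: "((\<lambda>r. \<phi> n (x + r *\<^sub>R axis j 1) $ i) has_real_derivative jacobian (\<phi> n) (at x) $ i $ j) (at 0)"
        by (simp add: J)
      have q: "(t, x) \<in> cyl" using True t by (simp add: cyl_def)
      from DERIV_mult[OF cutoff_DERIV[of "real (Suc n)" x j] slice_DERIV[OF tame1D(2)[OF W q], of i j]]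
      have B: "((\<lambda>r. \<eta> n (x + r *\<^sub>R axis j 1) * W i (t, x + r *\<^sub>R axis j 1)) has_real_derivative
          \<eta> n x * dx j (W i) (t, x) + \<eta>' n j x * W i (t, x)) (at 0)"
        unfolding \<eta>_def \<eta>'_def k_def by (simp add: algebra_simps)
      have lim: "((\<lambda>r::real. x + r *\<^sub>R axis j 1) \<longlongrightarrow> x) (at 0)" by (auto intro!: tendsto_eq_intros)
      have "\<forall>\<^sub>F r in at 0. x + r *\<^sub>R axis j 1 \<in> ball 0 1 - {0}"
        using topological_tendstoD[OF lim opB] True by blast
      then have "\<forall>\<^sub>F r in at 0. \<phi> n (x + r *\<^sub>R axis j 1) $ i = \<eta> n (x + r *\<^sub>R axis j 1) * W i (t, x + r *\<^sub>R axis j 1)"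
        by eventually_elim (simp add: \<phi>_def zc)
      moreover have "\<phi> n (x + 0 *\<^sub>R axis j 1) $ i = \<eta> n (x + 0 *\<^sub>R axis j 1) * W i (t, x + 0 *\<^sub>R axis j 1)"
        using True by (simp add: \<phi>_def zc)
      ultimately have "((\<lambda>r. \<phi> n (x + r *\<^sub>R axis j 1) $ i) has_real_derivative
          \<eta> n x * dx j (W i) (t, x) + \<eta>' n j x * W i (t, x)) (at 0)"
        using B by (subst DERIV_cong_ev[OF refl _ refl]) (auto simp: eventually_at_filter elim: eventually_mono)
      then have "jacobian (\<phi> n) (at x) $ i $ j = \<eta> n x * dx j (W i) (t, x) + \<eta>' n j x * W i (t, x)"
        using A DERIV_unique by blast
      then show ?thesis using True by (simp add: c_def zc algebra_simps)
    next
      case False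
      then have "x \<in> U n" using cover[of n] by blast
      then have "frechet_derivative (\<phi> n) (at x) = frechet_derivative (\<lambda>_. 0) (at x)"
        by (intro frechet_derivative_cong_open[OF openU]) (auto simp: \<phi>_def U_def outer vec_eq_iff)
      then show ?thesis using False by (auto simp: J c_def zc)
    qed
  qed
  obtain C where C: "C \<ge> 0" "\<And>i t x. \<bar>zcut (W i) (t, x)\<bar> \<le> C * (indicator (ball 0 1) x * norm x powr (- p))"
    using tame_zcut_bound_family[of p W] tame1D(1)[OF W] by blast
  obtain C' where C': "C' \<ge> 0" "\<And>i j t x. \<bar>zcut (dx j (W i)) (t, x)\<bar> \<le> C' * (indicator (ball 0 1) x * norm x powr (- (p + 1)))"
    using tame_zcut_bound_family[of "p + 1" "\<lambda>(i, j). dx j (W i)"] tame1D(4)[OF W] by auto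
  obtain C'' where C'': "C'' \<ge> 0" "\<And>i t x. \<bar>zcut (V i) (t, x)\<bar> \<le> C'' * (indicator (ball 0 1) x * norm x powr (- p))"
    using tame_zcut_bound_family[of p V] V(1) by blast
  define B where "B = C' + 2 * K * C + 2 * K * C''"
  have cb: "\<bar>c n i j x\<bar> \<le> B * (indicator (ball 0 1) x * norm x powr (- (p + 1)))" for n i j x
  proof (cases "x \<in> ball 0 1 - {0}")
    case False
    then have "c n i j x = 0" by (auto simp: c_def zc)
    then show ?thesis using C C' C'' K by (simp add: B_def)
  next
    case True
    let ?m = "real (Suc n)" and ?s = "x \<bullet> x" and ?y = "1 - x \<bullet> x"
    let ?N = "norm x powr (- (p + 1))"
    have x: "0 < norm x" "norm x < 1" and q: "(t, x) \<in> cyl" using True t by (auto simp: cyl_def)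
    have N: "norm x powr (- p) = norm x * ?N"
      using x by (simp add: powr_diff powr_minus_divide powr_add)
    have Nle: "norm x * ?N \<le> ?N" using x by (intro mult_left_le_one_le) auto
    have xj: "\<bar>x $ j\<bar> \<le> norm x" by (rule component_le_norm_cart)
    have "\<bar>(\<eta> n x - 1) * zcut (dx j (W i)) (t, x)\<bar> \<le> 1 * (C' * ?N)"
      unfolding abs_mult using C'(2)[where i=i and j=j and t=t and x=x] True \<eta>01[of n x] C'(1) by (intro mult_mono) auto
    moreover have "\<bar>(2 * ?m * x $ j * (k (?m * ?s - 1) * flat 1 (?m * ?y - 1))) * zcut (W i) (t, x)\<bar> \<le> 2 * K * C * ?N"
    proof -
      \<comment> \<open>Inner cutoff: \<open>?m * ?s * |k|\<close> is bounded, and one power of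
        \<open>norm x\<close> is taken from the weight of \<open>W\<close>, whose order is
        \<open>p\<close> and not \<open>p + 1\<close>.\<close>
      have "?m * ?s * \<bar>k (?m * ?s - 1)\<bar> \<le> K" using K(2)[of "?m * ?s - 1"] by (simp add: abs_mult del: of_nat_Suc)
      then have "norm x * (?m * norm x * \<bar>k (?m * ?s - 1)\<bar>) \<le> K"
        by (simp add: dot_square_norm power2_eq_square mult_ac del: of_nat_Suc)
      then have a: "norm x * (?m * \<bar>x $ j\<bar> * \<bar>k (?m * ?s - 1)\<bar>) \<le> K"
        using xj x by (elim order_trans[rotated]) (intro mult_left_mono mult_right_mono, auto)
      have "\<bar>(2 * ?m * x $ j * (k (?m * ?s - 1) * flat 1 (?m * ?y - 1))) * zcut (W i) (t, x)\<bar>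
        = (2 * (?m * \<bar>x $ j\<bar> * \<bar>k (?m * ?s - 1)\<bar>)) * flat 1 (?m * ?y - 1) * \<bar>zcut (W i) (t, x)\<bar>"
        using flat_1_bounds[of "?m * ?y - 1"] by (simp add: abs_mult del: of_nat_Suc)
      also have "\<dots> \<le> (2 * (?m * \<bar>x $ j\<bar> * \<bar>k (?m * ?s - 1)\<bar>) * 1) * (C * (norm x * ?N))"
        using C(2)[of i t x] True flat_1_bounds[of "?m * ?y - 1"] unfolding N
        by (intro mult_mono) (auto simp del: of_nat_Suc)
      also have "\<dots> = 2 * C * ?N * (norm x * (?m * \<bar>x $ j\<bar> * \<bar>k (?m * ?s - 1)\<bar>))" by (simp only: mult_ac mult_1_left mult_1_right)
      also have "\<dots> \<le> 2 * C * ?N * K" using a C(1) by (intro mult_left_mono) auto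
      finally show ?thesis by (simp only: mult_ac)
    qed
    moreover have "\<bar>(2 * ?m * x $ j * (flat 1 (?m * ?s - 1) * k (?m * ?y - 1))) * zcut (W i) (t, x)\<bar> \<le> 2 * K * C'' * ?N"
    proof -
      \<comment> \<open>Outer cutoff: the factor \<open>?y\<close> of \<open>W\<close> combines with
        the gradient to \<open>?m * ?y * |k|\<close>, which is at most \<open>K\<close>.\<close>
      have y: "0 < ?y" using x by (simp add: dot_square_norm power_less_one_iff)
      have Wv: "zcut (W i) (t, x) = ?y * zcut (V i) (t, x)" using V(2)[OF q, of i] q by simp
      have a: "?m * ?y * \<bar>k (?m * ?y - 1)\<bar> \<le> K" using K(2)[of "?m * ?y - 1"] y by (simp add: abs_mult del: of_nat_Suc)
      have "\<bar>(2 * ?m * x $ j * (flat 1 (?m * ?s - 1) * k (?m * ?y - 1))) * zcut (W i) (t, x)\<bar>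
        = 2 * (\<bar>x $ j\<bar> * flat 1 (?m * ?s - 1)) * (?m * ?y * \<bar>k (?m * ?y - 1)\<bar>) * \<bar>zcut (V i) (t, x)\<bar>"
        using y flat_1_bounds[of "?m * ?s - 1"] unfolding Wv by (simp add: abs_mult mult_ac del: of_nat_Suc)
      also have "\<dots> \<le> 2 * (1 * 1) * K * (C'' * (norm x * ?N))"
        using C''(2)[of i t x] True flat_1_bounds[of "?m * ?s - 1"] a K(1) xj x y C''(1) unfolding N
        by (intro mult_mono) (auto simp del: of_nat_Suc)
      also have "\<dots> \<le> 2 * (1 * 1) * K * (C'' * ?N)" using Nle C''(1) K(1) by (intro mult_left_mono) auto
      finally show ?thesis by (simp only: mult_ac mult_1_left mult_1_right)
    qed
    ultimately have "\<bar>c n i j x\<bar> \<le> 1 * (C' * ?N) + (2 * K * C * ?N + 2 * K * C'' * ?N)"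
      unfolding c_def \<eta>'_def right_diff_distrib left_diff_distrib by linarith
    then show ?thesis using True by (simp add: B_def distrib_right)
  qed
  have k0: "(\<lambda>n. real (Suc n) * k (real (Suc n) * a - 1)) \<longlonglongrightarrow> 0" if "a > 0" for a
  proof -
    have "(\<lambda>n. (1 / a) * (((real (Suc n) * a - 1) + 1) * k (real (Suc n) * a - 1))) \<longlonglongrightarrow> (1 / a) * 0"
      unfolding k_def by (intro tendsto_intros filterlim_compose[OF flat_next_1_tendsto]
          filterlim_compose[OF filterlim_real_mult_minus_at_top[OF that] filterlim_Suc])
    then show ?thesis using that by (simp add: field_simps del: of_nat_Suc)
  qed
  have f1: "(\<lambda>n. flat 1 (real (Suc n) * a - 1)) \<longlonglongrightarrow> 1" if "a > 0" for a
    by (rule filterlim_compose[OF flat_1_tendsto filterlim_compose[OF filterlim_real_mult_minus_at_top[OF that] filterlim_Suc]])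
  have lims: "(\<lambda>n. \<eta> n x - 1) \<longlonglongrightarrow> 0" "(\<lambda>n. \<eta>' n j x) \<longlonglongrightarrow> 0" if "x \<in> ball 0 1 - {0}" for x j
  proof -
    have s: "0 < x \<bullet> x" "0 < 1 - x \<bullet> x" using that by (auto simp: dot_square_norm power_less_one_iff)
    have "(\<lambda>n. \<eta> n x - 1) \<longlonglongrightarrow> 1 * 1 - 1" unfolding \<eta>_def by (intro tendsto_intros f1 s)
    then show "(\<lambda>n. \<eta> n x - 1) \<longlonglongrightarrow> 0" by simp
    have "(\<lambda>n. 2 * x $ j * ((real (Suc n) * k (real (Suc n) * (x \<bullet> x) - 1)) * flat 1 (real (Suc n) * (1 - x \<bullet> x) - 1)
      - flat 1 (real (Suc n) * (x \<bullet> x) - 1) * (real (Suc n) * k (real (Suc n) * (1 - x \<bullet> x) - 1)))) \<longlonglongrightarrow> 2 * x $ j * (0 * 1 - 1 * 0)"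
      by (intro tendsto_intros f1 k0 s)
    then show "(\<lambda>n. \<eta>' n j x) \<longlonglongrightarrow> 0" unfolding \<eta>'_def by (simp add: algebra_simps del: of_nat_Suc)
  qed
  have c0: "(\<lambda>n. c n i j x) \<longlonglongrightarrow> 0" for i j x
  proof (cases "x \<in> ball 0 1 - {0}")
    case True
    have "(\<lambda>n. c n i j x) \<longlonglongrightarrow> 0 * zcut (dx j (W i)) (t, x) + 0 * zcut (W i) (t, x)"
      unfolding c_def by (intro tendsto_intros lims True)
    then show ?thesis by simp
  qed (auto simp: c_def zc)
  define d where "d n i x = (\<eta> n x - 1) * zcut (W i) (t, x)" for n i x
  have d0: "(\<lambda>n. d n i x) \<longlonglongrightarrow> 0" for i x
  proof (cases "x \<in> ball 0 1 - {0}")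
    case True
    have "(\<lambda>n. d n i x) \<longlonglongrightarrow> 0 * zcut (W i) (t, x)"
      unfolding d_def by (intro tendsto_intros lims True)
    then show ?thesis by simp
  qed (auto simp: d_def zc)
  have db: "\<bar>d n i x\<bar> \<le> C * (indicator (ball 0 1) x * norm x powr (- p))" for n i x
  proof -
    have "\<bar>d n i x\<bar> \<le> 1 * \<bar>zcut (W i) (t, x)\<bar>"
      unfolding d_def abs_mult using \<eta>01[of n x] by (intro mult_right_mono) auto
    then show ?thesis using C(2)[of i t x] by simp
  qed
  have fc: "continuous_on UNIV (flat q)" for q
    using flat_has_real_derivative by (intro continuous_at_imp_continuous_on) (blast intro: DERIV_isCont)
  have fm: "(\<lambda>x::real^3. flat q (real (Suc n) * (x \<bullet> x) - 1)) \<in> borel_measurable borel"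
    "(\<lambda>x::real^3. flat q (real (Suc n) * (1 - x \<bullet> x) - 1)) \<in> borel_measurable borel" for q n
    by (rule borel_measurable_continuous_onI, rule continuous_on_compose2[OF fc], auto intro!: continuous_intros simp del: of_nat_Suc)+
  have \<eta>m: "\<eta> n \<in> borel_measurable borel" for n
    unfolding \<eta>_def[abs_def] by (rule borel_measurable_times[OF fm])
  have xm: "(\<lambda>x::real^3. x $ j) \<in> borel_measurable borel" for j
    by (intro borel_measurable_continuous_onI continuous_intros)
  have \<eta>'m: "\<eta>' n j \<in> borel_measurable borel" for n j
    unfolding \<eta>'_def[abs_def] k_def
    by (intro borel_measurable_times borel_measurable_diff fm xm borel_measurable_const)
  have cm: "c n i j \<in> borel_measurable borel" for n i j
    unfolding c_def[abs_def]
    by (intro borel_measurable_add borel_measurable_times borel_measurable_diff \<eta>m \<eta>'m borel_measurable_const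
        zcut_slice_measurable[OF tame1D(1)[OF W]] zcut_slice_measurable[OF tame1D(4)[OF W]])
  have dm: "d n i \<in> borel_measurable borel" for n i
    unfolding d_def[abs_def]
    by (intro borel_measurable_times borel_measurable_diff \<eta>m borel_measurable_const zcut_slice_measurable[OF tame1D(1)[OF W]])
  have "(\<lambda>n. LINT x:ball 0 1|lebesgue. (norm (\<phi> n x - vfield W (t, x)))\<^sup>2) \<longlonglongrightarrow> 0"
  proof -
    have e: "(norm (\<phi> n x - vfield W (t, x)))\<^sup>2 = (\<Sum>i\<in>UNIV. (d n i x)\<^sup>2)" for n x
      unfolding power2_norm_vec by (simp add: \<phi>_def d_def vfield_def left_diff_distrib)
    have z: "indicator (ball 0 1) x *\<^sub>R (\<Sum>i\<in>UNIV. (d n i x)\<^sup>2) = (\<Sum>i\<in>UNIV. (d n i x)\<^sup>2)" for n x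
      by (auto simp: indicator_def d_def zc)
    have "(LINT x:ball 0 1|lebesgue. (norm (\<phi> n x - vfield W (t, x)))\<^sup>2) = (\<Sum>i\<in>UNIV. LINT x|lborel. (d n i x)\<^sup>2)" for n
    proof -
      have "(\<lambda>x. \<Sum>i\<in>UNIV. (d n i x)\<^sup>2) \<in> borel_measurable borel"
        by (intro borel_measurable_sum borel_measurable_power dm)
      from lebesgue_set_integrable_iff(2)[OF this, of "ball 0 1"]
      show ?thesis unfolding e z using integral_square_tendsto_0(2)[OF dm db _ d0] p
        by (simp add: Bochner_Integration.integral_sum)
    qed
    moreover have "(\<lambda>n. \<Sum>i\<in>UNIV. LINT x|lborel. (d n i x)\<^sup>2) \<longlonglongrightarrow> (\<Sum>i\<in>(UNIV::3 set). 0)"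
      using p by (intro tendsto_sum integral_square_tendsto_0(1)[OF dm db _ d0]) simp
    ultimately show ?thesis by simp
  qed
  moreover have "(\<lambda>n. LINT x:ball 0 1|lebesgue. (norm (jacobian (\<phi> n) (at x) - mfield (\<lambda>i j. dx j (W i)) (t, x)))\<^sup>2) \<longlonglongrightarrow> 0"
  proof -
    have e: "(norm (jacobian (\<phi> n) (at x) - mfield (\<lambda>i j. dx j (W i)) (t, x)))\<^sup>2 = (\<Sum>i\<in>UNIV. \<Sum>j\<in>UNIV. (c n i j x)\<^sup>2)" for n x
      unfolding power2_norm_mat by (simp add: mfield_def jac)
    have z: "indicator (ball 0 1) x *\<^sub>R (\<Sum>i\<in>UNIV. \<Sum>j\<in>UNIV. (c n i j x)\<^sup>2) = (\<Sum>i\<in>UNIV. \<Sum>j\<in>UNIV. (c n i j x)\<^sup>2)" for n x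
      by (auto simp: indicator_def c_def zc)
    have "(LINT x:ball 0 1|lebesgue. (norm (jacobian (\<phi> n) (at x) - mfield (\<lambda>i j. dx j (W i)) (t, x)))\<^sup>2)
        = (\<Sum>i\<in>UNIV. \<Sum>j\<in>UNIV. LINT x|lborel. (c n i j x)\<^sup>2)" for n
    proof -
      have "(\<lambda>x. \<Sum>i\<in>UNIV. \<Sum>j\<in>UNIV. (c n i j x)\<^sup>2) \<in> borel_measurable borel"
        by (intro borel_measurable_sum borel_measurable_power cm)
      from lebesgue_set_integrable_iff(2)[OF this, of "ball 0 1"]
      show ?thesis unfolding e z using integral_square_tendsto_0(2)[OF cm cb _ c0] p
        by (simp add: Bochner_Integration.integral_sum)
    qed
    moreover have "(\<lambda>n. \<Sum>i\<in>UNIV. \<Sum>j\<in>UNIV. LINT x|lborel. (c n i j x)\<^sup>2) \<longlonglongrightarrow> (\<Sum>i\<in>(UNIV::3 set). \<Sum>j\<in>(UNIV::3 set). 0)"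
      using p by (intro tendsto_sum integral_square_tendsto_0(1)[OF cm cb _ c0]) simp
    ultimately show ?thesis by simp
  qed
  moreover have "L2_on (ball 0 1) (\<lambda>x. vfield W (t, x))"
    by (rule vfield_L2_slice(1)) (use W p in \<open>auto intro: tame1D(1)\<close>)
  moreover have "L2_on (ball 0 1) (\<lambda>x. mfield (\<lambda>i j. dx j (W i)) (t, x))"
    by (rule mfield_L2_slice[of "p + 1"]) (use W p in \<open>auto intro: tame1D(4)\<close>)
  ultimately show ?thesis unfolding H10_with_grad_def using test by blast
qed

section \<open>The radial profile\<close>

text \<open>With \<open>y = 1 - s\<close>, the quotient \<open>N\<^sub>k / (y\<^sup>2 + e)^(k + 1)\<close> is the \<open>k\<close>-th \<open>y\<close>-derivative of
  \<open>N\<^sub>0 / (y\<^sup>2 + e)\<close>, and \<open>M\<^sub>k / (y\<^sup>2 + e)^(k + 2)\<close> is the \<open>e\<close>-derivative of that quotient.\<close>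

definition N0 :: "real \<Rightarrow> real \<Rightarrow> real" where
  "N0 y e = 1/4 * y^4 + 9/20 * y^5"
definition N1 :: "real \<Rightarrow> real \<Rightarrow> real" where
  "N1 y e = 1/2 * y^5 + 27/20 * y^6 + y^3 * e + 9/4 * y^4 * e"
definition N2 :: "real \<Rightarrow> real \<Rightarrow> real" where
  "N2 y e = 1/2 * y^6 + 27/10 * y^7 + 3/2 * y^4 * e + 81/10 * y^5 * e + 3 * y^2 * e^2 + 9 * y^3 * e^2"
definition N3 :: "real \<Rightarrow> real \<Rightarrow> real" where
  "N3 y e = 27/10 * y^8 + 54/5 * y^6 * e - 6 * y^3 * e^2 + 27/2 * y^4 * e^2 + 6 * y * e^3 + 27 * y^2 * e^3"
definition N4 :: "real \<Rightarrow> real \<Rightarrow> real" where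
  "N4 y e = 30 * y^4 * e^2 + 54/5 * y^5 * e^2 - 60 * y^2 * e^3 - 108 * y^3 * e^3 + 6 * e^4 + 54 * y * e^4"
definition M0 :: "real \<Rightarrow> real \<Rightarrow> real" where
  "M0 y e = - 1/4 * y^4 - 9/20 * y^5"
definition M1 :: "real \<Rightarrow> real \<Rightarrow> real" where
  "M1 y e = - 9/20 * y^6 - y^3 * e - 9/4 * y^4 * e"
definition M2 :: "real \<Rightarrow> real \<Rightarrow> real" where
  "M2 y e = 3 * y^4 * e + 9/5 * y^5 * e - 3 * y^2 * e^2 - 9 * y^3 * e^2"

text \<open>The coefficients result from expanding the expression \<open>Hr\<close> for \<open>h\<^sup>2\<close>; see \<open>Hr_eq\<close>.\<close>

definition GP :: "real \<Rightarrow> real \<Rightarrow> real \<Rightarrow> real \<Rightarrow> real" where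
  "GP y e d h =
     y^8 * (48 + h + 581/5 * e + 19/10 * y * h - 1701/5 * y * e - 243/20 * y^2 * h - 117/2 * e * h + 9/4 * e * d)
   + y^6 * e * (240 + 5 * h + 581 * e + 19/2 * y * h - 1701 * y * e - 549/5 * e * h + 243/20 * e * d)
   + y^4 * e^2 * (480 + 13 * h + 6 * d + 5873/5 * e + 203/10 * y * h + 13/5 * y * d - 17001/5 * y * e
       - 927/10 * e * h + 783/20 * e * d)
   + y^2 * e^3 * (240 + 288/5 * y + 15 * h + 495 * e + 197/10 * y * h - 22/5 * y * d - 3231 * y * e
       - 117/4 * e * h + 117/4 * e * d)
   + e^4 * (720 - 96 * y + 6 * h - 6 * d + 1782 * e + 7 * y * h - 7 * y * d - 2574 * y * e)"

text \<open>The quotient rule with the common factor cancelled: the exponent of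
  \<open>y^2 + e\<close> grows by one per derivative instead of doubling, and the numerators remain
  explicit polynomials.\<close>

lemma quotient_DERIV:
  fixes e :: real
  assumes "y^2 + e \<noteq> 0" "(f has_real_derivative f') (at y)" "f' * (y^2 + e) - 2 * real n * y * f y = g" "n > 0"
    and m: "m = Suc n"
  shows "((\<lambda>y. f y / (y^2 + e)^n) has_real_derivative g / (y^2 + e)^m) (at y)"
proof -
  obtain k where n: "n = Suc k" using assms(4) by (cases n) auto
  have "((\<lambda>y. y^2 + e) has_real_derivative 2 * y) (at y)" by (auto intro!: derivative_eq_intros)
  from DERIV_power[OF this, of n]
  have D: "((\<lambda>y. (y^2 + e)^n) has_real_derivative real n * (2 * y) * (y^2 + e)^k) (at y)"
    by (simp add: n mult.assoc del: power_Suc)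
  have "((\<lambda>y. f y / (y^2 + e)^n) has_real_derivative
      (f' * (y^2 + e)^n - f y * (real n * (2 * y) * (y^2 + e)^k)) / ((y^2 + e)^n * (y^2 + e)^n)) (at y)"
    by (rule DERIV_divide[OF assms(2) D]) (use assms(1) in auto)
  moreover have "(f' * (y^2 + e)^n - f y * (real n * (2 * y) * (y^2 + e)^k)) / ((y^2 + e)^n * (y^2 + e)^n)
      = g / (y^2 + e)^Suc n"
  proof -
    have "f' * (y^2 + e)^n - f y * (real n * (2 * y) * (y^2 + e)^k) = g * (y^2 + e)^k"
      unfolding assms(3)[symmetric] n power_Suc by (simp add: algebra_simps)
    moreover have "(y^2 + e)^n * (y^2 + e)^n = (y^2 + e)^Suc n * (y^2 + e)^k" by (simp add: n mult_ac)
    ultimately show ?thesis using assms(1) by simp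
  qed
  ultimately show ?thesis unfolding m by simp
qed

lemma profile_DERIVs:
  assumes "y^2 + e \<noteq> 0"
  shows "((\<lambda>y. N0 y e / (y^2 + e)^1) has_real_derivative N1 y e / (y^2 + e)^2) (at y)"
    and "((\<lambda>y. N1 y e / (y^2 + e)^2) has_real_derivative N2 y e / (y^2 + e)^3) (at y)"
    and "((\<lambda>y. N2 y e / (y^2 + e)^3) has_real_derivative N3 y e / (y^2 + e)^4) (at y)"
    and "((\<lambda>y. N3 y e / (y^2 + e)^4) has_real_derivative N4 y e / (y^2 + e)^5) (at y)"
    and "((\<lambda>y. M0 y e / (y^2 + e)^2) has_real_derivative M1 y e / (y^2 + e)^3) (at y)"
    and "((\<lambda>y. M1 y e / (y^2 + e)^3) has_real_derivative M2 y e / (y^2 + e)^4) (at y)"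
proof -
  have "((\<lambda>y. N0 y e) has_real_derivative y^3 + 9/4 * y^4) (at y)"
    unfolding N0_def by (auto intro!: derivative_eq_intros)
  moreover have "(y^3 + 9/4 * y^4) * (y^2 + e) - 2 * real 1 * y * N0 y e = N1 y e"
    unfolding N0_def N1_def of_nat_numeral of_nat_1 by algebra
  ultimately show "((\<lambda>y. N0 y e / (y^2 + e)^1) has_real_derivative N1 y e / (y^2 + e)^2) (at y)"
    by (rule quotient_DERIV[OF assms]) simp_all
  have "((\<lambda>y. N1 y e) has_real_derivative 5/2 * y^4 + 81/10 * y^5 + 3 * y^2 * e + 9 * y^3 * e) (at y)"
    unfolding N1_def by (auto intro!: derivative_eq_intros)
  moreover have "(5/2 * y^4 + 81/10 * y^5 + 3 * y^2 * e + 9 * y^3 * e) * (y^2 + e) - 2 * real 2 * y * N1 y e = N2 y e"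
    unfolding N1_def N2_def of_nat_numeral of_nat_1 by algebra
  ultimately show "((\<lambda>y. N1 y e / (y^2 + e)^2) has_real_derivative N2 y e / (y^2 + e)^3) (at y)"
    by (rule quotient_DERIV[OF assms]) simp_all
  have "((\<lambda>y. N2 y e) has_real_derivative 3 * y^5 + 189/10 * y^6 + 6 * y^3 * e + 81/2 * y^4 * e + 6 * y * e^2 + 27 * y^2 * e^2) (at y)"
    unfolding N2_def by (auto intro!: derivative_eq_intros)
  moreover have "(3 * y^5 + 189/10 * y^6 + 6 * y^3 * e + 81/2 * y^4 * e + 6 * y * e^2 + 27 * y^2 * e^2) * (y^2 + e) - 2 * real 3 * y * N2 y e = N3 y e"
    unfolding N2_def N3_def of_nat_numeral of_nat_1 by algebra
  ultimately show "((\<lambda>y. N2 y e / (y^2 + e)^3) has_real_derivative N3 y e / (y^2 + e)^4) (at y)"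
    by (rule quotient_DERIV[OF assms]) simp_all
  have "((\<lambda>y. N3 y e) has_real_derivative 108/5 * y^7 + 324/5 * y^5 * e - 18 * y^2 * e^2 + 54 * y^3 * e^2 + 6 * e^3 + 54 * y * e^3) (at y)"
    unfolding N3_def by (auto intro!: derivative_eq_intros)
  moreover have "(108/5 * y^7 + 324/5 * y^5 * e - 18 * y^2 * e^2 + 54 * y^3 * e^2 + 6 * e^3 + 54 * y * e^3) * (y^2 + e) - 2 * real 4 * y * N3 y e = N4 y e"
    unfolding N3_def N4_def of_nat_numeral of_nat_1 by algebra
  ultimately show "((\<lambda>y. N3 y e / (y^2 + e)^4) has_real_derivative N4 y e / (y^2 + e)^5) (at y)"
    by (rule quotient_DERIV[OF assms]) simp_all
  have "((\<lambda>y. M0 y e) has_real_derivative ((-1) * y^3 - 9/4 * y^4)) (at y)"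
    unfolding M0_def by (auto intro!: derivative_eq_intros)
  moreover have "((-1) * y^3 - 9/4 * y^4) * (y^2 + e) - 2 * real 2 * y * M0 y e = M1 y e"
    unfolding M0_def M1_def of_nat_numeral of_nat_1 by algebra
  ultimately show "((\<lambda>y. M0 y e / (y^2 + e)^2) has_real_derivative M1 y e / (y^2 + e)^3) (at y)"
    by (rule quotient_DERIV[OF assms]) simp_all
  have "((\<lambda>y. M1 y e) has_real_derivative ((-27/10) * y^5 - 3 * y^2 * e - 9 * y^3 * e)) (at y)"
    unfolding M1_def by (auto intro!: derivative_eq_intros)
  moreover have "((-27/10) * y^5 - 3 * y^2 * e - 9 * y^3 * e) * (y^2 + e) - 2 * real 3 * y * M1 y e = M2 y e"
    unfolding M1_def M2_def of_nat_numeral of_nat_1 by algebra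
  ultimately show "((\<lambda>y. M1 y e / (y^2 + e)^3) has_real_derivative M2 y e / (y^2 + e)^4) (at y)"
    by (rule quotient_DERIV[OF assms]) simp_all
qed

lemma profile_time_DERIVs:
  assumes "y^2 + e \<noteq> 0"
  shows "((\<lambda>e. N0 y e / (y^2 + e)^1) has_real_derivative M0 y e / (y^2 + e)^2) (at e)"
    and "((\<lambda>e. N1 y e / (y^2 + e)^2) has_real_derivative M1 y e / (y^2 + e)^3) (at e)"
    and "((\<lambda>e. N2 y e / (y^2 + e)^3) has_real_derivative M2 y e / (y^2 + e)^4) (at e)"
  using assms unfolding N0_def N1_def N2_def M0_def M1_def M2_def
  by (auto intro!: derivative_eq_intros simp: divide_simps) (simp add: algebra_simps numeral_eq_Suc)+

text \<open>The exponent is \<open>3/4 - 4\<close>. The singular summand of the profile is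
  \<open>s powr (3/4) * (1 - s)^6\<close>, and it and its four derivatives are all written as this
  one fractional power times a polynomial, so that identities between them become
  polynomial.\<close>

definition sg :: "real \<Rightarrow> real" where "sg s = s powr (- (13 / 4))"

lemma sg_pos: "s > 0 \<Longrightarrow> sg s > 0"
  by (simp add: sg_def)

lemma sg_DERIV: "s > 0 \<Longrightarrow> (sg has_real_derivative - (13 / 4) * sg s / s) (at s)"
proof -
  assume s: "s > 0"
  have "s powr (- (13 / 4) - 1) = s powr (- (13 / 4)) / s" using s powr_diff[of s "- (13 / 4)" 1] by simp
  then show ?thesis
    using has_real_derivative_powr[OF s, of "- (13 / 4)"] unfolding sg_def by simp
qed

text \<open>The zero of order six leaves a factor \<open>(1 - s)^2\<close> even in the fourth
  derivative, so this summand respects the double zero of \<open>h^2\<close> at the sphere. At the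
  origin \<open>r4\<close> has the leading coefficient
  \<open>(3/4) * (- 1/4) * (- 5/4) * (- 9/4) = - 135/256\<close>; since \<open>a4\<close> enters
  \<open>Hr\<close> with the factor \<open>- 8 * s^2\<close>, its contribution there is
  positive.\<close>

definition r0 :: "real \<Rightarrow> real" where "r0 s = sg s * (s^4 * (1 - s)^6)"
definition r1 :: "real \<Rightarrow> real" where "r1 s = sg s * (s^3 * (1 - s)^5 * (3/4 - 27/4 * s))"
definition r2 :: "real \<Rightarrow> real" where "r2 s = sg s * (s^2 * (1 - s)^4 * (- 3/16 - 69/8 * s + 621/16 * s^2))"
definition r3 :: "real \<Rightarrow> real" where
  "r3 s = sg s * (s * (1 - s)^3 * (15/64 + 171/64 * s + 3933/64 * s^2 - 11799/64 * s^3))"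
definition r4 :: "real \<Rightarrow> real" where
  "r4 s = sg s * ((1 - s)^2 * (- 135/256 - 225/64 * s - 2565/128 * s^2 - 19665/64 * s^3 + 176985/256 * s^4))"

lemma sg_mult_DERIV:
  assumes "s > 0" "(f has_real_derivative f') (at s)" "s * f' - 13/4 * f s = s * g"
  shows "((\<lambda>s. sg s * f s) has_real_derivative sg s * g) (at s)"
proof -
  have "((\<lambda>s. sg s * f s) has_real_derivative (- (13 / 4) * sg s / s) * f s + f' * sg s) (at s)"
    by (rule DERIV_mult[OF sg_DERIV[OF assms(1)] assms(2)])
  moreover have "(- (13 / 4) * sg s / s) * f s + f' * sg s = sg s * ((s * f' - 13/4 * f s) / s)"
    using assms(1) by (simp add: field_simps)
  ultimately show ?thesis using assms(1,3) by simp
qed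

lemma rho_DERIVs:
  assumes s: "s > 0"
  shows "(r0 has_real_derivative r1 s) (at s)" "(r1 has_real_derivative r2 s) (at s)"
    "(r2 has_real_derivative r3 s) (at s)" "(r3 has_real_derivative r4 s) (at s)"
  unfolding r0_def r1_def r2_def r3_def r4_def
  by (rule sg_mult_DERIV[OF s], (rule derivative_eq_intros refl)+, simp, algebra)+

text \<open>The weights 36, 144, 216, 144, 36 are the coefficients of
  \<open>36 * (y^2 + e)^4\<close>, and each is compared with one bracket of \<open>GP\<close>: a
  positive constant that outweighs the other terms, since \<open>e\<close> and \<open>d\<close> are
  at most 1/100. The variable \<open>h\<close> stands for \<open>43 * d\<close>, where 43 is the
  exponent of the amplitude; this is below 1/2 thanks to the factor 1/100 in
  \<open>ee\<close>.\<close>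

lemma GP_lower:
  assumes y: "0 \<le> y" "y \<le> 1" and e: "0 < e" "e \<le> 1 / 100" and d: "0 \<le> d" "d \<le> 1 / 100" and h: "0 \<le> h" "h \<le> 1 / 2"
  shows "36 * (y^2 + e)^4 \<le> GP y e d h"
proof -
  have p: "0 \<le> y * h" "y * h \<le> h" "0 \<le> y * e" "y * e \<le> e" "0 \<le> e * h" "e * h \<le> e" "0 \<le> e * d" "e * d \<le> e"
    "0 \<le> y * d" "y * d \<le> d"
    using assms by (auto intro: mult_left_le_one_le mult_right_le_one_le order_trans)
  have p2: "y^2 * h \<le> h" using y h by (intro mult_left_le_one_le) (auto intro: power_le_one)
  have "36 \<le> 48 + h + 581/5 * e + 19/10 * y * h - 1701/5 * y * e - 243/20 * y^2 * h - 117/2 * e * h + 9/4 * e * d"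
    using p p2 e d h y unfolding mult.assoc by linarith
  then have c0: "y^8 * 36 \<le> y^8 * (48 + h + 581/5 * e + 19/10 * y * h - 1701/5 * y * e - 243/20 * y^2 * h - 117/2 * e * h + 9/4 * e * d)"
    using y by (intro mult_left_mono) auto
  have "144 \<le> 240 + 5 * h + 581 * e + 19/2 * y * h - 1701 * y * e - 549/5 * e * h + 243/20 * e * d"
    using p e d h y unfolding mult.assoc by linarith
  then have c1: "y^6 * e * 144 \<le> y^6 * e * (240 + 5 * h + 581 * e + 19/2 * y * h - 1701 * y * e - 549/5 * e * h + 243/20 * e * d)"
    using y e by (intro mult_left_mono) auto
  have "216 \<le> 480 + 13 * h + 6 * d + 5873/5 * e + 203/10 * y * h + 13/5 * y * d - 17001/5 * y * e - 927/10 * e * h + 783/20 * e * d"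
    using p e d h y unfolding mult.assoc by linarith
  then have c2: "y^4 * e^2 * 216 \<le> y^4 * e^2 * (480 + 13 * h + 6 * d + 5873/5 * e + 203/10 * y * h + 13/5 * y * d - 17001/5 * y * e
       - 927/10 * e * h + 783/20 * e * d)"
    using y e by (intro mult_left_mono) auto
  have "144 \<le> 240 + 288/5 * y + 15 * h + 495 * e + 197/10 * y * h - 22/5 * y * d - 3231 * y * e - 117/4 * e * h + 117/4 * e * d"
    using p e d h y unfolding mult.assoc by linarith
  then have c3: "y^2 * e^3 * 144 \<le> y^2 * e^3 * (240 + 288/5 * y + 15 * h + 495 * e + 197/10 * y * h - 22/5 * y * d - 3231 * y * e
       - 117/4 * e * h + 117/4 * e * d)"
    using y e by (intro mult_left_mono) auto
  have "36 \<le> 720 - 96 * y + 6 * h - 6 * d + 1782 * e + 7 * y * h - 7 * y * d - 2574 * y * e"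
    using p e d h y unfolding mult.assoc by linarith
  then have c4: "e^4 * 36 \<le> e^4 * (720 - 96 * y + 6 * h - 6 * d + 1782 * e + 7 * y * h - 7 * y * d - 2574 * y * e)"
    using y e by (intro mult_left_mono) auto
  have "36 * (y^2 + e)^4 = y^8 * 36 + y^6 * e * 144 + y^4 * e^2 * 216 + y^2 * e^3 * 144 + e^4 * 36" by algebra
  then show ?thesis unfolding GP_def using c0 c1 c2 c3 c4 by linarith
qed

text \<open>The contribution of the singular summand to \<open>Hr\<close>, freed of
  \<open>(1 - s)^2\<close>: \<open>SP1\<close> stems from the time derivative of the amplitude,
  \<open>SP2\<close> from the Laplacian.\<close>

definition SP1 :: "real \<Rightarrow> real" where
  "SP1 s = sg s * (s^3 * (1 - s)^2 * (27/8 - 219/4 * s + 891/8 * s^2))"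

definition SP2 :: "real \<Rightarrow> real" where
  "SP2 s = sg s * (s^2 * (135/32 + 3753/8 * s - 112683/16 * s^2 + 178089/8 * s^3 - 594297/32 * s^4))"

definition Gr :: "real \<Rightarrow> real \<Rightarrow> real" where
  "Gr t s = GP (1 - s) (ee t) (1/100 - ee t) (43 * (1/100 - ee t)) / ((1 - s)^2 + ee t)^5
     + (43 * (1/100 - ee t) * SP1 s + ee t * SP2 s) / 100"

text \<open>The boundary-layer part is at least \<open>36 / (101/100)\<close>, hence at least 35,
  while the negative terms of the singular part cost at most \<open>(60 + 260) / 100\<close>. Beyond
  positivity, the growth of \<open>sg s * s^2 = s powr (- (5/4))\<close> at the origin is retained;
  it gives the blow-up of \<open>u\<close> and the bound on the reciprocal square root.\<close>

lemma Gr_lower: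
  assumes t: "t > 0" and s: "0 < s" "s < 1"
  shows "1 + ee t * (sg s * s^2) / 100 \<le> Gr t s"
proof -
  let ?e = "ee t" and ?y = "1 - s"
  have e: "0 < ?e" "?e < 1 / 100" using ee_bounds[of t] t by auto
  have b: "0 < ?y^2 + ?e" "?y^2 + ?e \<le> 101 / 100"
    using e s power_le_one[of ?y 2] by (auto intro: add_nonneg_pos)
  have "36 * (?y^2 + ?e)^4 \<le> GP ?y ?e (1/100 - ?e) (43 * (1/100 - ?e))"
    using e s by (intro GP_lower) auto
  then have "36 * (?y^2 + ?e)^4 / (?y^2 + ?e)^5 \<le> GP ?y ?e (1/100 - ?e) (43 * (1/100 - ?e)) / (?y^2 + ?e)^5"
    using b by (intro divide_right_mono) auto
  moreover have "36 * (?y^2 + ?e)^4 / (?y^2 + ?e)^5 = 36 / (?y^2 + ?e)"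
    using b by (simp add: divide_simps eval_nat_numeral)
  moreover have "35 \<le> 36 / (?y^2 + ?e)" using b by (simp add: field_simps)
  ultimately have 1: "35 \<le> GP ?y ?e (1/100 - ?e) (43 * (1/100 - ?e)) / (?y^2 + ?e)^5" by linarith
  \<comment> \<open>Every negative term of \<open>SP1\<close> and \<open>SP2\<close> contains
    \<open>sg s * s^4\<close>, which lies between 0 and 1; this gives the constants 60 and 26000,
    and \<open>ee t * 26000\<close> is at most 260.\<close>
  have q: "sg s * s^4 = s powr (3/4)" 
  proof -
    have "s^4 = s powr 4" using s by simp
    then show ?thesis unfolding sg_def by (simp only: powr_add[symmetric]) simp
  qed
  have sgp: "0 < sg s" by (rule sg_pos[OF s(1)])
  have q1: "0 \<le> sg s * s^4" "sg s * s^4 \<le> 1" using s q powr_mono'[of 0 "3/4" s] sgp by auto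
  have SP1: "- 60 \<le> SP1 s"
  proof -
    have "SP1 s = sg s * s^3 * (1 - s)^2 * (27/8 + 891/8 * s^2) - 219/4 * ((sg s * s^4) * (1 - s)^2)"
      unfolding SP1_def by algebra
    moreover have "0 \<le> sg s * s^3 * (1 - s)^2 * (27/8 + 891/8 * s^2)" using s sgp by auto
    moreover have "(sg s * s^4) * (1 - s)^2 \<le> 1 * 1" using q1 s by (intro mult_mono) (auto intro: power_le_one)
    ultimately show ?thesis by linarith
  qed
  have SP2: "135/32 * (sg s * s^2) - 26000 \<le> SP2 s"
  proof -
    have "SP2 s = 135/32 * (sg s * s^2) + sg s * s^2 * (3753/8 * s + 178089/8 * s^3) - 112683/16 * (sg s * s^4) - 594297/32 * ((sg s * s^4) * s^2)"
      unfolding SP2_def by algebra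
    moreover have "0 \<le> sg s * s^2 * (3753/8 * s + 178089/8 * s^3)" using s sgp by auto
    moreover have "(sg s * s^4) * s^2 \<le> 1 * 1" using q1 s by (intro mult_mono) (auto intro: power_le_one)
    ultimately show ?thesis using q1 by linarith
  qed
  have "43 * (1/100 - ?e) * (- 60) \<le> 43 * (1/100 - ?e) * SP1 s" using SP1 e by (intro mult_left_mono) auto
  then have 2: "- 60 \<le> 43 * (1/100 - ?e) * SP1 s" using e by (elim order_trans[rotated]) simp
  have "?e * (135/32 * (sg s * s^2) - 26000) \<le> ?e * SP2 s" using SP2 e by (intro mult_left_mono) auto
  then have 3: "135/32 * (?e * (sg s * s^2)) - 260 \<le> ?e * SP2 s" using e by (simp add: algebra_simps)
  have "0 \<le> ?e * (sg s * s^2)" using e sgp by auto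
  moreover have "1 + D / 100 \<le> A + (B + C) / 100"
    if "35 \<le> A" "- 60 \<le> B" "135 / 32 * D - 260 \<le> C" "0 \<le> D" for A B C D :: real
    using that by (simp add: field_simps)
  ultimately show ?thesis unfolding Gr_def using 1 2 3 by blast
qed

text \<open>The quantity \<open>a0\<close> is a stream potential: the stream function of \<open>v\<close> is its radial derivative \<open>a1\<close>.  The
  numbers attached to the names count derivatives in the squared radius, and \<open>d0\<close>, \<open>d1\<close>, \<open>d2\<close> are
  time derivatives.\<close>

definition a0 :: "real \<Rightarrow> real \<Rightarrow> real" where
  "a0 t s = ee t^43 * (N0 (1 - s) (ee t) / ((1 - s)^2 + ee t)^1 + r0 s / 100)"
definition a1 :: "real \<Rightarrow> real \<Rightarrow> real" where
  "a1 t s = ee t^43 * (- (N1 (1 - s) (ee t) / ((1 - s)^2 + ee t)^2) + r1 s / 100)"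
definition a2 :: "real \<Rightarrow> real \<Rightarrow> real" where
  "a2 t s = ee t^43 * (N2 (1 - s) (ee t) / ((1 - s)^2 + ee t)^3 + r2 s / 100)"
definition a3 :: "real \<Rightarrow> real \<Rightarrow> real" where
  "a3 t s = ee t^43 * (- (N3 (1 - s) (ee t) / ((1 - s)^2 + ee t)^4) + r3 s / 100)"
definition a4 :: "real \<Rightarrow> real \<Rightarrow> real" where
  "a4 t s = ee t^43 * (N4 (1 - s) (ee t) / ((1 - s)^2 + ee t)^5 + r4 s / 100)"

definition d0 :: "real \<Rightarrow> real \<Rightarrow> real" where
  "d0 t s = (1/100 - ee t) * (43 * ee t^42 * (N0 (1 - s) (ee t) / ((1 - s)^2 + ee t)^1 + r0 s / 100)
     + ee t^43 * (M0 (1 - s) (ee t) / ((1 - s)^2 + ee t)^2))"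
definition d1 :: "real \<Rightarrow> real \<Rightarrow> real" where
  "d1 t s = (1/100 - ee t) * (43 * ee t^42 * (- (N1 (1 - s) (ee t) / ((1 - s)^2 + ee t)^2) + r1 s / 100)
     + ee t^43 * (- (M1 (1 - s) (ee t) / ((1 - s)^2 + ee t)^3)))"
definition d2 :: "real \<Rightarrow> real \<Rightarrow> real" where
  "d2 t s = (1/100 - ee t) * (43 * ee t^42 * (N2 (1 - s) (ee t) / ((1 - s)^2 + ee t)^3 + r2 s / 100)
     + ee t^43 * (M2 (1 - s) (ee t) / ((1 - s)^2 + ee t)^4))"

text \<open>The function \<open>j1\<close> is the radial profile of the heat operator applied to
  \<open>v\<close>, where the Laplacian acts as \<open>4 * s * f'' + 14 * f'\<close>. Its primitive
  \<open>j0\<close> enters the pressure and its derivative is \<open>j2\<close>; the numbers 10 and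
  18 are \<open>14 - 4\<close> and \<open>14 + 4\<close>, with 4 from differentiating
  \<open>4 * s\<close>.\<close>

definition j0 :: "real \<Rightarrow> real \<Rightarrow> real" where "j0 t s = d0 t s - 4 * s * a2 t s - 10 * a1 t s"
definition j1 :: "real \<Rightarrow> real \<Rightarrow> real" where "j1 t s = d1 t s - 4 * s * a3 t s - 14 * a2 t s"
definition j2 :: "real \<Rightarrow> real \<Rightarrow> real" where "j2 t s = d2 t s - 4 * s * a4 t s - 18 * a3 t s"

text \<open>The coefficient of \<open>(x1, x2, 0)\<close> in the equation for \<open>v\<close>. At
  \<open>s = 1\<close> the constant 48 meets \<open>- 8 * a4\<close>, contained in
  \<open>2 * s * j2\<close>, and \<open>a4 = 6 * ee t^42\<close> there because
  \<open>N4 0 e = 6 * e^4\<close>; this explains the coefficient 1/4 of \<open>y^4\<close> in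
  \<open>N0\<close>. With the coefficient 9/20 of \<open>y^5\<close> the first order in
  \<open>y = 1 - s\<close> cancels as well: up to \<open>ee t^42\<close>, the term of
  \<open>a4\<close> contributes \<open>- 336 * y\<close> and that of \<open>a3\<close> contributes
  \<open>336 * y\<close>.\<close>

definition Hr :: "real \<Rightarrow> real \<Rightarrow> real" where
  "Hr t s = 2 * s * j2 t s + 5 * j1 t s + 48 * ee t^42"

text \<open>Layer and singular part are independent summands, and each carries its factor
  \<open>(1 - s)^2\<close> by a polynomial identity of its own: \<open>R\<close>, cleared of
  denominators by \<open>b^5\<close>, and \<open>S\<close>.\<close>

lemma Hr_eq:
  assumes t: "t > 0"
  shows "Hr t s = ee t^42 * (1 - s)^2 * Gr t s"
proof -
  define e where "e = ee t"
  define y where "y = 1 - s"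
  define b where "b = y^2 + e"
  define d where "d = 1/100 - e"
  have e: "e > 0" using ee_bounds[of t] t by (simp add: e_def)
  then have b: "b > 0" by (simp add: b_def add_nonneg_pos)
  have s: "s = 1 - y" by (simp add: y_def)
  have R: "48 * b^5 + 43 * d * (2 * s * (N2 y e * b^2) - 5 * (N1 y e * b^3)) + e * d * (2 * s * (M2 y e * b) - 5 * (M1 y e * b^2))
      - e * (8 * s^2 * N4 y e - 56 * s * (N3 y e * b) + 70 * (N2 y e * b^2)) = y^2 * GP y e d (43 * d)"
    unfolding s b_def N1_def N2_def N3_def N4_def M1_def M2_def GP_def by algebra
  have R': "48 + 43 * d * (2 * s * (N2 y e / b^3) - 5 * (N1 y e / b^2)) + e * d * (2 * s * (M2 y e / b^4) - 5 * (M1 y e / b^3))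
      - e * (8 * s^2 * (N4 y e / b^5) - 56 * s * (N3 y e / b^4) + 70 * (N2 y e / b^3)) = y^2 * (GP y e d (43 * d) / b^5)"
  proof -
    \<comment> \<open>Naming the quotients makes them indeterminates, so that only polynomial
      arithmetic remains.\<close>
    define X1 X2 X3 X4 Y1 Y2 Z where X: "X1 = N1 y e / b^2" "X2 = N2 y e / b^3" "X3 = N3 y e / b^4" "X4 = N4 y e / b^5"
      "Y1 = M1 y e / b^3" "Y2 = M2 y e / b^4" "Z = GP y e d (43 * d) / b^5"
    have N: "N1 y e = X1 * b^2" "N2 y e = X2 * b^3" "N3 y e = X3 * b^4" "N4 y e = X4 * b^5"
      "M1 y e = Y1 * b^3" "M2 y e = Y2 * b^4" "GP y e d (43 * d) = Z * b^5"
      using b by (simp_all add: X)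
    have "b^5 * (48 + 43 * d * (2 * s * X2 - 5 * X1) + e * d * (2 * s * Y2 - 5 * Y1)
      - e * (8 * s^2 * X4 - 56 * s * X3 + 70 * X2)) = b^5 * (y^2 * Z)"
      using R unfolding N by algebra
    then show ?thesis using b unfolding X[symmetric] by simp
  qed
  have S: "43 * d * (2 * s * r2 s + 5 * r1 s) - e * (8 * s^2 * r4 s + 56 * s * r3 s + 70 * r2 s) = y^2 * (43 * d * SP1 s + e * SP2 s)"
    unfolding r1_def r2_def r3_def r4_def SP1_def SP2_def y_def by algebra
  have "Hr t s = e^42 * ((48 + 43 * d * (2 * s * (N2 y e / b^3) - 5 * (N1 y e / b^2)) + e * d * (2 * s * (M2 y e / b^4) - 5 * (M1 y e / b^3))
      - e * (8 * s^2 * (N4 y e / b^5) - 56 * s * (N3 y e / b^4) + 70 * (N2 y e / b^3)))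
      + (43 * d * (2 * s * r2 s + 5 * r1 s) - e * (8 * s^2 * r4 s + 56 * s * r3 s + 70 * r2 s)) / 100)"
  proof -
    define X1 X2 X3 X4 Y1 Y2 where X: "X1 = N1 y e / b^2" "X2 = N2 y e / b^3" "X3 = N3 y e / b^4" "X4 = N4 y e / b^5"
      "Y1 = M1 y e / b^3" "Y2 = M2 y e / b^4"
    define q where "q = e^42"
    have q: "e^43 = e * q" unfolding q_def power_Suc[symmetric] by simp
    show ?thesis
      unfolding Hr_def j1_def j2_def d1_def d2_def a2_def a3_def a4_def
        e_def[symmetric] y_def[symmetric] d_def[symmetric] b_def[symmetric] X[symmetric] q q_def[symmetric]
      by algebra
  qed
  also have "\<dots> = e^42 * (y^2 * (GP y e d (43 * d) / b^5) + y^2 * (43 * d * SP1 s + e * SP2 s) / 100)"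
    unfolding R' S ..
  also have "\<dots> = e^42 * y^2 * Gr t s"
    unfolding Gr_def e_def[symmetric] y_def[symmetric] d_def[symmetric] b_def[symmetric] by algebra
  finally show ?thesis by (simp add: e_def y_def)
qed

lemma DERIV_reflect:
  fixes f :: "real \<Rightarrow> real"
  assumes "(f has_real_derivative f') (at (1 - s))"
  shows "((\<lambda>s. f (1 - s)) has_real_derivative - f') (at s)"
proof -
  have "((\<lambda>s. 1 - s) has_real_derivative - 1) (at s)" by (auto intro!: derivative_eq_intros)
  from DERIV_chain2[where f=f and g="\<lambda>s. 1 - s" and x=s, OF assms this] show ?thesis by simp
qed

lemma a_DERIVs:
  assumes t: "t > 0" and s: "s > 0"
  shows "(a0 t has_real_derivative a1 t s) (at s)" "(a1 t has_real_derivative a2 t s) (at s)"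
    "(a2 t has_real_derivative a3 t s) (at s)" "(a3 t has_real_derivative a4 t s) (at s)"
    "(d0 t has_real_derivative d1 t s) (at s)" "(d1 t has_real_derivative d2 t s) (at s)"
proof -
  let ?e = "ee t"
  have "?e > 0" using ee_bounds t by auto
  then have b: "(1 - s)^2 + ?e \<noteq> 0" by (metis add_nonneg_pos less_numeral_extra(3) zero_le_power2)
  note P = profile_DERIVs[OF b, THEN DERIV_reflect]
  note R = rho_DERIVs[OF s]
  show "(a0 t has_real_derivative a1 t s) (at s)" unfolding a0_def[abs_def] a1_def
    by (rule DERIV_cong, rule DERIV_cmult, rule DERIV_add, rule P, rule DERIV_cdivide, rule R) simp
  show "(a1 t has_real_derivative a2 t s) (at s)" unfolding a1_def[abs_def] a2_def
    by (rule DERIV_cong, rule DERIV_cmult, rule DERIV_add, rule DERIV_minus, rule P, rule DERIV_cdivide, rule R) simp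
  show "(a2 t has_real_derivative a3 t s) (at s)" unfolding a2_def[abs_def] a3_def
    by (rule DERIV_cong, rule DERIV_cmult, rule DERIV_add, rule P, rule DERIV_cdivide, rule R) simp
  show "(a3 t has_real_derivative a4 t s) (at s)" unfolding a3_def[abs_def] a4_def
    by (rule DERIV_cong, rule DERIV_cmult, rule DERIV_add, rule DERIV_minus, rule P, rule DERIV_cdivide, rule R) simp
  show "(d0 t has_real_derivative d1 t s) (at s)" unfolding d0_def[abs_def] d1_def
    by (rule DERIV_cong, rule DERIV_cmult, rule DERIV_add, rule DERIV_cmult, rule DERIV_add, rule P, rule DERIV_cdivide, rule R,
        rule DERIV_cmult, rule P) simp
  show "(d1 t has_real_derivative d2 t s) (at s)" unfolding d1_def[abs_def] d2_def
    by (rule DERIV_cong, rule DERIV_cmult, rule DERIV_add, rule DERIV_cmult, rule DERIV_add, rule DERIV_minus, rule P, rule DERIV_cdivide, rule R,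
        rule DERIV_cmult, rule DERIV_minus, rule P) simp
qed

lemma a_time_DERIVs:
  assumes t: "t > 0"
  shows "((\<lambda>t. a0 t s) has_real_derivative d0 t s) (at t)" "((\<lambda>t. a1 t s) has_real_derivative d1 t s) (at t)"
    "((\<lambda>t. a2 t s) has_real_derivative d2 t s) (at t)"
proof -
  let ?e = "ee t"
  have "?e > 0" using ee_bounds t by auto
  then have b: "(1 - s)^2 + ?e \<noteq> 0" by (metis add_nonneg_pos less_numeral_extra(3) zero_le_power2)
  have p: "((\<lambda>e. e^43 * f e) has_real_derivative 43 * e^42 * f e + e^43 * f') (at e)"
    if "(f has_real_derivative f') (at e)" for f f' and e :: real
    using DERIV_mult[OF DERIV_pow[of 43 e UNIV] that] by (simp add: mult_ac)
  have k: "((\<lambda>e. f e + c) has_real_derivative f') (at e)" if "(f has_real_derivative f') (at e)" for f f' and e c :: real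
    using DERIV_add[OF that DERIV_const[of c]] by simp
  note P = profile_time_DERIVs[OF b]
  show "((\<lambda>t. a0 t s) has_real_derivative d0 t s) (at t)"
    using DERIV_chain2[OF p[OF k[OF P(1)]] ee_deriv, of "r0 s / 100"] unfolding a0_def d0_def by (simp add: mult.commute)
  show "((\<lambda>t. a1 t s) has_real_derivative d1 t s) (at t)"
    using DERIV_chain2[OF p[OF k[OF DERIV_minus[OF P(2)]]] ee_deriv, of "r1 s / 100"] unfolding a1_def d1_def by (simp add: mult.commute)
  show "((\<lambda>t. a2 t s) has_real_derivative d2 t s) (at t)"
    using DERIV_chain2[OF p[OF k[OF P(3)]] ee_deriv, of "r2 s / 100"] unfolding a2_def d2_def by (simp add: mult.commute)
qed

section \<open>Membership in the differential algebra\<close>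

definition BB :: "spacetime \<Rightarrow> real" where
  "BB q = 1 / ((1 - snd q \<bullet> snd q)^2 + ee (fst q))"

definition L :: "(real \<Rightarrow> real \<Rightarrow> real) \<Rightarrow> spacetime \<Rightarrow> real" where
  "L f q = f (fst q) (snd q \<bullet> snd q)"

text \<open>The reciprocal \<open>gi\<close> accompanies \<open>gg\<close> because derivatives of
  square roots produce it: with \<open>G = L Gr\<close> the derivative of \<open>gg\<close> is
  \<open>gi / 2\<close> times that of \<open>G\<close>, and the derivative of \<open>gi\<close> is
  \<open>- gi^3 / 2\<close> times that of \<open>G\<close>.\<close>

definition gg :: "spacetime \<Rightarrow> real" where "gg q = sqrt (L Gr q)"
definition gi :: "spacetime \<Rightarrow> real" where "gi q = 1 / sqrt (L Gr q)"

definition Gen0 :: "(real \<times> real \<times> (spacetime \<Rightarrow> real)) set" where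
  "Gen0 = {(0, 1, BB)}"

definition Gen1 :: "(real \<times> real \<times> (spacetime \<Rightarrow> real)) set" where
  "Gen1 = {(0, 1, BB), (5/4, 5, gg), (- (5/4), 1, gi)}"

lemma cylD: "q \<in> cyl \<Longrightarrow> 0 < fst q" "q \<in> cyl \<Longrightarrow> 0 < snd q \<bullet> snd q" "q \<in> cyl \<Longrightarrow> snd q \<bullet> snd q < 1"
  by (auto simp: cyl_def dot_square_norm power_less_one_iff)

lemma BB_denominator_pos: "q \<in> cyl \<Longrightarrow> 0 < (1 - snd q \<bullet> snd q)^2 + ee (fst q)"
  using ee_bounds(1)[OF cylD(1)] by (simp add: add_nonneg_pos)

lemma alg_power: "alg Gen p N F \<Longrightarrow> alg Gen (real n * p) (real n * N) (\<lambda>q. F q ^ n)"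
proof (induction n)
  case 0
  then show ?case using alg_const[of Gen 1] by simp
next
  case (Suc n)
  have "alg Gen (p + real n * p) (N + real n * N) (\<lambda>q. F q * F q ^ n)"
    using Suc by (intro alg_mult) auto
  then show ?case by (simp add: algebra_simps)
qed

lemma alg_cmult: "alg Gen p N F \<Longrightarrow> alg Gen p N (\<lambda>q. c * F q)"
  using alg_mult[OF alg_const, of Gen p N F c] by simp

lemma alg_minus: "alg Gen p N F \<Longrightarrow> alg Gen p N (\<lambda>q. - F q)"
  using alg_cmult[of Gen p N F "- 1"] by simp

lemma alg_diff: "alg Gen p N F \<Longrightarrow> alg Gen p N G \<Longrightarrow> alg Gen p N (\<lambda>q. F q - G q)"
  using alg_add[OF _ alg_minus, of Gen p N F G] by simp

lemma alg_divide: "alg Gen p N F \<Longrightarrow> alg Gen p N (\<lambda>q. F q / c)"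
  using alg_cmult[of Gen p N F "1 / c"] by simp

lemma
  shows alg00_const: "alg Gen 0 0 (\<lambda>_. c)"
    and alg00_coord: "alg Gen 0 0 (\<lambda>q. snd q $ i)"
    and alg00_ee: "alg Gen 0 0 (\<lambda>q. ee (fst q))"
  by (rule alg_const, rule alg_weaken[OF alg_coord], simp, simp, rule alg_weaken[OF alg_ee], simp, simp)

lemma alg00_mult: "alg Gen 0 0 F \<Longrightarrow> alg Gen 0 0 G \<Longrightarrow> alg Gen 0 0 (\<lambda>q. F q * G q)"
  using alg_mult[of Gen 0 0 F 0 0 G] by simp

lemma alg00_power: "alg Gen 0 0 F \<Longrightarrow> alg Gen 0 0 (\<lambda>q. F q ^ n)"
  using alg_power[of Gen 0 0 F n] by simp

lemma alg_s_powr: "alg Gen (- (2 * a)) 0 (\<lambda>q. (snd q \<bullet> snd q) powr a)"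
proof (rule alg_cong[OF alg_radius[of Gen "2 * a"]])
  fix q :: spacetime
  have "(snd q \<bullet> snd q) powr a = (norm (snd q) powr 2) powr a" by (simp add: dot_square_norm)
  then show "norm (snd q) powr (2 * a) = (snd q \<bullet> snd q) powr a" by (simp only: powr_powr)
qed

lemma alg_s_power: "alg Gen (- (2 * real n)) 0 (\<lambda>q. (snd q \<bullet> snd q) ^ n)"
  by (rule alg_cong[OF alg_s_powr[of Gen "real n"]]) (rule powr_realpow[OF cylD(2)])

lemma alg00_s: "alg Gen 0 0 (\<lambda>q. snd q \<bullet> snd q)"
  using alg_weaken[OF alg_s_power[of Gen 1], of 0 0] by simp

lemma alg_sg: "alg Gen (13 / 2) 0 (\<lambda>q. sg (snd q \<bullet> snd q))"
  unfolding sg_def using alg_s_powr[of Gen "- (13 / 4)"] by simp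

lemmas alg00_intros = alg00_const alg00_coord alg00_ee alg00_mult alg00_power alg00_s alg_add[of _ 0 0] alg_diff[of _ 0 0] alg_minus[of _ 0 0]

lemma alg_ee_power: "alg Gen 0 (- real n) (\<lambda>q. ee (fst q) ^ n)"
  using alg_power[OF alg_ee, of Gen n] by simp

lemma alg_quotient:
  assumes "(0, 1, BB) \<in> Gen" "alg Gen 0 0 F"
  shows "alg Gen 0 (real n) (\<lambda>q. F q / ((1 - snd q \<bullet> snd q)^2 + ee (fst q))^n)"
proof -
  have "alg Gen 0 (real n) (\<lambda>q. F q * BB q ^ n)"
    using alg_mult[OF assms(2) alg_power[OF alg_gen[OF assms(1)], of n]] by simp
  then show ?thesis by (simp add: BB_def power_divide)
qed

lemma alg_sg_part:
  assumes "alg Gen 0 0 F" "13 / 2 - 2 * real n \<le> p"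
  shows "alg Gen p 0 (\<lambda>q. sg (snd q \<bullet> snd q) * ((snd q \<bullet> snd q)^n * F q))"
  using alg_weaken[OF alg_mult[OF alg_sg alg_mult[OF alg_s_power[of Gen n] assms(1)]], of p 0] assms(2) by simp

text \<open>The order 5/2 is that of \<open>SP2\<close>, where \<open>sg\<close> of order 13/2 is
  multiplied by \<open>s^2\<close>; the grade 5 is the power of \<open>BB\<close> in the layer
  part.\<close>

lemma Gr_alg:
  assumes B: "(0, 1, BB) \<in> Gen" shows "alg Gen (5 / 2) 5 (L Gr)"
proof -
  let ?s = "\<lambda>q::spacetime. snd q \<bullet> snd q" and ?e = "\<lambda>q::spacetime. ee (fst q)"
  have 1: "alg Gen (5 / 2) 5 (\<lambda>q. GP (1 - ?s q) (?e q) (1/100 - ?e q) (43 * (1/100 - ?e q)) / ((1 - ?s q)^2 + ?e q)^5)"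
    unfolding GP_def
    by (rule alg_weaken[OF alg_quotient[OF B, of _ 5]]) (intro alg00_intros, simp_all)
  have 2: "alg Gen (5 / 2) 0 (\<lambda>q. SP1 (?s q))" unfolding SP1_def mult.assoc
    by (rule alg_sg_part) (intro alg00_intros, simp)
  have 3: "alg Gen (5 / 2) 0 (\<lambda>q. SP2 (?s q))" unfolding SP2_def
    by (rule alg_sg_part) (intro alg00_intros, simp)
  have "alg Gen (0 + 5 / 2) (0 + 0) (\<lambda>q. 43 * (1/100 - ?e q) * SP1 (?s q))"
    by (intro alg_mult 2) (intro alg00_intros)
  moreover have "alg Gen (0 + 5 / 2) (0 + 0) (\<lambda>q. ?e q * SP2 (?s q))"
    by (intro alg_mult 3) (intro alg00_intros)
  ultimately have "alg Gen (5 / 2) 0 (\<lambda>q. (43 * (1/100 - ?e q) * SP1 (?s q) + ?e q * SP2 (?s q)) / 100)"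
    by (intro alg_divide alg_add) simp_all
  then have "alg Gen (5 / 2) 5 (\<lambda>q. (43 * (1/100 - ?e q) * SP1 (?s q) + ?e q * SP2 (?s q)) / 100)"
    by (rule alg_weaken) simp_all
  from alg_add[OF 1 this] show ?thesis unfolding L_def Gr_def .
qed

lemma ee_part:
  assumes "alg Gen p N F" shows "alg Gen p (N - real n) (\<lambda>q. ee (fst q) ^ n * F q)"
  using alg_mult[OF alg_ee_power assms, of n] by simp

text \<open>The layer terms have grade at most 5, whence \<open>5 - 43 = - 38\<close>. From the
  first derivative on, the orders at the origin are those of the derivatives of
  \<open>s powr (3/4)\<close>, namely \<open>2 * k - 3/2\<close> for the derivative number
  \<open>k\<close>.\<close>

lemma a_alg:
  assumes B: "(0, 1, BB) \<in> Gen"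
  shows "alg Gen 0 (- 38) (L a0)" "alg Gen (1 / 2) (- 38) (L a1)" "alg Gen (5 / 2) (- 38) (L a2)"
    "alg Gen (9 / 2) (- 38) (L a3)" "alg Gen (13 / 2) (- 38) (L a4)"
    "alg Gen 0 (- 38) (L d0)" "alg Gen (1 / 2) (- 38) (L d1)" "alg Gen (5 / 2) (- 38) (L d2)"
proof -
  let ?s = "\<lambda>q::spacetime. snd q \<bullet> snd q" and ?e = "\<lambda>q::spacetime. ee (fst q)"
  let ?b = "\<lambda>q. (1 - ?s q)^2 + ?e q"
  have Q: "alg Gen p (real n) (\<lambda>q. F q / ?b q ^ n)" if "alg Gen 0 0 F" "0 \<le> p" for F p n
    by (rule alg_weaken[OF alg_quotient[OF B that(1)]]) (use that in auto)
  have N: "alg Gen 0 0 (\<lambda>q. N0 (1 - ?s q) (?e q))" "alg Gen 0 0 (\<lambda>q. N1 (1 - ?s q) (?e q))"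
    "alg Gen 0 0 (\<lambda>q. N2 (1 - ?s q) (?e q))" "alg Gen 0 0 (\<lambda>q. N3 (1 - ?s q) (?e q))"
    "alg Gen 0 0 (\<lambda>q. N4 (1 - ?s q) (?e q))" "alg Gen 0 0 (\<lambda>q. M0 (1 - ?s q) (?e q))"
    "alg Gen 0 0 (\<lambda>q. M1 (1 - ?s q) (?e q))" "alg Gen 0 0 (\<lambda>q. M2 (1 - ?s q) (?e q))"
    unfolding N0_def N1_def N2_def N3_def N4_def M0_def M1_def M2_def by (intro alg00_intros)+
  have R: "alg Gen 0 0 (\<lambda>q. r0 (?s q) / 100)" "alg Gen (1 / 2) 0 (\<lambda>q. r1 (?s q) / 100)"
    "alg Gen (5 / 2) 0 (\<lambda>q. r2 (?s q) / 100)" "alg Gen (9 / 2) 0 (\<lambda>q. r3 (?s q) / 100)" "alg Gen (13 / 2) 0 (\<lambda>q. r4 (?s q) / 100)"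
  proof -
    show "alg Gen 0 0 (\<lambda>q. r0 (?s q) / 100)" unfolding r0_def mult.assoc
      by (intro alg_divide, rule alg_sg_part) (intro alg00_intros, simp)
    show "alg Gen (1 / 2) 0 (\<lambda>q. r1 (?s q) / 100)" unfolding r1_def mult.assoc
      by (intro alg_divide, rule alg_sg_part) (intro alg00_intros, simp)
    show "alg Gen (5 / 2) 0 (\<lambda>q. r2 (?s q) / 100)" unfolding r2_def mult.assoc
      by (intro alg_divide, rule alg_sg_part) (intro alg00_intros, simp)
    have "alg Gen (9 / 2) 0 (\<lambda>q. sg (?s q) * ((?s q)^1 * ((1 - ?s q)^3 * (15/64 + 171/64 * ?s q + 3933/64 * (?s q)^2 - 11799/64 * (?s q)^3))))"
      by (rule alg_sg_part) (intro alg00_intros, simp)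
    then show "alg Gen (9 / 2) 0 (\<lambda>q. r3 (?s q) / 100)" unfolding r3_def mult.assoc
      by (intro alg_divide) simp
    have "alg Gen (13 / 2) 0 (\<lambda>q. sg (?s q) * ((?s q)^0 * ((1 - ?s q)^2 * (- 135/256 - 225/64 * ?s q - 2565/128 * (?s q)^2 - 19665/64 * (?s q)^3 + 176985/256 * (?s q)^4))))"
      by (rule alg_sg_part) (intro alg00_intros, simp)
    then show "alg Gen (13 / 2) 0 (\<lambda>q. r4 (?s q) / 100)" unfolding r4_def mult.assoc
      by (intro alg_divide) simp
  qed
  have W: "alg Gen p 5 (\<lambda>q. G q + H q)" if "alg Gen p (real n) G" "alg Gen p 0 H" "n \<le> 5" for p n G H
    using that by (intro alg_add) (auto intro: alg_weaken)
  have E: "alg Gen p (- 38) (\<lambda>q. ?e q ^ 43 * F q)" if "alg Gen p 5 F" for p F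
    using ee_part[OF that, of 43] by simp
  note WQ = W[OF Q] W[OF alg_minus[OF Q]]
  show A: "alg Gen 0 (- 38) (L a0)" "alg Gen (1 / 2) (- 38) (L a1)" "alg Gen (5 / 2) (- 38) (L a2)"
    "alg Gen (9 / 2) (- 38) (L a3)" "alg Gen (13 / 2) (- 38) (L a4)"
    unfolding L_def a0_def a1_def a2_def a3_def a4_def
    by (rule E, rule WQ, rule N, simp, rule R, simp)+
  have E2: "alg Gen p (- 38) (\<lambda>q. (1/100 - ?e q) * (43 * ?e q ^ 42 * F q + ?e q ^ 43 * K q))"
    if "alg Gen p 4 F" "alg Gen p 5 K" for p F K
  proof -
    have "alg Gen (0 + p) (0 + - 38) (\<lambda>q. 43 * (?e q ^ 42 * F q))" "alg Gen (0 + p) (0 + - 38) (\<lambda>q. ?e q ^ 43 * K q)"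
      using ee_part[OF that(1), of 42] E[OF that(2)] by (auto intro: alg_cmult)
    then have "alg Gen (0 + p) (0 + - 38) (\<lambda>q. (1/100 - ?e q) * (43 * (?e q ^ 42 * F q) + ?e q ^ 43 * K q))"
      by (intro alg_mult alg_add) (intro alg00_intros, auto)
    then show ?thesis by (simp add: mult.assoc)
  qed
  have W4: "alg Gen p 4 (\<lambda>q. G q + H q)" if "alg Gen p (real n) G" "alg Gen p 0 H" "n \<le> 4" for p n G H
    using that by (intro alg_add) (auto intro: alg_weaken)
  have Q5: "alg Gen p 5 G" if "alg Gen p (real n) G" "n \<le> 5" for p n G
    by (rule alg_weaken[OF that(1)]) (use that in auto)
  show "alg Gen 0 (- 38) (L d0)" "alg Gen (1 / 2) (- 38) (L d1)" "alg Gen (5 / 2) (- 38) (L d2)"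
    unfolding L_def d0_def d1_def d2_def
    by (rule E2, rule W4[OF Q] W4[OF alg_minus[OF Q]], rule N, simp, rule R, simp, rule Q5[OF Q] Q5[OF alg_minus[OF Q]], rule N, simp, simp)+
qed

section \<open>Bounds and derivatives of the generators\<close>

lemma BB_graded_bound: "graded_bound 0 1 BB"
  unfolding graded_bound_def
proof (intro exI[of _ 1] conjI allI impI)
  fix t and x :: "real^3" assume q: "(t, x) \<in> cyl"
  then have e: "0 < ee t" using ee_bounds by (simp add: in_cyl)
  have "1 / ((1 - x \<bullet> x)^2 + ee t) \<le> 1 / ee t" using e by (intro divide_left_mono mult_pos_pos add_nonneg_pos) auto
  then show "\<bar>BB (t, x)\<bar> \<le> 1 * (norm x powr - 0 * ee t powr - 1)"
    using q e BB_denominator_pos[OF q] by (simp add: BB_def in_cyl powr_minus_divide)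
qed simp

lemma BB_dclosed:
  assumes "(0, 1, BB) \<in> Gen" "r \<ge> 1"
  shows "dclosed Gen r 0 1 BB"
proof -
  have D: "(BB has_derivative (\<lambda>h. - ((BB q)^2) * ((1/100 - ee (fst q)) * fst h - 4 * (1 - snd q \<bullet> snd q) * (snd q \<bullet> snd h)))) (at q)"
    if q: "q \<in> cyl" for q
  proof -
    have "((\<lambda>q. ee (fst q)) has_derivative (\<lambda>h. (1 / 100 - ee (fst q)) * fst h)) (at q)"
      using time_has_derivative[OF ee_deriv, of "fst q" "snd q"] by simp
    moreover have "((\<lambda>q. (1 - snd q \<bullet> snd q)^2) has_derivative (\<lambda>h. - 2 * (1 - snd q \<bullet> snd q) * (2 * (snd q \<bullet> snd h)))) (at q)"
    proof -
      have "((\<lambda>s. (1 - s)^2) has_real_derivative - 2 * (1 - snd q \<bullet> snd q)) (at (snd q \<bullet> snd q))"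
        by (auto intro!: derivative_eq_intros)
      from radial_has_derivative[OF this, of "fst q"] show ?thesis by simp
    qed
    ultimately have "((\<lambda>q. (1 - snd q \<bullet> snd q)^2 + ee (fst q)) has_derivative
       (\<lambda>h. - 2 * (1 - snd q \<bullet> snd q) * (2 * (snd q \<bullet> snd h)) + (1 / 100 - ee (fst q)) * fst h)) (at q)"
      by (rule has_derivative_add[rotated])
    moreover have "((\<lambda>r. 1 / r) has_real_derivative - ((BB q)^2)) (at ((1 - snd q \<bullet> snd q)^2 + ee (fst q)))"
      using BB_denominator_pos[OF q] unfolding BB_def
      by (auto intro!: derivative_eq_intros simp: power2_eq_square)
    ultimately have "((\<lambda>q. 1 / ((1 - snd q \<bullet> snd q)^2 + ee (fst q))) has_derivative
       (\<lambda>h. (- 2 * (1 - snd q \<bullet> snd q) * (2 * (snd q \<bullet> snd h)) + (1 / 100 - ee (fst q)) * fst h) * - ((BB q)^2))) (at q)"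
      by (rule DERIV_compose_FDERIV[where f="\<lambda>r. 1 / r", rotated])
    then show ?thesis unfolding BB_def[abs_def] by (simp add: algebra_simps)
  qed
  note B = alg_gen[OF assms(1)]
  have B2: "alg Gen 0 2 (\<lambda>q. (BB q)^2)" using alg_power[OF B, of 2] by simp
  have "alg Gen (0 + 0) (2 + 0) (\<lambda>q. (BB q)^2 * (- (1/100 - ee (fst q))))"
    by (intro alg_mult B2) (intro alg00_intros)
  then have 1: "alg Gen 0 (1 + r) (\<lambda>q. (BB q)^2 * (- (1/100 - ee (fst q))))"
    by (rule alg_weaken) (use assms in auto)
  have "alg Gen (0 + 0) (2 + 0) (\<lambda>q. (BB q)^2 * (4 * (1 - snd q \<bullet> snd q) * snd q $ i))" for i
    by (intro alg_mult B2) (intro alg00_intros)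
  then have 2: "alg Gen (0 + 1) (1 + r) (\<lambda>q. (BB q)^2 * (4 * (1 - snd q \<bullet> snd q) * snd q $ i))" for i
    by (rule alg_weaken) (use assms in auto)
  show ?thesis
    by (rule dclosedI[where Fx="\<lambda>i q. (BB q)^2 * (4 * (1 - snd q \<bullet> snd q) * snd q $ i)", OF _ 1 _ 2])
      (use D in \<open>auto simp: differentiable_def dt_eq[OF D] dx_eq[OF D] inner_axis algebra_simps\<close>)
qed

lemma alg0_dclosed: "alg Gen0 p N F \<Longrightarrow> dclosed Gen0 1 p N F"
  by (rule alg_dclosed) (auto simp: Gen0_def intro!: BB_dclosed)

lemma Gr_pos: "q \<in> cyl \<Longrightarrow> 0 < L Gr q"
  and Gr_ge: "q \<in> cyl \<Longrightarrow> ee (fst q) * norm (snd q) powr (- (5 / 2)) / 100 \<le> L Gr q"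
proof -
  assume q: "q \<in> cyl"
  let ?s = "snd q \<bullet> snd q"
  have l: "1 + ee (fst q) * (sg ?s * ?s^2) / 100 \<le> L Gr q"
    unfolding L_def by (rule Gr_lower) (use cylD[OF q] in auto)
  have "sg ?s * ?s^2 = norm (snd q) powr (- (5 / 2))"
  proof -
    have "?s^2 = ?s powr 2" using cylD(2)[OF q] by (simp add: powr_numeral)
    then have "sg ?s * ?s^2 = ?s powr (- (5 / 4))" unfolding sg_def by (simp only: powr_add[symmetric]) simp
    also have "\<dots> = (norm (snd q) powr 2) powr (- (5 / 4))" by (simp add: dot_square_norm)
    also have "\<dots> = norm (snd q) powr (2 * (- (5 / 4)))" by (rule powr_powr)
    finally show ?thesis by simp
  qed
  with l have "1 + ee (fst q) * norm (snd q) powr (- (5 / 2)) / 100 \<le> L Gr q" by simp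
  moreover have "0 \<le> ee (fst q) * norm (snd q) powr (- (5 / 2)) / 100"
    using ee_bounds(1)[OF cylD(1)[OF q]] by simp
  ultimately show "0 < L Gr q" "ee (fst q) * norm (snd q) powr (- (5 / 2)) / 100 \<le> L Gr q" by linarith+
qed

lemma alg0_bound: "alg Gen0 p N F \<Longrightarrow> graded_bound p N F"
  by (rule alg_bound) (auto simp: Gen0_def BB_graded_bound)

lemma gg_graded_bound: "graded_bound (5 / 4) 5 gg"
proof -
  have "alg Gen0 (5 / 2) 5 (L Gr)" by (rule Gr_alg) (simp add: Gen0_def)
  then obtain C where C: "C \<ge> 0" "\<And>t x. (t, x) \<in> cyl \<Longrightarrow> \<bar>L Gr (t, x)\<bar> \<le> C * (norm x powr (- (5 / 2)) * ee t powr (- 5))"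
    using alg0_bound unfolding graded_bound_def by blast
  have "\<bar>gg (t, x)\<bar> \<le> sqrt C * (norm x powr (- (5 / 4)) * ee t powr (- 5))" if q: "(t, x) \<in> cyl" for t x
  proof -
    have e: "0 < ee t" "ee t \<le> 1" using q ee_bounds[of t] by (auto simp: in_cyl)
    have "norm x powr (- (5 / 2)) * ee t powr (- 5) \<le> norm x powr (- (5 / 2)) * ee t powr (- 10)"
      using e by (intro mult_left_mono powr_mono') auto
    then have "L Gr (t, x) \<le> C * (norm x powr (- (5 / 2)) * ee t powr (- 10))"
      using C(1) C(2)[OF q] by (meson abs_le_D1 mult_left_mono order_trans)
    also have "\<dots> = C * (norm x powr (- (5 / 4)) * ee t powr (- 5))^2"
      unfolding power2_eq_square by (simp add: powr_add[symmetric] mult_ac)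
    finally have "sqrt (L Gr (t, x)) \<le> sqrt (C * (norm x powr (- (5 / 4)) * ee t powr (- 5))^2)" by simp
    then show ?thesis using Gr_pos[OF q] by (simp add: gg_def real_sqrt_mult)
  qed
  then show ?thesis using C(1) unfolding graded_bound_def by (intro exI[of _ "sqrt C"]) auto
qed

text \<open>Rests on the quantitative bound \<open>Gr_ge\<close>. That \<open>gi\<close> vanishes at
  the origin to the order 5/4 lets a space derivative of \<open>gg\<close> lose only one power of
  \<open>norm x\<close>: \<open>7/2 - 5/4 = 5/4 + 1\<close>.\<close>

lemma gi_graded_bound: "graded_bound (- (5 / 4)) 1 gi"
  unfolding graded_bound_def
proof (intro exI[of _ 10] conjI allI impI)
  fix t and x :: "real^3" assume q: "(t, x) \<in> cyl"
  have e: "0 < ee t" "ee t \<le> 1" and x: "0 < norm x" using q ee_bounds[of t] by (auto simp: in_cyl)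
  have "ee t powr 2 \<le> ee t" using powr_mono'[of 1 2 "ee t"] e by simp
  then have "ee t powr 2 * norm x powr (- (5 / 2)) \<le> ee t * norm x powr (- (5 / 2))" by (intro mult_right_mono) auto
  moreover have "ee t powr 2 * norm x powr (- (5 / 2)) = (ee t * norm x powr (- (5 / 4)))^2"
    using e by (simp add: power2_eq_square powr_add[symmetric] mult_ac)
  ultimately have "(ee t * norm x powr (- (5 / 4)) / 10)^2 \<le> L Gr (t, x)"
    using Gr_ge[OF q] by (simp add: power_divide)
  then have "ee t * norm x powr (- (5 / 4)) / 10 \<le> sqrt (L Gr (t, x))" by (rule real_le_rsqrt)
  moreover have p: "0 < ee t * norm x powr (- (5 / 4)) / 10" using e x by simp
  ultimately have "1 / sqrt (L Gr (t, x)) \<le> 1 / (ee t * norm x powr (- (5 / 4)) / 10)"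
    using Gr_pos[OF q] by (intro divide_left_mono mult_pos_pos) auto
  also have "\<dots> = 10 * (norm x powr (5 / 4) * ee t powr (- 1))"
    using e x by (simp add: powr_minus_divide)
  finally show "\<bar>gi (t, x)\<bar> \<le> 10 * (norm x powr - (- (5 / 4)) * ee t powr - 1)"
    using Gr_pos[OF q] by (simp add: gi_def)
qed simp

lemma Gr_partials:
  shows "q \<in> cyl \<Longrightarrow> L Gr differentiable (at q)" "alg Gen1 (5 / 2) 6 (dt (L Gr))" "alg Gen1 (7 / 2) 6 (dx i (L Gr))"
proof -
  have "dclosed Gen0 1 (5 / 2) 5 (L Gr)" by (intro alg0_dclosed Gr_alg) (simp add: Gen0_def)
  then show "q \<in> cyl \<Longrightarrow> L Gr differentiable (at q)" "alg Gen1 (5 / 2) 6 (dt (L Gr))" "alg Gen1 (7 / 2) 6 (dx i (L Gr))"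
    using alg_mono[of Gen0 _ _ _ Gen1] unfolding dclosed_def Gen0_def Gen1_def by simp_all
qed

lemma gg_has_derivative:
  assumes q: "q \<in> cyl"
  shows "(gg has_derivative (\<lambda>h. 1 / 2 * gi q * frechet_derivative (L Gr) (at q) h)) (at q)"
    and "(gi has_derivative (\<lambda>h. - (1 / 2) * gi q ^ 3 * frechet_derivative (L Gr) (at q) h)) (at q)"
proof -
  have D: "(L Gr has_derivative frechet_derivative (L Gr) (at q)) (at q)"
    using Gr_partials(1)[OF q] by (simp add: frechet_derivative_works)
  have p: "L Gr q > 0" by (rule Gr_pos[OF q])
  have "(sqrt has_real_derivative gi q / 2) (at (L Gr q))"
    using p unfolding gi_def by (auto intro!: derivative_eq_intros simp: inverse_eq_divide)
  from DERIV_compose_FDERIV[OF this D]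
  show "(gg has_derivative (\<lambda>h. 1 / 2 * gi q * frechet_derivative (L Gr) (at q) h)) (at q)"
    unfolding gg_def[abs_def] by (simp add: mult_ac)
  have "((\<lambda>r. 1 / sqrt r) has_real_derivative - (1 / 2) * gi q ^ 3) (at (L Gr q))"
  proof -
    have "((\<lambda>r. 1 / sqrt r) has_real_derivative (0 * sqrt (L Gr q) - 1 * (inverse (sqrt (L Gr q)) / 2)) / (sqrt (L Gr q) * sqrt (L Gr q))) (at (L Gr q))"
      by (rule DERIV_divide[OF DERIV_const DERIV_real_sqrt]) (use p in auto)
    then show ?thesis by (simp add: gi_def power3_eq_cube inverse_eq_divide mult_ac)
  qed
  from DERIV_compose_FDERIV[OF this D]
  show "(gi has_derivative (\<lambda>h. - (1 / 2) * gi q ^ 3 * frechet_derivative (L Gr) (at q) h)) (at q)"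
    unfolding gi_def[abs_def] by (simp add: mult_ac)
qed

text \<open>The price 8 of a derivative is dictated by \<open>gi\<close>: the product of
  \<open>gi^3\<close> and a derivative of \<open>L Gr\<close> has grade
  \<open>3 + 6 = 1 + 8\<close>.\<close>

lemma gg_dclosed: "dclosed Gen1 8 (5 / 4) 5 gg" and gi_dclosed: "dclosed Gen1 8 (- (5 / 4)) 1 gi"
proof -
  have gi: "alg Gen1 (- (5 / 4)) 1 gi" by (rule alg_gen) (simp add: Gen1_def)
  then have gi3: "alg Gen1 (- (15 / 4)) 3 (\<lambda>q. gi q ^ 3)" using alg_power[OF gi, of 3] by simp
  have 1: "alg Gen1 (5 / 4) (5 + 8) (\<lambda>q. 1 / 2 * (gi q * dt (L Gr) q))"
    by (rule alg_cmult, rule alg_weaken[OF alg_mult[OF gi Gr_partials(2)]]) auto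
  have 2: "alg Gen1 (5 / 4 + 1) (5 + 8) (\<lambda>q. 1 / 2 * (gi q * dx i (L Gr) q))" for i
    by (rule alg_cmult, rule alg_weaken[OF alg_mult[OF gi Gr_partials(3)]]) auto
  show "dclosed Gen1 8 (5 / 4) 5 gg"
    by (rule dclosedI[where Fx="\<lambda>i q. 1 / 2 * (gi q * dx i (L Gr) q)", OF _ 1 _ 2])
      (auto simp: differentiable_def dt_eq[OF gg_has_derivative(1)] dx_eq[OF gg_has_derivative(1)] dt_def[of "L Gr"] dx_def[of _ "L Gr"]
        intro: gg_has_derivative)
  have 3: "alg Gen1 (- (5 / 4)) (1 + 8) (\<lambda>q. - (1 / 2) * (gi q ^ 3 * dt (L Gr) q))"
    by (rule alg_cmult, rule alg_weaken[OF alg_mult[OF gi3 Gr_partials(2)]]) auto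
  have 4: "alg Gen1 (- (5 / 4) + 1) (1 + 8) (\<lambda>q. - (1 / 2) * (gi q ^ 3 * dx i (L Gr) q))" for i
    by (rule alg_cmult, rule alg_weaken[OF alg_mult[OF gi3 Gr_partials(3)]]) auto
  show "dclosed Gen1 8 (- (5 / 4)) 1 gi"
    by (rule dclosedI[where Fx="\<lambda>i q. - (1 / 2) * (gi q ^ 3 * dx i (L Gr) q)", OF _ 3 _ 4])
      (auto simp: differentiable_def dt_eq[OF gg_has_derivative(2)] dx_eq[OF gg_has_derivative(2)] dt_def[of "L Gr"] dx_def[of _ "L Gr"]
        intro: gg_has_derivative)
qed

lemma BB_Gen1: "(0, 1, BB) \<in> Gen1"
  by (simp add: Gen1_def)

lemma Gen1_cases:
  assumes "(p, N, F) \<in> Gen1" "P 0 1 BB" "P (5/4) 5 gg" "P (- (5/4)) 1 gi"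
  shows "P p N F"
  using assms unfolding Gen1_def by (elim insertE emptyE) (simp_all only: prod.inject)

lemma alg1_dclosed: "alg Gen1 p N F \<Longrightarrow> dclosed Gen1 8 p N F"
  by (rule alg_dclosed, simp, erule Gen1_cases[where P="dclosed Gen1 8"])
    (simp_all add: gg_dclosed gi_dclosed BB_dclosed BB_Gen1)

lemma alg1_bound: "alg Gen1 p N F \<Longrightarrow> graded_bound p N F"
  by (rule alg_bound, erule Gen1_cases[where P=graded_bound])
    (simp_all add: BB_graded_bound gg_graded_bound gi_graded_bound)

lemma alg1_tame1: "alg Gen1 p N F \<Longrightarrow> N \<le> - 8 \<Longrightarrow> tame1 p F"
  by (rule alg_imp_tame1[OF alg1_bound alg1_dclosed]) auto

lemma alg1_differentiable: "alg Gen1 p N F \<Longrightarrow> q \<in> cyl \<Longrightarrow> F differentiable (at q)"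
  and alg1_dx: "alg Gen1 p N F \<Longrightarrow> alg Gen1 (p + 1) (N + 8) (dx i F)"
  using alg1_dclosed unfolding dclosed_def by blast+

section \<open>The flow\<close>

lemma L_dx:
  assumes q: "q \<in> cyl" and D: "L f differentiable (at q)"
    and f: "(f (fst q) has_real_derivative f') (at (snd q \<bullet> snd q))"
  shows "dx i (L f) q = 2 * snd q $ i * f'"
proof -
  obtain t x where tx: "q = (t, x)" by (cases q)
  have g: "((\<lambda>r. (x + r *\<^sub>R axis i 1) \<bullet> (x + r *\<^sub>R axis i 1)) has_real_derivative 2 * x $ i) (at (0::real))"
    by (auto intro!: derivative_eq_intros simp: inner_axis inner_axis' algebra_simps)
  have "((\<lambda>r. L f (t, x + r *\<^sub>R axis i 1)) has_real_derivative f' * (2 * x $ i)) (at 0)"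
    unfolding L_def fst_conv snd_conv by (rule DERIV_chain2[OF _ g]) (use f in \<open>simp add: tx\<close>)
  moreover have "((\<lambda>r. L f (t, x + r *\<^sub>R axis i 1)) has_real_derivative dx i (L f) (t, x)) (at 0)"
    using slice_DERIV D tx by blast
  ultimately show ?thesis using DERIV_unique by (fastforce simp: tx)
qed

lemma L_dt:
  assumes q: "q \<in> cyl" and D: "L f differentiable (at q)"
    and f: "((\<lambda>t. f t (snd q \<bullet> snd q)) has_real_derivative f') (at (fst q))"
  shows "dt (L f) q = f'"
proof -
  obtain t x where tx: "q = (t, x)" by (cases q)
  have "((\<lambda>r. L f (r, x)) has_real_derivative f') (at t)" using f by (simp add: L_def tx)
  moreover have "((\<lambda>r. L f (r, x)) has_real_derivative dt (L f) (t, x)) (at t)"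
    using time_DERIV D tx by blast
  ultimately show ?thesis using DERIV_unique by (fastforce simp: tx)
qed

lemmas a_alg1 = a_alg[OF BB_Gen1]

lemma a_differentiable:
  assumes "q \<in> cyl"
  shows "L a0 differentiable (at q)" "L a1 differentiable (at q)" "L a2 differentiable (at q)" "L a3 differentiable (at q)"
    "L a4 differentiable (at q)" "L d0 differentiable (at q)" "L d1 differentiable (at q)" "L d2 differentiable (at q)"
  using a_alg1[THEN alg1_differentiable, OF assms] by auto

lemma a_dx:
  assumes "q \<in> cyl"
  shows "dx i (L a0) q = 2 * snd q $ i * L a1 q" "dx i (L a1) q = 2 * snd q $ i * L a2 q"
    "dx i (L a2) q = 2 * snd q $ i * L a3 q" "dx i (L a3) q = 2 * snd q $ i * L a4 q"
    "dx i (L d0) q = 2 * snd q $ i * L d1 q" "dx i (L d1) q = 2 * snd q $ i * L d2 q"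
  using a_DERIVs[OF cylD(1,2)[OF assms]] a_differentiable[OF assms]
  by (auto intro!: L_dx[OF assms, of _ "L _ q", unfolded L_def] simp: L_def[abs_def])

lemma a_dt:
  assumes "q \<in> cyl"
  shows "dt (L a0) q = L d0 q" "dt (L a1) q = L d1 q" "dt (L a2) q = L d2 q"
  using a_time_DERIVs[OF cylD(1)[OF assms]] a_differentiable[OF assms]
  by (auto intro!: L_dt[OF assms, of _ "L _ q", unfolded L_def] simp: L_def[abs_def])

section \<open>The explicit fields and their pointwise equations\<close>

abbreviation X1 :: "spacetime \<Rightarrow> real" where "X1 q \<equiv> snd q $ 1"
abbreviation X2 :: "spacetime \<Rightarrow> real" where "X2 q \<equiv> snd q $ 2"
abbreviation X3 :: "spacetime \<Rightarrow> real" where "X3 q \<equiv> snd q $ 3"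

lemma snd_inner: "snd q \<bullet> snd q = X1 q * X1 q + X2 q * X2 q + X3 q * X3 q" for q :: spacetime
  by (simp add: inner_vec_def sum_3)

text \<open>If \<open>A\<close> is a function of \<open>t\<close> and \<open>s\<close>, and
  \<open>B\<close> is its derivative in \<open>s\<close>, this is the curl of
  \<open>x3 * A * (x2, - x1, 0)\<close>; hence it is solenoidal and has no swirl.\<close>

definition form :: "(spacetime \<Rightarrow> real) \<Rightarrow> (spacetime \<Rightarrow> real) \<Rightarrow> 3 \<Rightarrow> spacetime \<Rightarrow> real" where
  "form A B i q = (if i = 3 then (- 2) * (X3 q * (A q + B q * (X1 q * X1 q + X2 q * X2 q)))
     else snd q $ i * (A q + 2 * (B q * (X3 q * X3 q))))"

definition Wv :: "3 \<Rightarrow> spacetime \<Rightarrow> real" where "Wv = form (L a1) (L a2)"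

text \<open>The square root of \<open>Hr\<close>. The exponent 21 is \<open>5 + 8 + 8\<close>: the
  grade of \<open>gg\<close> and the price of two derivatives, so that second derivatives of
  \<open>u\<close> have bounds uniform in time. This determines the exponents 42 in
  \<open>Hr\<close> and 43 in the profile.\<close>

definition hh :: "spacetime \<Rightarrow> real" where "hh q = ee (fst q)^21 * ((1 - snd q \<bullet> snd q) * gg q)"

definition rot :: "3 \<Rightarrow> spacetime \<Rightarrow> real" where
  "rot i q = (if i = 1 then - X2 q else if i = 2 then X1 q else 0)"

definition Wu :: "3 \<Rightarrow> spacetime \<Rightarrow> real" where "Wu i q = hh q * rot i q"

text \<open>With \<open>R = x1^2 + x2^2\<close>, the third component of the heat operator on
  \<open>v\<close> is \<open>- 2 * x3 * (j1 + R * j2)\<close>, and \<open>j0 + R * j1\<close> has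
  the opposite derivative in \<open>x3\<close>. The summand with 24 does not depend on
  \<open>x3\<close> and yields the 48 in \<open>Hr\<close>.\<close>

definition PI :: "spacetime \<Rightarrow> real" where
  "PI q = L j0 q + (X1 q * X1 q + X2 q * X2 q) * (L j1 q + 24 * ee (fst q)^42)"

lemma neq3: "(1::3) \<noteq> 2" "(1::3) \<noteq> 3" "(2::3) \<noteq> 3" "(2::3) \<noteq> 1" "(3::3) \<noteq> 1" "(3::3) \<noteq> 2"
  by auto

lemma dx_minus: "F differentiable (at q) \<Longrightarrow> dx i (\<lambda>q. - F q) q = - dx i F q"
  and dt_minus: "F differentiable (at q) \<Longrightarrow> dt (\<lambda>q. - F q) q = - dt F q"
  using dx_mult[of "\<lambda>_. - 1" q F i] dt_mult[of "\<lambda>_. - 1" q F] by simp_all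

lemma dx_form:
  assumes q: "q \<in> cyl" and A: "A differentiable (at q)" "B differentiable (at q)"
    and d: "\<And>j. dx j A q = 2 * snd q $ j * B q" "\<And>j. dx j B q = 2 * snd q $ j * C q"
  shows "dx j (form A B i) q =
     (if i = 3 then (- 2) * ((if j = 3 then A q + B q * (X1 q * X1 q + X2 q * X2 q) else 0)
          + X3 q * (2 * snd q $ j * B q + 2 * snd q $ j * C q * (X1 q * X1 q + X2 q * X2 q) + (if j = 3 then 0 else B q * (2 * snd q $ j))))
      else (if i = j then A q + 2 * (B q * (X3 q * X3 q)) else 0)
          + snd q $ i * (2 * snd q $ j * B q + 2 * (2 * snd q $ j * C q * (X3 q * X3 q) + (if j = 3 then B q * (2 * X3 q) else 0))))"
  using exhaust_3[of i] exhaust_3[of j]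
  by (elim disjE; simp add: form_def[abs_def] dx_mult dx_add dx_minus A d coord_differentiable neq3; simp add: algebra_simps)

text \<open>The Laplacian commutes with the curl, and on a harmonic polynomial of degree 2 in three
  variables times \<open>f(s)\<close> it acts on the factor as
  \<open>4 * s * f'' + 2 * (3 + 2 * 2) * f'\<close>. The second argument is the derivative of the
  first, whence \<open>18 = 14 + 4\<close>.\<close>

lemma laplacian_form:
  assumes q: "q \<in> cyl" and A: "\<And>q. q \<in> cyl \<Longrightarrow> A differentiable (at q)" "\<And>q. q \<in> cyl \<Longrightarrow> B differentiable (at q)"
      "\<And>q. q \<in> cyl \<Longrightarrow> C differentiable (at q)"
    and d: "\<And>j q. q \<in> cyl \<Longrightarrow> dx j A q = 2 * snd q $ j * B q" "\<And>j q. q \<in> cyl \<Longrightarrow> dx j B q = 2 * snd q $ j * C q"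
      "\<And>j q. q \<in> cyl \<Longrightarrow> dx j C q = 2 * snd q $ j * E q"
  shows "(\<Sum>j\<in>UNIV. dx j (dx j (form A B i)) q) =
     form (\<lambda>q. 4 * (snd q \<bullet> snd q) * C q + 14 * B q) (\<lambda>q. 4 * (snd q \<bullet> snd q) * E q + 18 * C q) i q"
proof -
  have e: "dx j (dx j (form A B i)) q = dx j (\<lambda>q. if i = 3 then (- 2) * ((if j = 3 then A q + B q * (X1 q * X1 q + X2 q * X2 q) else 0)
          + X3 q * (2 * snd q $ j * B q + 2 * snd q $ j * C q * (X1 q * X1 q + X2 q * X2 q) + (if j = 3 then 0 else B q * (2 * snd q $ j))))
      else (if i = j then A q + 2 * (B q * (X3 q * X3 q)) else 0)
          + snd q $ i * (2 * snd q $ j * B q + 2 * (2 * snd q $ j * C q * (X3 q * X3 q) + (if j = 3 then B q * (2 * X3 q) else 0)))) q" for j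
    by (rule dx_cong[OF q]) (rule dx_form; simp add: A d)
  show ?thesis
    unfolding sum_3 e using exhaust_3[of i]
    by (elim disjE; simp add: dx_mult dx_add dx_diff dx_minus A[OF q] d[OF q] coord_differentiable neq3; simp add: form_def snd_inner neq3 algebra_simps)
qed

lemma Wv_laplacian:
  "q \<in> cyl \<Longrightarrow> (\<Sum>j\<in>UNIV. dx j (dx j (Wv i)) q) =
     form (\<lambda>q. 4 * (snd q \<bullet> snd q) * L a3 q + 14 * L a2 q) (\<lambda>q. 4 * (snd q \<bullet> snd q) * L a4 q + 18 * L a3 q) i q"
  unfolding Wv_def by (rule laplacian_form) (auto simp: a_differentiable a_dx)

lemma Wv_dt: "q \<in> cyl \<Longrightarrow> dt (Wv i) q = form (L d1) (L d2) i q"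
  using exhaust_3[of i] unfolding Wv_def
  by (elim disjE; simp add: form_def[abs_def] dt_mult dt_add dt_minus a_differentiable a_dt coord_differentiable neq3)

lemma Wv_div: "q \<in> cyl \<Longrightarrow> (\<Sum>i\<in>UNIV. dx i (Wv i) q) = 0"
  unfolding Wv_def sum_3
  by (subst (1 2 3) dx_form) (auto simp: a_differentiable a_dx neq3 algebra_simps)

lemma e42_dx:
  assumes "q \<in> cyl"
  shows "(\<lambda>q::spacetime. ee (fst q)^n) differentiable (at q)" "dx i (\<lambda>q. ee (fst q)^n) q = 0"
proof -
  have D: "((\<lambda>t. ee t^n) has_real_derivative real n * ((1 / 100 - ee t) * ee t ^ (n - Suc 0))) (at t)" for t
    using DERIV_power[OF ee_deriv, of n] by simp
  note T = time_has_derivative[OF D, of "fst q" "snd q", unfolded prod.collapse]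
  show "(\<lambda>q::spacetime. ee (fst q)^n) differentiable (at q)" using T differentiable_def by blast
  show "dx i (\<lambda>q. ee (fst q)^n) q = 0" using dx_eq[OF T] by simp
qed

lemma L_j:
  "L j0 = (\<lambda>q. L d0 q - 4 * (snd q \<bullet> snd q) * L a2 q - 10 * L a1 q)"
  "L j1 = (\<lambda>q. L d1 q - 4 * (snd q \<bullet> snd q) * L a3 q - 14 * L a2 q)"
  "L j2 = (\<lambda>q. L d2 q - 4 * (snd q \<bullet> snd q) * L a4 q - 18 * L a3 q)"
  by (auto simp: L_def j0_def j1_def j2_def fun_eq_iff)

lemma j_dx:
  assumes "q \<in> cyl"
  shows "L j0 differentiable (at q)" "L j1 differentiable (at q)"
    "dx i (L j0) q = 2 * snd q $ i * L j1 q" "dx i (L j1) q = 2 * snd q $ i * L j2 q"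
  using exhaust_3[of i] unfolding L_j snd_inner
  by (simp_all add: a_differentiable[OF assms] coord_differentiable, (elim disjE; simp add: dx_diff dx_mult dx_add
      a_differentiable[OF assms] a_dx[OF assms] coord_differentiable neq3; simp add: algebra_simps)+)

lemma PI_dx:
  assumes "q \<in> cyl"
  shows "dx i PI q = 2 * snd q $ i * L j1 q + (X1 q * X1 q + X2 q * X2 q) * (2 * snd q $ i * L j2 q)
      + (if i = 3 then 0 else 2 * snd q $ i * (L j1 q + 24 * ee (fst q)^42))"
  using exhaust_3[of i] unfolding PI_def[abs_def]
  by (elim disjE; simp add: dx_mult dx_add j_dx[OF assms] e42_dx[OF assms] coord_differentiable neq3; simp add: algebra_simps)

lemma Hr_L: "L Hr q = 2 * (snd q \<bullet> snd q) * L j2 q + 5 * L j1 q + 48 * ee (fst q)^42"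
  by (simp add: L_def Hr_def)

lemma hh_square: "q \<in> cyl \<Longrightarrow> hh q * hh q = L Hr q"
proof -
  assume q: "q \<in> cyl"
  have "gg q * gg q = L Gr q" using Gr_pos[OF q] by (simp add: gg_def)
  moreover have "hh q * hh q = ee (fst q)^42 * (1 - snd q \<bullet> snd q)^2 * (gg q * gg q)"
    unfolding hh_def power2_eq_square by (simp add: mult_ac power_add[symmetric])
  ultimately show ?thesis using Hr_eq[OF cylD(1)[OF q], of "snd q \<bullet> snd q"] by (simp add: L_def)
qed

lemma momentum_v:
  assumes q: "q \<in> cyl"
  shows "dt (Wv i) q - (\<Sum>j\<in>UNIV. dx j (dx j (Wv i)) q) + dx i PI q = (if i = 3 then 0 else hh q * hh q * snd q $ i)"
  using exhaust_3[of i]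
  unfolding Wv_dt[OF q] Wv_laplacian[OF q] PI_dx[OF q] hh_square[OF q] Hr_L
  by (elim disjE; simp add: form_def neq3 L_j snd_inner; simp add: algebra_simps)

section \<open>The swirl field and its convective term\<close>

lemma hh_alg: "alg Gen1 (5 / 4) (- 16) hh"
proof -
  have "alg Gen1 (0 + 5 / 4) (0 + 5) (\<lambda>q. (1 - snd q \<bullet> snd q) * gg q)"
    by (intro alg_mult) (intro alg00_intros, intro alg_gen, simp add: Gen1_def)
  from ee_part[OF this, of 21] show ?thesis unfolding hh_def[abs_def] by simp
qed

lemma rot_differentiable: "rot i differentiable (at q)"
  using exhaust_3[of i] by (elim disjE; simp add: rot_def[abs_def] coord_differentiable neq3)

lemma rot_alg: "alg Gen (- 1) 0 (rot i)"
  using exhaust_3[of i] alg_coord[of Gen] alg_minus[OF alg_coord[of Gen]]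
  by (elim disjE; simp add: rot_def[abs_def] neq3 alg_zero)

lemma dx_rot: "dx j (rot i) q = (if i = 1 \<and> j = 2 then - 1 else if i = 2 \<and> j = 1 then 1 else 0)"
  using exhaust_3[of i] exhaust_3[of j]
  by (elim disjE; simp add: rot_def[abs_def] dx_minus coord_differentiable neq3)

lemma hh_differentiable: "q \<in> cyl \<Longrightarrow> hh differentiable (at q)"
  by (rule alg1_differentiable[OF hh_alg])

text \<open>\<open>hh\<close> is constant along the orbits of the rotations about the third axis.\<close>

lemma hh_rot:
  assumes q: "q \<in> cyl" shows "(\<Sum>j\<in>UNIV. rot j q * dx j hh q) = 0"
proof -
  define \<gamma> where "\<gamma> r = (fst q, (\<chi> i. if i = 1 then X1 q * cos r - X2 q * sin r
      else if i = 2 then X1 q * sin r + X2 q * cos r else X3 q) :: real^3)" for r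
  have "((\<lambda>r. if i = 1 then X1 q * cos r - X2 q * sin r
      else if i = 2 then X1 q * sin r + X2 q * cos r else X3 q) has_derivative (\<lambda>r. r * rot i q)) (at 0)" for i :: 3
    using exhaust_3[of i]
    by (elim disjE; simp add: rot_def neq3; auto intro!: derivative_eq_intros)
  then have "(\<gamma> has_derivative (\<lambda>r. (0, \<chi> i. r * rot i q))) (at 0)"
    unfolding \<gamma>_def by (intro has_derivative_Pair has_derivative_const has_derivative_vec_lambda_at)
  moreover have "\<gamma> 0 = q" unfolding \<gamma>_def by (cases q) (auto simp: vec_eq_iff forall_3)
  ultimately have "((\<lambda>r. hh (\<gamma> r)) has_derivative (\<lambda>r. frechet_derivative hh (at q) (0, \<chi> i. r * rot i q))) (at 0)"
    using has_derivative_compose[of \<gamma> _ 0 UNIV hh] hh_differentiable[OF q] frechet_derivative_works by metis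
  moreover have "hh (\<gamma> r) = hh q" for r
  proof -
    have "snd (\<gamma> r) \<bullet> snd (\<gamma> r) = (X1 q * cos r - X2 q * sin r)^2 + (X1 q * sin r + X2 q * cos r)^2 + X3 q * X3 q"
      by (simp add: inner_vec_def sum_3 \<gamma>_def neq3 power2_eq_square)
    also have "\<dots> = (X1 q * X1 q + X2 q * X2 q) * ((sin r)^2 + (cos r)^2) + X3 q * X3 q" by algebra
    finally have "snd (\<gamma> r) \<bullet> snd (\<gamma> r) = snd q \<bullet> snd q" by (simp add: snd_inner)
    moreover have "fst (\<gamma> r) = fst q" by (simp add: \<gamma>_def)
    ultimately show ?thesis by (simp add: hh_def gg_def L_def)
  qed
  ultimately have "((\<lambda>r::real. hh q) has_derivative (\<lambda>r. frechet_derivative hh (at q) (0, \<chi> i. r * rot i q))) (at 0)" by simp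
  then have "(\<lambda>r::real. frechet_derivative hh (at q) (0, \<chi> i. r * rot i q)) = (\<lambda>r. 0)"
    using has_derivative_unique has_derivative_const by blast
  then have "frechet_derivative hh (at q) (0, \<chi> i. 1 * rot i q) = 0" by metis
  then show ?thesis using frechet_derivative_dt_dx[OF hh_differentiable[OF q], of "(0, \<chi> i. 1 * rot i q)"]
    by (simp add: mult.commute)
qed

lemma Wu_dx: "q \<in> cyl \<Longrightarrow> dx j (Wu i) q = dx j hh q * rot i q + hh q * dx j (rot i) q"
  unfolding Wu_def[abs_def] by (rule dx_mult[OF hh_differentiable rot_differentiable])

lemma Wu_div: "q \<in> cyl \<Longrightarrow> (\<Sum>i\<in>UNIV. dx i (Wu i) q) = 0"
  using hh_rot[of q] by (simp add: Wu_dx sum_3 dx_rot neq3 mult.commute)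

text \<open>As \<open>hh\<close> is constant along \<open>rot\<close>, only the rotation itself is
  differentiated, and this leaves the centripetal acceleration \<open>- (x1, x2, 0)\<close> times
  \<open>hh^2\<close>.\<close>

lemma Wu_convection:
  assumes q: "q \<in> cyl"
  shows "(\<Sum>j\<in>UNIV. dx j (Wu i) q * Wu j q) = (if i = 3 then 0 else - (hh q * hh q * snd q $ i))"
proof -
  have "(\<Sum>j\<in>UNIV. dx j (Wu i) q * Wu j q) = rot i q * hh q * (\<Sum>j\<in>UNIV. rot j q * dx j hh q) + hh q * hh q * (\<Sum>j\<in>UNIV. dx j (rot i) q * rot j q)"
    unfolding Wu_dx[OF q] Wu_def sum_3 by algebra
  also have "(\<Sum>j\<in>UNIV. dx j (rot i) q * rot j q) = (if i = 3 then 0 else - snd q $ i)"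
    using exhaust_3[of i] by (elim disjE; simp add: sum_3 dx_rot rot_def neq3)
  finally show ?thesis using hh_rot[OF q] by simp
qed

lemma momentum_pointwise:
  assumes q: "q \<in> cyl"
  shows "dt (Wv i) q - (\<Sum>j\<in>UNIV. dx j (dx j (Wv i)) q) + dx i PI q = - (\<Sum>j\<in>UNIV. dx j (Wu i) q * Wu j q)"
  unfolding momentum_v[OF q] Wu_convection[OF q] by simp

lemma form_alg:
  assumes "alg Gen (p + 1) N A" "alg Gen (p + 3) N B"
  shows "alg Gen p N (form A B i)"
proof -
  have x: "alg Gen (- 1) 0 (\<lambda>q. snd q $ j)" for j by (rule alg_coord)
  have xx: "alg Gen (- 2) 0 (\<lambda>q. snd q $ j * snd q $ j)" for j using alg_mult[OF x x, of j j] by simp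
  have B1: "alg Gen (p + 1) N (\<lambda>q. B q * (X1 q * X1 q + X2 q * X2 q))" "alg Gen (p + 1) N (\<lambda>q. 2 * (B q * (X3 q * X3 q)))"
    using alg_mult[OF assms(2) alg_add[OF xx xx], of 1 2] alg_cmult[OF alg_mult[OF assms(2) xx], of 2 3] by (simp_all add: add.commute[of p])
  have "alg Gen p N (\<lambda>q. X3 q * (A q + B q * (X1 q * X1 q + X2 q * X2 q)))"
    using alg_mult[OF x alg_add[OF assms(1) B1(1)], of 3] by simp
  moreover have "alg Gen p N (\<lambda>q. snd q $ i * (A q + 2 * (B q * (X3 q * X3 q))))"
    using alg_mult[OF x alg_add[OF assms(1) B1(2)], of i] by simp
  ultimately show ?thesis
    unfolding form_def[abs_def] using alg_cmult[of Gen p N _ "- 2"] by (cases "i = 3") auto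
qed

lemma Wv_alg: "alg Gen1 (- (1 / 2)) (- 38) (Wv i)"
  unfolding Wv_def using a_alg1 by (intro form_alg) auto

lemma Wu_alg: "alg Gen1 (1 / 4) (- 16) (Wu i)"
  using alg_mult[OF hh_alg rot_alg, of i] by (simp add: Wu_def[abs_def])

lemma PI_alg: "alg Gen1 (1 / 2) (- 38) PI"
proof -
  have s: "alg Gen1 (- 2) 0 (\<lambda>q::spacetime. snd q \<bullet> snd q)" using alg_s_power[of Gen1 1] by simp
  have x: "alg Gen1 (- 1) 0 (\<lambda>q. snd q $ j)" for j by (rule alg_coord)
  have xx: "alg Gen1 (- 2) 0 (\<lambda>q. X1 q * X1 q + X2 q * X2 q)" using alg_mult[OF x x] by (intro alg_add) simp_all
  have j0: "alg Gen1 (1 / 2) (- 38) (L j0)" unfolding L_j mult.assoc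
    by (intro alg_diff alg_cmult a_alg1 alg_weaken[OF a_alg1(6)])
      (use alg_mult[OF s a_alg1(3)] in simp_all)
  have j1: "alg Gen1 (5 / 2) (- 38) (L j1)" unfolding L_j mult.assoc
    by (intro alg_diff alg_cmult a_alg1 alg_weaken[OF a_alg1(7)])
      (use alg_mult[OF s a_alg1(4)] in simp_all)
  have "alg Gen1 (5 / 2) (- 38) (\<lambda>q. 24 * ee (fst q)^42)"
    by (intro alg_cmult, rule alg_weaken[OF alg_ee_power]) auto
  from alg_mult[OF xx alg_add[OF j1 this]]
  have "alg Gen1 (1 / 2) (- 38) (\<lambda>q. (X1 q * X1 q + X2 q * X2 q) * (L j1 q + 24 * ee (fst q) ^ 42))" by simp
  from alg_add[OF j0 this] show ?thesis unfolding PI_def[abs_def] .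
qed

section \<open>Weak formulations\<close>

lemma half_cylinder_integral:
  assumes F: "tame p F" and T: "\<And>q. q \<in> cyl \<Longrightarrow> T \<le> fst q \<Longrightarrow> F q = 0"
  shows "(LINT q:{0<..} \<times> ball 0 1|lebesgue. zcut F q) = slab_integral T F"
proof -
  have o: "open ({0<..} \<times> ball 0 1 :: spacetime set)" by (intro open_Times) auto
  have e: "indicator ({0<..} \<times> ball 0 1) q *\<^sub>R zcut F q = indicator (slab T) q * zcut F q" for q
    using T[of q] by (cases "q \<in> cyl"; cases q) (auto simp: indicator_def)
  show ?thesis
    using lebesgue_set_integrable_iff(2)[OF tame_zcut_measurable[OF F], of "{0<..} \<times> ball 0 1"] o
    unfolding e by (simp add: slab_integral_def)
qed

lemma partial_derivatives_late:
  fixes \<phi> :: "spacetime \<Rightarrow> real" and q :: spacetime and T :: real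
  assumes "\<And>q. T < fst q \<Longrightarrow> \<phi> q = 0" "T < fst q"
  shows "dt \<phi> q = 0" "dx i \<phi> q = 0"
proof -
  have "open {q::spacetime. T < fst q}" by (intro open_Collect_less continuous_intros)
  from frechet_derivative_cong_open[OF this, of q \<phi> "\<lambda>_. 0"] assms
  have "frechet_derivative \<phi> (at q) = (\<lambda>_. 0)" by simp
  then show "dt \<phi> q = 0" "dx i \<phi> q = 0" by (simp_all add: dt_def dx_def)
qed

text \<open>The difference of the two integrands is the space-time divergence of
  \<open>(P0, X)\<close>, and the slice at time \<open>S\<close> lies beyond the support of the test
  function. The flux contains first derivatives of \<open>w\<close> and the pressure;
  \<open>p < 1\<close> and \<open>r < 2\<close> keep its order below 2.\<close>

lemma momentum_eq_vfield:
  fixes p r s :: real and w F :: "3 \<Rightarrow> spacetime \<Rightarrow> real"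
  assumes w: "\<And>i. tame1 p (w i)" "\<And>i j. tame1 (p + 1) (dx j (w i))" and p: "0 \<le> p" "p < 1"
    and P: "tame1 r P" "0 \<le> r" "r < 2" and F: "\<And>i. tame s (F i)" "0 \<le> s" "s < 3"
    and eq: "\<And>i q. q \<in> cyl \<Longrightarrow> dt (w i) q - (\<Sum>j\<in>UNIV. dx j (dx j (w i)) q) + dx i P q = F i q"
  shows "momentum_eq ({0<..} \<times> ball 0 1) (vfield w) (zcut P) (vfield F)"
  unfolding momentum_eq_def
proof (intro conjI allI impI)
  show "locally_integrable_on ({0<..} \<times> ball 0 1) (vfield w)"
    by (rule vfield_locally_integrable[OF tame1D(1)[OF w(1)]]) (use p in simp)
  show "locally_integrable_on ({0<..} \<times> ball 0 1) (zcut P)"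
    by (rule tame_locally_integrable[OF tame1D(1)[OF P(1)]]) (use P in simp)
  show "locally_integrable_on ({0<..} \<times> ball 0 1) (vfield F)"
    by (rule vfield_locally_integrable[OF F(1) F(3)])
  fix i and \<phi> :: "spacetime \<Rightarrow> real" assume \<phi>: "test_function ({0<..} \<times> ball 0 1) \<phi>"
  obtain t0 T \<rho> where T: "t0 > 0" "T > 0" "\<And>q. \<phi> q \<noteq> 0 \<Longrightarrow> t0 \<le> fst q \<and> fst q < T \<and> norm (snd q) \<le> \<rho>"
    using test_function_support[OF \<phi> order_refl] by metis
  \<comment> \<open>One unit beyond the support, so that the test function vanishes near every time
    from \<open>S\<close> on and its derivatives vanish with it.\<close>
  define S where "S = T + 1"
  have S: "S > 0" using T(2) by (simp add: S_def)
  have z: "\<phi> q = 0" "dt \<phi> q = 0" "dx j \<phi> q = 0" "dx j (dx j \<phi>) q = 0" if "S \<le> fst q" for q j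
  proof -
    have 0: "\<phi> q = 0" if "T < fst q" for q using T(3)[of q] that by fastforce
    note 1 = partial_derivatives_late[of T \<phi>, OF 0]
    show "\<phi> q = 0" "dt \<phi> q = 0" "dx j \<phi> q = 0" "dx j (dx j \<phi>) q = 0"
      using that by (auto simp: S_def intro!: 0 1 partial_derivatives_late(2)[of T, OF 1(2)])
  qed
  have \<phi>1: "tame1 0 \<phi>" "\<And>j. tame1 0 (dx j \<phi>)" "\<And>j. tame1 0 (dx j (dx j \<phi>))"
    by (rule test_function_tame1[OF \<phi>] test_function_tame1[OF test_function_dx[OF \<phi>]]
      test_function_tame1[OF test_function_dx[OF test_function_dx[OF \<phi>]]])+
  have lap: "tame 0 (laplacian \<phi>)" unfolding laplacian_def[abs_def] by (intro tame_sum tame1D(1) \<phi>1) auto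
  have sup: "supported \<phi>" "\<And>j. supported (dx j \<phi>)"
    by (rule test_function_supported[OF \<phi> order_refl] test_function_supported[OF test_function_dx[OF \<phi>] order_refl])+
  define A where "A q = - (w i q) * (dt \<phi> q + laplacian \<phi> q) - P q * dx i \<phi> q" for q
  define B where "B q = F i q * \<phi> q" for q
  define P0 where "P0 q = w i q * \<phi> q" for q
  define X where "X j q = w i q * dx j \<phi> q - dx j (w i) q * \<phi> q + (if j = i then P q * \<phi> q else 0)" for j q
  define m where "m = max (p + 1) r"
  have m: "p \<le> m" "p + 1 \<le> m" "r \<le> m" "0 \<le> m" "m < 2" using p P by (auto simp: m_def)
  have tA: "tame m A" unfolding A_def[abs_def]
  proof (rule tame_diff)
    show "tame m (\<lambda>q. - w i q * (dt \<phi> q + laplacian \<phi> q))"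
      by (rule tame_weaken[OF tame_mult[OF tame_minus[OF tame1D(1)[OF w(1)]] tame_add[OF tame1D(3)[OF \<phi>1(1)] lap]]]) (use m in simp)
    show "tame m (\<lambda>q. P q * dx i \<phi> q)"
      by (rule tame_weaken[OF tame_mult[OF tame1D(1)[OF P(1)] tame1D(1)[OF \<phi>1(2)]]]) (use m in simp)
  qed
  have tB: "tame s B" unfolding B_def[abs_def] using tame_mult[OF F(1) tame1D(1)[OF \<phi>1(1)]] by simp
  have tP0: "tame1 m P0" unfolding P0_def[abs_def]
    by (rule tame1_weaken[OF tame1_mult[OF w(1) \<phi>1(1)]]) (use m in simp)
  have tX: "tame1 m (X j)" for j unfolding X_def[abs_def]
  proof (intro tame1_add tame1_diff)
    show "tame1 m (\<lambda>q. w i q * dx j \<phi> q)" by (rule tame1_weaken[OF tame1_mult[OF w(1) \<phi>1(2)]]) (use m in simp)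
    show "tame1 m (\<lambda>q. dx j (w i) q * \<phi> q)" by (rule tame1_weaken[OF tame1_mult[OF w(2) \<phi>1(1)]]) (use m in simp)
    show "tame1 m (\<lambda>q. if j = i then P q * \<phi> q else 0)"
      using tame1_weaken[OF tame1_mult[OF P(1) \<phi>1(1)], of m] tame1_weaken[OF tame1_const[of 0], of m] m by (cases "j = i") auto
  qed
  have "slab_integral S (\<lambda>q. B q - A q) = slice_integral S P0"
  proof (rule slab_divergence[where P=X])
    show "supported P0" unfolding P0_def[abs_def] by (intro supported_mult_left sup)
    show "supported (X j)" for j
    proof -
      have "supported (\<lambda>q. w i q * dx j \<phi> q - dx j (w i) q * \<phi> q + (if j = i then P q else 0) * \<phi> q)"
        by (intro supported_add supported_diff supported_mult_left sup)
      moreover have "X j = (\<lambda>q. w i q * dx j \<phi> q - dx j (w i) q * \<phi> q + (if j = i then P q else 0) * \<phi> q)"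
        by (auto simp: X_def)
      ultimately show ?thesis by simp
    qed
    show "B q - A q = dt P0 q + (\<Sum>j\<in>UNIV. dx j (X j) q)" if q: "q \<in> cyl" for q
    proof -
      note d = tame1D(2)[OF w(1) q] tame1D(2)[OF w(2) q] tame1D(2)[OF P(1) q] tame1D(2)[OF \<phi>1(1) q] tame1D(2)[OF \<phi>1(2) q]
      have "dx j (X j) q = w i q * dx j (dx j \<phi>) q - dx j (dx j (w i)) q * \<phi> q + (if j = i then dx i P q * \<phi> q + P q * dx i \<phi> q else 0)" for j
        unfolding X_def[abs_def] by (cases "j = i"; simp add: dx_add dx_diff dx_mult d; simp add: algebra_simps)
      then have "(\<Sum>j\<in>UNIV. dx j (X j) q) = w i q * laplacian \<phi> q - (\<Sum>j\<in>UNIV. dx j (dx j (w i)) q) * \<phi> q + (dx i P q * \<phi> q + P q * dx i \<phi> q)"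
        by (simp add: sum.distrib sum_subtractf sum_distrib_left sum_distrib_right laplacian_def)
      moreover have "dt P0 q = dt (w i) q * \<phi> q + w i q * dt \<phi> q" unfolding P0_def[abs_def] by (simp add: dt_mult d)
      ultimately show ?thesis unfolding A_def B_def eq[OF q, symmetric] by (simp add: algebra_simps)
    qed
  qed (use tP0 tX m S in auto)
  moreover have "slice_integral S P0 = 0"
  proof -
    have "zcut P0 (S, x) = 0" for x by (auto simp: zcut_def P0_def z)
    then show ?thesis by (simp add: slice_integral_def)
  qed
  moreover have "slab_integral S (\<lambda>q. B q - A q) = slab_integral S B - slab_integral S A"
  proof -
    have "slab_integral S (\<lambda>q. B q + (- 1) * A q) = slab_integral S B + slab_integral S (\<lambda>q. (- 1) * A q)"
      by (rule slab_integral_add[OF tame_weaken[OF tB] tame_weaken[OF tame_cmult[OF tA]], of "max m s"]) (use m F(3) in auto)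
    then show ?thesis by (simp only: slab_integral_cmult) simp
  qed
  moreover have "(LINT q:{0<..} \<times> ball 0 1|lebesgue. - (vfield w q $ i) * (dt \<phi> q + laplacian \<phi> q) - zcut P q * dx i \<phi> q) = slab_integral S A"
  proof -
    have "- (vfield w q $ i) * (dt \<phi> q + laplacian \<phi> q) - zcut P q * dx i \<phi> q = zcut A q" for q
      by (auto simp: zcut_def A_def vfield_def)
    then show ?thesis using half_cylinder_integral[OF tA, of S] z by (simp add: A_def laplacian_def)
  qed
  moreover have "(LINT q:{0<..} \<times> ball 0 1|lebesgue. vfield F q $ i * \<phi> q) = slab_integral S B"
  proof -
    have "vfield F q $ i * \<phi> q = zcut B q" for q by (auto simp: zcut_def B_def vfield_def)
    then show ?thesis using half_cylinder_integral[OF tB, of S] z by (simp add: B_def)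
  qed
  ultimately show "(LINT q:{0<..} \<times> ball 0 1|lebesgue. - (vfield w q $ i) * (dt \<phi> q + laplacian \<phi> q) - zcut P q * dx i \<phi> q)
      = (LINT q:{0<..} \<times> ball 0 1|lebesgue. vfield F q $ i * \<phi> q)" by simp
qed

lemma div_free_vfield:
  assumes w: "\<And>i. tame1 p (w i)" and p: "0 \<le> p" "p < 2"
    and div: "\<And>q. q \<in> cyl \<Longrightarrow> (\<Sum>i\<in>UNIV. dx i (w i) q) = 0"
  shows "div_free ({0<..} \<times> ball 0 1) (vfield w)"
  unfolding div_free_def
proof (intro allI impI)
  fix \<phi> :: "spacetime \<Rightarrow> real" assume \<phi>: "test_function ({0<..} \<times> ball 0 1) \<phi>"
  obtain t0 T \<rho> where T: "t0 > 0" "T > 0" "\<And>q. \<phi> q \<noteq> 0 \<Longrightarrow> t0 \<le> fst q \<and> fst q < T \<and> norm (snd q) \<le> \<rho>"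
    using test_function_support[OF \<phi> order_refl] by metis
  define S where "S = T + 1"
  have S: "S > 0" using T(2) by (simp add: S_def)
  have z: "dx j \<phi> q = 0" if "S \<le> fst q" for q j
    by (rule partial_derivatives_late(2)[of T]) (use T(3) that in \<open>fastforce simp: S_def\<close>)+
  have \<phi>1: "tame1 0 \<phi>" "\<And>j. tame1 0 (dx j \<phi>)" by (rule test_function_tame1[OF \<phi>] test_function_tame1[OF test_function_dx[OF \<phi>]])+
  have sup: "supported \<phi>" by (rule test_function_supported[OF \<phi> order_refl])
  define A where "A q = (\<Sum>i\<in>UNIV. w i q * dx i \<phi> q)" for q
  have tA: "tame p A" unfolding A_def[abs_def]
    using p tame_mult[OF tame1D(1)[OF w] tame1D(1)[OF \<phi>1(2)]] by (intro tame_sum) auto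
  have "slab_integral S A = slice_integral S (\<lambda>_. 0)"
  proof (rule slab_divergence[where P="\<lambda>i q. w i q * \<phi> q"])
    show "tame1 p (\<lambda>q. w i q * \<phi> q)" for i using tame1_mult[OF w \<phi>1(1)] by simp
    show "tame1 p (\<lambda>_. 0)" by (rule tame1_weaken[OF tame1_const]) (use p in simp)
    show "supported (\<lambda>q. w i q * \<phi> q)" for i by (intro supported_mult_left sup)
    show "supported (\<lambda>_. 0)" unfolding supported_def by (intro exI[of _ 1] conjI exI[of _ 0]) auto
    show "A q = dt (\<lambda>_. 0) q + (\<Sum>i\<in>UNIV. dx i (\<lambda>q. w i q * \<phi> q) q)" if q: "q \<in> cyl" for q
      using div[OF q] tame1D(2)[OF w q] tame1D(2)[OF \<phi>1(1) q]
      by (simp add: A_def dx_mult sum.distrib sum_distrib_right[symmetric])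
  qed (use p S in auto)
  then have "slab_integral S A = 0" by (simp add: slice_integral_def zcut_zero)
  moreover have "vfield w q \<bullet> grad \<phi> q = zcut A q" for q
    by (auto simp: zcut_def A_def vfield_def grad_def inner_vec_def)
  ultimately show "(LINT q:{0<..} \<times> ball 0 1|lebesgue. vfield w q \<bullet> grad \<phi> q) = 0"
    using half_cylinder_integral[OF tA, of S] z by (simp add: A_def)
qed

text \<open>The grade -1 leaves a factor \<open>ee t\<close>, which tends to 0 with
  \<open>t\<close>; the remaining factor is an integrable power of the norm.\<close>

lemma initial_value_vfield:
  assumes w: "\<And>i. alg Gen1 p (- 1) (w i)" and p: "p < 3"
  shows "initial_value (ball 0 1) (vfield w) (\<lambda>x. 0)"
  unfolding initial_value_def
proof (intro conjI exI[of _ "{}"] allI impI)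
  show "L2_on (ball 0 1) (\<lambda>x::real^3. 0::real^3)" by (simp add: L2_on_def set_borel_measurable_def)
  show "negligible ({} :: real set)" by simp
  fix \<psi> :: "real^3 \<Rightarrow> real^3" assume \<psi>: "test_function (ball 0 1) \<psi>"
  obtain M where M: "M \<ge> 0" "\<And>x. norm (\<psi> x) \<le> M" using test_function_bounded[OF \<psi>] by blast
  have "\<exists>C. C \<ge> 0 \<and> (\<forall>q\<in>cyl. \<bar>w i q\<bar> \<le> C * norm (snd q) powr (- p) * ee (fst q))" for i
  proof -
    obtain C where "C \<ge> 0" "\<And>t x. (t, x) \<in> cyl \<Longrightarrow> \<bar>w i (t, x)\<bar> \<le> C * (norm x powr (- p) * ee t powr (- (- 1)))"
      using alg1_bound[OF w, of i] unfolding graded_bound_def by blast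
    moreover have "ee (fst q) powr (- (- 1)) = ee (fst q)" if "q \<in> cyl" for q
      using that ee_bounds(1)[of "fst q"] by (cases q) (simp add: in_cyl)
    ultimately show ?thesis by (intro exI[of _ C]) (auto simp: mult.assoc)
  qed
  then obtain C where C: "\<And>i. C i \<ge> 0" "\<And>i q. q \<in> cyl \<Longrightarrow> \<bar>w i q\<bar> \<le> C i * norm (snd q) powr (- p) * ee (fst q)"
    by metis
  define K where "K = (\<Sum>i\<in>UNIV. C i) * M"
  define J where "J = (LINT x|lborel. indicator (ball 0 1) x * norm (x::real^3) powr (- p))"
  have iJ: "integrable lborel (\<lambda>x::real^3. indicator (ball 0 1) x * norm x powr (- p))"
    using integrable_norm_powr_ball[where 'a="real^3", of p] p by simp
  have "\<bar>LINT x:ball 0 1|lebesgue. vfield w (t, x) \<bullet> \<psi> x\<bar> \<le> K * ee t * J" if t: "t > 0" for t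
  proof -
    let ?h = "\<lambda>x. indicator (ball 0 1) x * (vfield w (t, x) \<bullet> \<psi> x)"
    have b: "\<bar>?h x\<bar> \<le> K * ee t * (indicator (ball 0 1) x * norm x powr (- p))" for x
    proof (cases "(t, x) \<in> cyl")
      case True
      then have x: "x \<in> ball 0 1" by (auto simp: in_cyl)
      have "norm (vfield w (t, x)) \<le> (\<Sum>i\<in>UNIV. \<bar>vfield w (t, x) $ i\<bar>)" by (rule norm_le_l1_cart)
      also have "\<dots> \<le> (\<Sum>i\<in>UNIV. C i * norm x powr (- p) * ee t)"
        by (intro sum_mono) (use C(2)[OF True] True in \<open>simp add: vfield_def zcut_def\<close>)
      finally have n: "norm (vfield w (t, x)) \<le> (\<Sum>i\<in>UNIV. C i) * (norm x powr (- p) * ee t)"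
        by (simp add: sum_distrib_right mult.assoc)
      have "\<bar>vfield w (t, x) \<bullet> \<psi> x\<bar> \<le> norm (vfield w (t, x)) * norm (\<psi> x)" by (rule Cauchy_Schwarz_ineq2)
      also have "\<dots> \<le> ((\<Sum>i\<in>UNIV. C i) * (norm x powr (- p) * ee t)) * M"
        by (rule mult_mono[OF n M(2)]) (use C(1) ee_bounds(1)[OF t] in \<open>auto intro!: mult_nonneg_nonneg sum_nonneg\<close>)
      finally show ?thesis using x by (simp add: K_def mult_ac)
    next
      case False
      then have "vfield w (t, x) = 0" by (simp add: vfield_def zcut_def vec_eq_iff)
      then show ?thesis using C(1) M(1) ee_bounds(1)[OF t] by (auto simp: K_def intro!: mult_nonneg_nonneg sum_nonneg)
    qed
    have "(LINT x:ball 0 1|lebesgue. vfield w (t, x) \<bullet> \<psi> x) = (LINT x|lebesgue. ?h x)"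
      by (simp add: set_lebesgue_integral_def)
    moreover have "\<bar>LINT x|lebesgue. ?h x\<bar> \<le> (LINT x|lebesgue. K * ee t * (indicator (ball 0 1) x * norm (x::real^3) powr (- p)))"
    proof (cases "integrable lebesgue ?h")
      case True
      have "\<bar>LINT x|lebesgue. ?h x\<bar> \<le> (LINT x|lebesgue. \<bar>?h x\<bar>)" by (rule integral_abs_bound)
      also have "\<dots> \<le> (LINT x|lebesgue. K * ee t * (indicator (ball 0 1) x * norm (x::real^3) powr (- p)))"
      proof (rule integral_mono)
        show "integrable lebesgue (\<lambda>x. \<bar>?h x\<bar>)" using integrable_abs[OF True] by simp
        show "integrable lebesgue (\<lambda>x::real^3. K * ee t * (indicator (ball 0 1) x * norm x powr (- p)))"
          by (intro integrable_mult_right) (use iJ borel_measurable_integrable[OF iJ] in \<open>simp add: integrable_completion\<close>)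
      qed (use b in simp)
      finally show ?thesis .
    next
      \<comment> \<open>Without integrability the integral is 0 by convention, and the bound is
        trivial.\<close>
      case False
      have "0 \<le> (LINT x|lebesgue. K * ee t * (indicator (ball 0 1) x * norm (x::real^3) powr (- p)))"
        by (rule integral_nonneg_AE) (use C(1) M(1) ee_bounds(1)[OF t] in \<open>auto simp: K_def intro!: mult_nonneg_nonneg sum_nonneg\<close>)
      then show ?thesis using False by (simp add: not_integrable_integral_eq)
    qed
    moreover have "(LINT x|lebesgue. indicator (ball 0 1) x * norm (x::real^3) powr (- p)) = J"
      using integral_completion[OF borel_measurable_integrable[OF iJ]] by (simp add: J_def)
    ultimately show ?thesis by simp
  qed
  then have "\<forall>\<^sub>F t in at 0 within {0<..}. norm (LINT x:ball 0 1|lebesgue. vfield w (t, x) \<bullet> \<psi> x) \<le> K * ee t * J"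
    by (auto simp: eventually_at_filter)
  moreover have "((\<lambda>t. K * ee t * J) \<longlongrightarrow> 0) (at 0 within {0<..})"
    unfolding ee_def by (auto intro!: tendsto_eq_intros)
  ultimately have "((\<lambda>t. LINT x:ball 0 1|lebesgue. vfield w (t, x) \<bullet> \<psi> x) \<longlongrightarrow> 0) (at 0 within {0<..})"
    by (rule Lim_null_comparison)
  then show "((\<lambda>t. LINT x:ball 0 1|lebesgue. vfield w (t, x) \<bullet> \<psi> x) \<longlongrightarrow> (LINT x:ball 0 1|lebesgue. 0 \<bullet> \<psi> x)) (at 0 within {0<..} - {})"
    by simp
qed

text \<open>The equation is multiplied by \<open>2 * \<phi> * w\<close>. With
  \<open>z = u - w\<close> the weight \<open>|w|^2 + 2 * (w \<bullet> z)\<close> is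
  \<open>m = 2 * (u \<bullet> w) - |w|^2\<close>, and the convective term obeys \<open>- 2 w \<cdot>
  (u \<cdot> \<nabla>) u = - (u \<cdot> \<nabla>) m + 2 z \<cdot> (u \<cdot> \<nabla>) w\<close>; as
  \<open>u\<close> is solenoidal, the first part is a divergence.\<close>

lemma energy_identity:
  assumes q: "q \<in> cyl" and w: "\<And>i. w i differentiable (at q)" "\<And>i j. dx j (w i) differentiable (at q)"
    and u: "\<And>i. u i differentiable (at q)" and P: "P differentiable (at q)"
    and \<phi>: "\<phi> differentiable (at q)" "\<And>j. dx j \<phi> differentiable (at q)"
    and div: "(\<Sum>i\<in>UNIV. dx i (w i) q) = 0" "(\<Sum>i\<in>UNIV. dx i (u i) q) = 0"
    and mom: "\<And>i. dt (w i) q - (\<Sum>j\<in>UNIV. dx j (dx j (w i)) q) + dx i P q = - (\<Sum>j\<in>UNIV. dx j (u i) q * u j q)"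
  shows "dt (\<lambda>q. (\<Sum>k\<in>UNIV. w k q * w k q) * \<phi> q) q
      + (\<Sum>i\<in>UNIV. dx i (\<lambda>q. (\<Sum>k\<in>UNIV. w k q * w k q) * dx i \<phi> q - \<phi> q * (\<Sum>k\<in>UNIV. 2 * (w k q * dx i (w k) q))
          + 2 * (P q * w i q) * \<phi> q + \<phi> q * ((\<Sum>k\<in>UNIV. 2 * (u k q * w k q) - w k q * w k q) * u i q)) q)
    = (\<Sum>k\<in>UNIV. w k q * w k q) * (dt \<phi> q + (\<Sum>i\<in>UNIV. dx i (dx i \<phi>) q))
      - 2 * (\<phi> q * (\<Sum>k\<in>UNIV. \<Sum>i\<in>UNIV. dx i (w k) q * dx i (w k) q))
      + (\<Sum>k\<in>UNIV. 2 * (u k q * w k q) - w k q * w k q) * (\<Sum>i\<in>UNIV. u i q * dx i \<phi> q)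
      + 2 * (\<phi> q * (\<Sum>k\<in>UNIV. (u k q - w k q) * (\<Sum>i\<in>UNIV. dx i (w k) q * u i q)))
      + 2 * P q * (\<Sum>i\<in>UNIV. w i q * dx i \<phi> q)"
proof -
  define n where "n q = (\<Sum>k\<in>UNIV. w k q * w k q)" for q
  define m where "m q = (\<Sum>k\<in>UNIV. 2 * (u k q * w k q) - w k q * w k q)" for q
  define g where "g i q = (\<Sum>k\<in>UNIV. 2 * (w k q * dx i (w k) q))" for i q
  have D: "n differentiable (at q)" "m differentiable (at q)" "g i differentiable (at q)" for i
    unfolding n_def[abs_def] m_def[abs_def] g_def[abs_def] sum_3 by (simp_all add: w u)
  have dn: "dt n q = (\<Sum>k\<in>UNIV. 2 * (w k q * dt (w k) q))" "dx i n q = g i q" for i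
    unfolding n_def[abs_def] g_def sum_3 by (simp_all add: dt_add dt_mult dx_add dx_mult w)
  have dm: "dx i m q = (\<Sum>k\<in>UNIV. 2 * (dx i (u k) q * w k q + u k q * dx i (w k) q) - 2 * (w k q * dx i (w k) q))" for i
    unfolding m_def[abs_def] sum_3 by (simp add: dx_add dx_diff dx_mult w u)
  have dg: "dx i (g i) q = (\<Sum>k\<in>UNIV. 2 * (dx i (w k) q * dx i (w k) q + w k q * dx i (dx i (w k)) q))" for i
    unfolding g_def[abs_def] sum_3 by (simp add: dx_add dx_mult w)
  have X: "dx i (\<lambda>q. n q * dx i \<phi> q - \<phi> q * g i q + 2 * (P q * w i q) * \<phi> q + \<phi> q * (m q * u i q)) q
    = n q * dx i (dx i \<phi>) q + 2 * P q * (w i q * dx i \<phi> q) + m q * (u i q * dx i \<phi> q)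
      + (2 * P q * dx i (w i) q + m q * dx i (u i) q) * \<phi> q
      + \<phi> q * (2 * (dx i P q * w i q) - dx i (g i) q + dx i m q * u i q)" for i
    by (simp add: dx_add dx_diff dx_mult D w u P \<phi> dn algebra_simps)
  have mom': "(\<Sum>k\<in>UNIV. 2 * (w k q * dt (w k) q)) + (\<Sum>i\<in>UNIV. 2 * (dx i P q * w i q) - dx i (g i) q + dx i m q * u i q)
    = 2 * (\<Sum>k\<in>UNIV. (u k q - w k q) * (\<Sum>i\<in>UNIV. dx i (w k) q * u i q))
      - 2 * (\<Sum>k\<in>UNIV. \<Sum>i\<in>UNIV. dx i (w k) q * dx i (w k) q)"
  proof -
    have mm: "dt (w i) q = (\<Sum>j\<in>UNIV. dx j (dx j (w i)) q) - dx i P q - (\<Sum>j\<in>UNIV. dx j (u i) q * u j q)" for i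
      using mom[of i] by simp
    show ?thesis unfolding dm dg mm sum_3 by (simp add: algebra_simps)
  qed
  have "dt (\<lambda>q. n q * \<phi> q) q = (\<Sum>k\<in>UNIV. 2 * (w k q * dt (w k) q)) * \<phi> q + n q * dt \<phi> q"
    by (simp add: dt_mult D \<phi> dn)
  moreover have "(\<Sum>i\<in>UNIV. dx i (\<lambda>q. n q * dx i \<phi> q - \<phi> q * g i q + 2 * (P q * w i q) * \<phi> q + \<phi> q * (m q * u i q)) q)
    = n q * (\<Sum>i\<in>UNIV. dx i (dx i \<phi>) q) + 2 * P q * (\<Sum>i\<in>UNIV. w i q * dx i \<phi> q) + m q * (\<Sum>i\<in>UNIV. u i q * dx i \<phi> q)
      + (2 * P q * (\<Sum>i\<in>UNIV. dx i (w i) q) + m q * (\<Sum>i\<in>UNIV. dx i (u i) q)) * \<phi> q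
      + \<phi> q * (\<Sum>i\<in>UNIV. 2 * (dx i P q * w i q) - dx i (g i) q + dx i m q * u i q)"
    unfolding X by (simp only: sum.distrib sum_distrib_left[symmetric] sum_distrib_right[symmetric])
  ultimately have "dt (\<lambda>q. n q * \<phi> q) q
      + (\<Sum>i\<in>UNIV. dx i (\<lambda>q. n q * dx i \<phi> q - \<phi> q * g i q + 2 * (P q * w i q) * \<phi> q + \<phi> q * (m q * u i q)) q)
    = n q * (dt \<phi> q + (\<Sum>i\<in>UNIV. dx i (dx i \<phi>) q)) + m q * (\<Sum>i\<in>UNIV. u i q * dx i \<phi> q)
      + 2 * P q * (\<Sum>i\<in>UNIV. w i q * dx i \<phi> q)
      + \<phi> q * ((\<Sum>k\<in>UNIV. 2 * (w k q * dt (w k) q)) + (\<Sum>i\<in>UNIV. 2 * (dx i P q * w i q) - dx i (g i) q + dx i m q * u i q))"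
    unfolding div by (simp only: algebra_simps mult_zero_right mult_zero_left add_0_left add_0_right)
  then show ?thesis
    unfolding mom' unfolding n_def m_def g_def by (simp only: algebra_simps)
qed

text \<open>Integration of \<open>energy_identity\<close> up to any time \<open>t\<close>. The
  fluxes \<open>X\<close> have order at most 1 at the origin, below the threshold 2, and the worst
  integrand \<open>B\<close> has order 2, below 3; so all integrals exist and no term is lost at the
  axis.\<close>

lemma local_energy_vfield:
  fixes w u z :: "3 \<Rightarrow> spacetime \<Rightarrow> real" and P :: "spacetime \<Rightarrow> real"
  assumes w: "\<And>i. tame1 0 (w i)" "\<And>i j. tame1 1 (dx j (w i))" and u: "\<And>i. tame1 (1 / 4) (u i)" and P: "tame1 (1 / 2) P"
    and div: "\<And>q. q \<in> cyl \<Longrightarrow> (\<Sum>i\<in>UNIV. dx i (w i) q) = 0" "\<And>q. q \<in> cyl \<Longrightarrow> (\<Sum>i\<in>UNIV. dx i (u i) q) = 0"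
    and mom: "\<And>i q. q \<in> cyl \<Longrightarrow>
      dt (w i) q - (\<Sum>j\<in>UNIV. dx j (dx j (w i)) q) + dx i P q = - (\<Sum>j\<in>UNIV. dx j (u i) q * u j q)"
  shows "local_energy_inequality (ball 0 1) (vfield (\<lambda>i q. u i q - w i q)) (vfield w) (mfield (\<lambda>i j. dx j (w i))) (zcut P)"
  unfolding local_energy_inequality_def
proof (intro allI impI AE_I2, elim conjE)
  fix T t :: real and \<phi> :: "spacetime \<Rightarrow> real"
  assume T: "T > 0" and t: "t \<in> {0<..T}" and \<phi>: "test_function ({0<..T} \<times> ball 0 1) \<phi>"
  have sub: "{0<..T} \<times> ball 0 1 \<subseteq> {0<..} \<times> ball (0::real^3) 1" by auto
  have \<phi>1: "tame1 0 \<phi>" "\<And>j. tame1 0 (dx j \<phi>)" "\<And>j. tame1 0 (dx j (dx j \<phi>))"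
    by (rule test_function_tame1[OF \<phi>] test_function_tame1[OF test_function_dx[OF \<phi>]]
      test_function_tame1[OF test_function_dx[OF test_function_dx[OF \<phi>]]])+
  have sup: "supported \<phi>" "\<And>j. supported (dx j \<phi>)"
    by (rule test_function_supported[OF \<phi> sub] test_function_supported[OF test_function_dx[OF \<phi>] sub])+
  define n where "n q = (\<Sum>k\<in>UNIV. w k q * w k q)" for q
  define m where "m q = (\<Sum>k\<in>UNIV. 2 * (u k q * w k q) - w k q * w k q)" for q
  define B where "B q = \<phi> q * (\<Sum>k\<in>UNIV. \<Sum>i\<in>UNIV. dx i (w k) q * dx i (w k) q)" for q
  define C where "C q = n q * (dt \<phi> q + (\<Sum>i\<in>UNIV. dx i (dx i \<phi>) q))" for q
  define E where "E q = m q * (\<Sum>i\<in>UNIV. u i q * dx i \<phi> q)" for q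
  define G where "G q = \<phi> q * (\<Sum>k\<in>UNIV. (u k q - w k q) * (\<Sum>i\<in>UNIV. dx i (w k) q * u i q))" for q
  define H where "H q = 2 * P q * (\<Sum>i\<in>UNIV. w i q * dx i \<phi> q)" for q
  define N where "N q = n q * \<phi> q" for q
  define X where "X i q = n q * dx i \<phi> q - \<phi> q * (\<Sum>k\<in>UNIV. 2 * (w k q * dx i (w k) q))
      + 2 * (P q * w i q) * \<phi> q + \<phi> q * (m q * u i q)" for i q
  have uw: "tame1 (1 / 4) (\<lambda>q. u k q * w k q)" "tame1 0 (\<lambda>q. w k q * w k q)" for k
    using tame1_mult[OF u w(1), of k k] tame1_mult[OF w(1) w(1), of k k] by simp_all
  have n: "tame1 0 n" unfolding n_def[abs_def] by (intro tame1_sum uw) auto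
  have m: "tame1 (1 / 4) m" unfolding m_def[abs_def]
    by (intro tame1_sum tame1_diff tame1_cmult uw tame1_weaken[OF uw(2)]) auto
  have N: "tame1 0 N" unfolding N_def[abs_def] using tame1_mult[OF n \<phi>1(1)] by simp
  have X: "tame1 1 (X i)" for i unfolding X_def[abs_def]
  proof (intro tame1_add tame1_diff)
    show "tame1 1 (\<lambda>q. n q * dx i \<phi> q)" by (rule tame1_weaken[OF tame1_mult[OF n \<phi>1(2)]]) simp
    have "tame1 1 (\<lambda>q. \<Sum>k\<in>UNIV. 2 * (w k q * dx i (w k) q))"
      using tame1_mult[OF w(1) w(2)] by (intro tame1_sum tame1_cmult) auto
    from tame1_mult[OF \<phi>1(1) this]
    show "tame1 1 (\<lambda>q. \<phi> q * (\<Sum>k\<in>UNIV. 2 * (w k q * dx i (w k) q)))" by simp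
    show "tame1 1 (\<lambda>q. 2 * (P q * w i q) * \<phi> q)"
      by (rule tame1_weaken[OF tame1_mult[OF tame1_cmult[OF tame1_mult[OF P w(1)]] \<phi>1(1)]]) simp
    show "tame1 1 (\<lambda>q. \<phi> q * (m q * u i q))"
      by (rule tame1_weaken[OF tame1_mult[OF \<phi>1(1) tame1_mult[OF m u]]]) simp
  qed
  have B: "tame 2 B"
  proof -
    have "tame 2 (\<lambda>q. \<Sum>k\<in>UNIV. \<Sum>i\<in>UNIV. dx i (w k) q * dx i (w k) q)"
      using tame_mult[OF tame1D(1)[OF w(2)] tame1D(1)[OF w(2)]] by (intro tame_sum) auto
    from tame_mult[OF tame1D(1)[OF \<phi>1(1)] this] show ?thesis unfolding B_def[abs_def] by simp
  qed
  have C: "tame 0 C"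
  proof -
    have "tame 0 (\<lambda>q. dt \<phi> q + (\<Sum>i\<in>UNIV. dx i (dx i \<phi>) q))"
      by (intro tame_add tame_sum tame1D(1) tame1D(3) \<phi>1) auto
    from tame_mult[OF tame1D(1)[OF n] this] show ?thesis unfolding C_def[abs_def] by simp
  qed
  have E: "tame (1 / 2) E"
  proof -
    have "tame (1 / 4) (\<lambda>q. \<Sum>i\<in>UNIV. u i q * dx i \<phi> q)"
      using tame_mult[OF tame1D(1)[OF u] tame1D(1)[OF \<phi>1(2)]] by (intro tame_sum) auto
    from tame_mult[OF tame1D(1)[OF m] this] show ?thesis unfolding E_def[abs_def] by simp
  qed
  have G: "tame (3 / 2) G"
  proof -
    have z: "tame (1 / 4) (\<lambda>q. u k q - w k q)" for k
      by (intro tame_diff tame1D(1) u tame1_weaken[OF w(1)]) simp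
    have "tame (5 / 4) (\<lambda>q. \<Sum>i\<in>UNIV. dx i (w k) q * u i q)" for k
      using tame_mult[OF tame1D(1)[OF w(2)] tame1D(1)[OF u]] by (intro tame_sum) auto
    from tame_mult[OF z this]
    have "tame (3 / 2) (\<lambda>q. \<Sum>k\<in>UNIV. (u k q - w k q) * (\<Sum>i\<in>UNIV. dx i (w k) q * u i q))"
      by (intro tame_sum) auto
    from tame_mult[OF tame1D(1)[OF \<phi>1(1)] this] show ?thesis unfolding G_def[abs_def] by simp
  qed
  have H: "tame (1 / 2) H"
  proof -
    have "tame 0 (\<lambda>q. \<Sum>i\<in>UNIV. w i q * dx i \<phi> q)"
      using tame_mult[OF tame1D(1)[OF w(1)] tame1D(1)[OF \<phi>1(2)]] by (intro tame_sum) auto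
    from tame_mult[OF tame_cmult[OF tame1D(1)[OF P], of 2] this] show ?thesis unfolding H_def[abs_def] by simp
  qed
  have "slab_integral t (\<lambda>q. C q - 2 * B q + E q + 2 * G q + H q) = slice_integral t N"
  proof (rule slab_divergence[where P=X and p=1])
    show "supported N" unfolding N_def[abs_def] by (intro supported_mult_left sup)
    show "supported (X i)" for i
      unfolding X_def[abs_def] by (intro supported_add supported_diff supported_mult_left[OF sup(2)] supported_mult_left[OF sup(1)] supported_mult_right[OF sup(1)])
    show "C q - 2 * B q + E q + 2 * G q + H q = dt N q + (\<Sum>i\<in>UNIV. dx i (X i) q)" if q: "q \<in> cyl" for q
      using energy_identity[OF q tame1D(2)[OF w(1) q] tame1D(2)[OF w(2) q] tame1D(2)[OF u q] tame1D(2)[OF P q]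
          tame1D(2)[OF \<phi>1(1) q] tame1D(2)[OF \<phi>1(2) q] div[OF q] mom[OF q]]
      unfolding N_def[abs_def] X_def[abs_def] B_def C_def E_def G_def H_def n_def m_def by simp
  qed (use N X t in \<open>auto intro: tame1_weaken\<close>)
  moreover have "slab_integral t (\<lambda>q. C q - 2 * B q + E q + 2 * G q + H q)
      = slab_integral t C - 2 * slab_integral t B + slab_integral t E + 2 * slab_integral t G + slab_integral t H"
  proof -
    have b: "tame 2 (\<lambda>q. (- 2) * B q)" "tame 2 (\<lambda>q. 2 * G q)" "tame 2 C" "tame 2 E" "tame 2 H"
      by (intro tame_cmult B tame_weaken[OF G] tame_weaken[OF C] tame_weaken[OF E] tame_weaken[OF H]; simp)+
    have "slab_integral t (\<lambda>q. C q + (- 2) * B q + E q + 2 * G q + H q)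
      = slab_integral t C + slab_integral t (\<lambda>q. (- 2) * B q) + slab_integral t E + slab_integral t (\<lambda>q. 2 * G q) + slab_integral t H"
      by (simp only: slab_integral_add[where p=2] tame_add b)
    then show ?thesis by (simp only: slab_integral_cmult) simp
  qed
  moreover have "(norm (vfield w q))\<^sup>2 * \<phi> q = zcut N q" for q
    by (simp add: norm_vfield N_def n_def zcut_def)
  moreover have "\<phi> q * (norm (mfield (\<lambda>i j. dx j (w i)) q))\<^sup>2 = zcut B q" for q
    by (simp add: norm_mfield B_def zcut_def)
  moreover have "(norm (vfield w q))\<^sup>2 * (dt \<phi> q + laplacian \<phi> q) = zcut C q" for q
    by (simp add: norm_vfield C_def n_def laplacian_def zcut_def)
  moreover have vz: "vfield w q + vfield (\<lambda>i q. u i q - w i q) q = vfield u q" for q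
    by (simp add: vec_eq_iff vfield_def zcut_def)
  moreover have "((norm (vfield w q))\<^sup>2 + 2 * (vfield w q \<bullet> vfield (\<lambda>i q. u i q - w i q) q)) *
      (vfield u q \<bullet> grad \<phi> q) = zcut E q" for q
  proof (cases "q \<in> cyl")
    case True
    then have "(norm (vfield w q))\<^sup>2 + 2 * (vfield w q \<bullet> vfield (\<lambda>i q. u i q - w i q) q) = m q"
      unfolding norm_vfield by (simp add: vfield_def inner_vec_def m_def sum_3 algebra_simps)
    moreover have "vfield u q \<bullet> grad \<phi> q = (\<Sum>i\<in>UNIV. u i q * dx i \<phi> q)"
      using True by (simp add: vfield_def grad_def inner_vec_def)
    ultimately show ?thesis using True by (simp add: E_def)
  qed (simp add: vfield_def inner_vec_def)
  moreover have "\<phi> q * (vfield (\<lambda>i q. u i q - w i q) q \<bullet> (mfield (\<lambda>i j. dx j (w i)) q *v vfield u q)) = zcut G q" for q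
    by (cases "q \<in> cyl") (simp_all add: vfield_def mfield_def inner_vec_def matrix_vector_mult_def G_def)
  moreover have "2 * zcut P q * (vfield w q \<bullet> grad \<phi> q) = zcut H q" for q
    by (cases "q \<in> cyl") (simp_all add: vfield_def grad_def inner_vec_def H_def)
  ultimately show "let C = {0<..<t} \<times> ball 0 1;
              a = (\<lambda>x. (norm (vfield w (t, x)))\<^sup>2 * \<phi> (t, x));
              b = (\<lambda>p. \<phi> p * (norm (mfield (\<lambda>i j. dx j (w i)) p))\<^sup>2);
              c = (\<lambda>p. (norm (vfield w p))\<^sup>2 * (dt \<phi> p + laplacian \<phi> p));
              d = (\<lambda>p. ((norm (vfield w p))\<^sup>2 + 2 * (vfield w p \<bullet> vfield (\<lambda>i q. u i q - w i q) p)) *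
                 ((vfield w p + vfield (\<lambda>i q. u i q - w i q) p) \<bullet> grad \<phi> p));
              e = (\<lambda>p. \<phi> p * (vfield (\<lambda>i q. u i q - w i q) p \<bullet>
                 (mfield (\<lambda>i j. dx j (w i)) p *v (vfield w p + vfield (\<lambda>i q. u i q - w i q) p))));
              g = (\<lambda>p. 2 * zcut P p * (vfield w p \<bullet> grad \<phi> p))
          in a absolutely_integrable_on ball 0 1 \<and>
             b absolutely_integrable_on C \<and> c absolutely_integrable_on C \<and>
             d absolutely_integrable_on C \<and> e absolutely_integrable_on C \<and>
             g absolutely_integrable_on C \<and>
             (LINT x:ball 0 1|lebesgue. a x) + 2 * (LINT p:C|lebesgue. b p)
               \<le> (LINT p:C|lebesgue. c p) + (LINT p:C|lebesgue. d p)
                 + 2 * (LINT p:C|lebesgue. e p) + (LINT p:C|lebesgue. g p)"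
    using tame_slice[OF tame1D(1)[OF N], of t] tame_slab[OF B, of t] tame_slab[OF C, of t] tame_slab[OF E, of t]
      tame_slab[OF G, of t] tame_slab[OF H, of t]
    unfolding Let_def by (simp only: simp_thms)
qed

section \<open>The solution\<close>

text \<open>\<open>a1\<close> and \<open>a2\<close> divided by \<open>1 - s\<close>: the flow vanishes on the sphere.\<close>

definition b1 :: "real \<Rightarrow> real \<Rightarrow> real" where
  "b1 t s = ee t^43 * (- ((1/2 * (1 - s)^4 + 27/20 * (1 - s)^5 + (1 - s)^2 * ee t + 9/4 * (1 - s)^3 * ee t) / ((1 - s)^2 + ee t)^2)
     + sg s * (s^3 * ((1 - s)^4 * (3/4 - 27/4 * s))) / 100)"
definition b2 :: "real \<Rightarrow> real \<Rightarrow> real" where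
  "b2 t s = ee t^43 * ((1/2 * (1 - s)^5 + 27/10 * (1 - s)^6 + 3/2 * (1 - s)^3 * ee t + 81/10 * (1 - s)^4 * ee t
       + 3 * (1 - s) * ee t^2 + 9 * (1 - s)^2 * ee t^2) / ((1 - s)^2 + ee t)^3
     + sg s * (s^2 * ((1 - s)^3 * (- 3/16 - 69/8 * s + 621/16 * s^2))) / 100)"

lemma a_factor: "a1 t s = (1 - s) * b1 t s" "a2 t s = (1 - s) * b2 t s"
proof -
  define y where "y = 1 - s"
  have c: "e * (- (y * A / b) + y * B / 100) = y * (e * (- (A / b) + B / 100))"
    "e * (y * A / b + y * B / 100) = y * (e * (A / b + B / 100))" for e A B b :: real
    by (simp_all add: algebra_simps)
  have 1: "N1 y (ee t) = y * (1/2 * y^4 + 27/20 * y^5 + y^2 * ee t + 9/4 * y^3 * ee t)" unfolding N1_def by algebra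
  have 2: "r1 s = y * (sg s * (s^3 * (y^4 * (3/4 - 27/4 * s))))" unfolding r1_def y_def by algebra
  show "a1 t s = (1 - s) * b1 t s"
    unfolding a1_def b1_def y_def[symmetric] 1 2 c ..
  have 1: "N2 y (ee t) = y * (1/2 * y^5 + 27/10 * y^6 + 3/2 * y^3 * ee t + 81/10 * y^4 * ee t + 3 * y * ee t^2 + 9 * y^2 * ee t^2)"
    unfolding N2_def by algebra
  have 2: "r2 s = y * (sg s * (s^2 * (y^3 * (- 3/16 - 69/8 * s + 621/16 * s^2))))" unfolding r2_def y_def by algebra
  show "a2 t s = (1 - s) * b2 t s"
    unfolding a2_def b2_def y_def[symmetric] 1 2 c ..
qed

lemma b_alg: "alg Gen1 (1 / 2) (- 38) (L b1)" "alg Gen1 (5 / 2) (- 38) (L b2)"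
proof -
  have Q: "alg Gen1 p 5 (\<lambda>q. F q / ((1 - snd q \<bullet> snd q)^2 + ee (fst q))^n)" if "alg Gen1 0 0 F" "0 \<le> p" "n \<le> 5" for F p n
    by (rule alg_weaken[OF alg_quotient[OF BB_Gen1 that(1)]]) (use that in auto)
  have R: "alg Gen1 p 5 (\<lambda>q. sg (snd q \<bullet> snd q) * ((snd q \<bullet> snd q)^n * F q) / 100)"
    if "alg Gen1 0 0 F" "13 / 2 - 2 * real n \<le> p" for F p n
    by (intro alg_divide, rule alg_weaken[OF alg_sg_part[OF that]]) auto
  have E: "alg Gen1 p (- 38) (\<lambda>q. ee (fst q) ^ 43 * F q)" if "alg Gen1 p 5 F" for p F
    using ee_part[OF that, of 43] by simp
  show "alg Gen1 (1 / 2) (- 38) (L b1)" unfolding L_def b1_def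
    by (rule E, rule alg_add, rule alg_minus, rule Q, intro alg00_intros, simp, simp, rule R, intro alg00_intros, simp)
  show "alg Gen1 (5 / 2) (- 38) (L b2)" unfolding L_def b2_def
    by (rule E, rule alg_add, rule Q, intro alg00_intros, simp, simp, rule R, intro alg00_intros, simp)
qed

definition Wz :: "3 \<Rightarrow> spacetime \<Rightarrow> real" where "Wz i q = Wu i q - Wv i q"

definition body_force :: "3 \<Rightarrow> spacetime \<Rightarrow> real" where
  "body_force i q = dt (Wz i) q - (\<Sum>j\<in>UNIV. dx j (dx j (Wz i)) q)"

lemma W_alg: "alg Gen1 0 (- 16) (Wv i)" "alg Gen1 (1 / 4) (- 16) (Wu i)" "alg Gen1 (1 / 4) (- 16) (Wz i)"
proof -
  show "alg Gen1 (1 / 4) (- 16) (Wu i)" by (rule Wu_alg)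
  show "alg Gen1 0 (- 16) (Wv i)" by (rule alg_weaken[OF Wv_alg]) auto
  show "alg Gen1 (1 / 4) (- 16) (Wz i)" unfolding Wz_def[abs_def]
    by (rule alg_diff[OF Wu_alg alg_weaken[OF Wv_alg]]) auto
qed

lemma W_tame1: "tame1 0 (Wv i)" "tame1 (1 / 4) (Wu i)" "tame1 (1 / 4) (Wz i)" "tame1 (1 / 2) PI"
  using W_alg[THEN alg1_tame1] alg1_tame1[OF PI_alg] by simp_all

lemma W_dx_tame1: "tame1 1 (dx j (Wv i))" "tame1 (5 / 4) (dx j (Wu i))" "tame1 (5 / 4) (dx j (Wz i))"
  using W_alg[THEN alg1_dx, THEN alg1_tame1, of j i] by simp_all

lemma body_force_tame: "tame (9 / 4) (body_force i)"
proof -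
  have "tame (9 / 4) (\<lambda>q. \<Sum>j\<in>UNIV. dx j (dx j (Wz i)) q)"
    using tame1D(4)[OF W_dx_tame1(3)] by (intro tame_sum) auto
  from tame_diff[OF tame_weaken[OF tame1D(3)[OF W_tame1(3)]] this] show ?thesis unfolding body_force_def[abs_def] by simp
qed

text \<open>Explicit quotients by \<open>1 - s\<close>, the form in which \<open>H10_vfield\<close>
  reads the boundary condition.\<close>

lemma W_boundary_factor:
  obtains Vu Vv Vz where "\<And>i. tame (1 / 4) (Vu i)" "\<And>i q. q \<in> cyl \<Longrightarrow> Wu i q = (1 - snd q \<bullet> snd q) * Vu i q"
    "\<And>i. tame (1 / 4) (Vv i)" "\<And>i q. q \<in> cyl \<Longrightarrow> Wv i q = (1 - snd q \<bullet> snd q) * Vv i q"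
    "\<And>i. tame (1 / 4) (Vz i)" "\<And>i q. q \<in> cyl \<Longrightarrow> Wz i q = (1 - snd q \<bullet> snd q) * Vz i q"
proof -
  let ?Vu = "\<lambda>i q. ee (fst q)^21 * gg q * rot i q" and ?Vv = "form (L b1) (L b2)"
  have g: "alg Gen1 (5 / 4) (- 16) (\<lambda>q. ee (fst q)^21 * gg q)"
    using ee_part[OF alg_gen[of "5 / 4" 5 gg Gen1], of 21] by (simp add: Gen1_def)
  have Vu: "tame (1 / 4) (?Vu i)" for i
    using alg1_tame1[OF alg_mult[OF g rot_alg, of i]] tame1D(1) by simp
  have v: "alg Gen1 (- (1 / 2)) (- 38) (?Vv i)" for i using b_alg by (intro form_alg) auto
  have Vv: "tame (1 / 4) (?Vv i)" for i
    by (rule tame_weaken[OF tame1D(1)[OF alg1_tame1[OF v]]]) auto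
  have u: "Wu i q = (1 - snd q \<bullet> snd q) * ?Vu i q" for i q by (simp add: Wu_def hh_def)
  have v: "Wv i q = (1 - snd q \<bullet> snd q) * ?Vv i q" for i q
    by (simp add: Wv_def form_def L_def a_factor algebra_simps)
  show ?thesis
    by (rule that[of ?Vu ?Vv "\<lambda>i q. ?Vu i q - ?Vv i q"])
      (use Vu Vv in \<open>auto simp: u v Wz_def right_diff_distrib intro: tame_diff\<close>)
qed

lemma W_L2_loc_H10:
  "L2_loc_H10_with_grad (ball 0 1) (vfield Wu) (mfield (\<lambda>i j. dx j (Wu i)))"
  "L2_loc_H10_with_grad (ball 0 1) (vfield Wv) (mfield (\<lambda>i j. dx j (Wv i)))"
  "L2_loc_H10_with_grad (ball 0 1) (vfield Wz) (mfield (\<lambda>i j. dx j (Wz i)))"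
proof -
  have main: "L2_loc_H10_with_grad (ball 0 1) (vfield W) (mfield (\<lambda>i j. dx j (W i)))"
    if W: "\<And>i. alg Gen1 (1 / 4) (- 16) (W i)"
      and V: "\<And>i. tame (1 / 4) (V i)" "\<And>i q. q \<in> cyl \<Longrightarrow> W i q = (1 - snd q \<bullet> snd q) * V i q" for W V
  proof -
    have t: "tame1 (1 / 4) (W i)" for i by (rule alg1_tame1[OF W]) simp
    have "H10_with_grad (ball 0 1) (\<lambda>x. vfield W (s, x)) (\<lambda>x. mfield (\<lambda>i j. dx j (W i)) (s, x))" if "s > 0" for s
      by (rule H10_vfield[OF t _ _ that alg_Ck_on_slice[OF alg1_dclosed W that] V]) auto
    moreover have "L2_on (slab T) (vfield W)" "L2_on (slab T) (mfield (\<lambda>i j. dx j (W i)))" for T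
      by (rule vfield_L2_slab[OF tame1D(1)[OF t]] mfield_L2_slab[OF tame1D(4)[OF t]]; simp)+
    ultimately show ?thesis unfolding L2_loc_H10_with_grad_def L2_H10_with_grad_def by simp
  qed
  obtain Vu Vv Vz where V: "\<And>i. tame (1 / 4) (Vu i)" "\<And>i q. q \<in> cyl \<Longrightarrow> Wu i q = (1 - snd q \<bullet> snd q) * Vu i q"
    "\<And>i. tame (1 / 4) (Vv i)" "\<And>i q. q \<in> cyl \<Longrightarrow> Wv i q = (1 - snd q \<bullet> snd q) * Vv i q"
    "\<And>i. tame (1 / 4) (Vz i)" "\<And>i q. q \<in> cyl \<Longrightarrow> Wz i q = (1 - snd q \<bullet> snd q) * Vz i q"
    by (rule W_boundary_factor) (rule that)
  have v: "alg Gen1 (1 / 4) (- 16) (Wv i)" for i by (rule alg_weaken[OF W_alg(1)]) auto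
  show "L2_loc_H10_with_grad (ball 0 1) (vfield Wu) (mfield (\<lambda>i j. dx j (Wu i)))"
    "L2_loc_H10_with_grad (ball 0 1) (vfield Wv) (mfield (\<lambda>i j. dx j (Wv i)))"
    "L2_loc_H10_with_grad (ball 0 1) (vfield Wz) (mfield (\<lambda>i j. dx j (Wz i)))"
    by (rule main[OF W_alg(2) V(1,2)] main[OF v V(3,4)] main[OF W_alg(3) V(5,6)]; assumption)+
qed

text \<open>A compact set may touch the initial time and reach beyond the ball here. The field
  vanishes off \<open>cyl\<close> and its bound is uniform in time, so it is integrable over a slab
  down to time 0.\<close>

lemma vfield_locally_integrable_closed_half_space:
  assumes F: "\<And>i. tame p (F i)" and p: "p < 3"
  shows "locally_integrable_on ({0..} \<times> UNIV) (vfield F)"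
  unfolding locally_integrable_on_def
proof (intro allI impI, elim conjE)
  fix K :: "spacetime set" assume K: "compact K"
  obtain T where T: "\<And>q. q \<in> K \<Longrightarrow> fst q < T"
  proof -
    obtain B where B: "\<And>q. q \<in> K \<Longrightarrow> norm q \<le> B" using compact_imp_bounded[OF K] unfolding bounded_iff by blast
    have "fst q < B + 1" if "q \<in> K" for q
      using B[OF that] norm_fst_le[of "fst q" "snd q"] abs_ge_self[of "fst q"] by (simp del: abs_ge_self)
    then show ?thesis by (rule that)
  qed
  have "vfield F absolutely_integrable_on slab T"
    unfolding absolutely_integrable_componentwise_iff[where f="vfield F"]
    using tame_slab(1)[OF F p] by (auto simp: Basis_vec_def vfield_component)
  then have "integrable lborel (\<lambda>q. indicator (slab T) q *\<^sub>R vfield F q)"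
    using lebesgue_set_integrable_iff(1)[OF vfield_measurable[of p F, OF F], of "slab T"] open_slab by simp
  then have "integrable lborel (\<lambda>q. indicator K q *\<^sub>R (indicator (slab T) q *\<^sub>R vfield F q))"
    by (rule integrable_mult_indicator[rotated]) (use K in \<open>simp add: compact_imp_closed\<close>)
  moreover have "indicator K q *\<^sub>R (indicator (slab T) q *\<^sub>R vfield F q) = indicator K q *\<^sub>R vfield F q" for q
  proof (cases "q \<in> K \<and> q \<in> cyl")
    case True
    then have "q \<in> slab T" using T[of q] by (cases q) (auto simp: in_cyl)
    then show ?thesis by simp
  next
    case False
    then have "q \<notin> K \<or> vfield F q = 0" by (auto simp: vfield_def vec_eq_iff)
    then show ?thesis by auto
  qed
  ultimately have "integrable lborel (\<lambda>q. indicator K q *\<^sub>R vfield F q)" by (simp only:)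
  then show "vfield F absolutely_integrable_on K"
    using lebesgue_set_integrable_iff(1)[OF vfield_measurable[of p F, OF F], of K] K by (simp add: compact_imp_closed)
qed

lemma zcut_Lp_loc:
  assumes P: "tame p P" and p: "p * r < 3" "r > 0"
  shows "Lp_loc r ({0<..<T} \<times> ball 0 1) (zcut P)"
proof -
  obtain C where C: "C \<ge> 0" "\<And>t x. (t, x) \<in> cyl \<Longrightarrow> \<bar>P (t, x)\<bar> \<le> C * norm x powr (- p)"
    using P unfolding tame_def by blast
  have "\<bar>P (t, x)\<bar> powr r \<le> C powr r * norm x powr (- (p * r))" if "(t, x) \<in> cyl" for t x
    using powr_mono2[OF _ _ C(2)[OF that], of r] C(1) p by (simp add: powr_mult powr_powr)
  moreover have "continuous_on cyl (\<lambda>q. \<bar>P q\<bar> powr r)"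
    using P p by (intro continuous_on_powr' continuous_intros) (auto simp: tame_def)
  ultimately have "tame (p * r) (\<lambda>q. \<bar>P q\<bar> powr r)"
    unfolding tame_def by (auto intro!: exI[of _ "C powr r"])
  moreover have "zcut (\<lambda>q. \<bar>P q\<bar> powr r) = (\<lambda>q. norm (zcut P q) powr r)" by (auto simp: zcut_def)
  ultimately have "locally_integrable_on ({0<..} \<times> ball 0 1) (\<lambda>q. norm (zcut P q) powr r)"
    using tame_locally_integrable[of "p * r" "\<lambda>q. \<bar>P q\<bar> powr r"] p by simp
  moreover have "K \<subseteq> {0<..} \<times> ball 0 1" if "K \<subseteq> slab T" for K using that by auto
  ultimately show ?thesis
    unfolding Lp_loc_def locally_integrable_on_def
    using set_borel_measurable_lebesgue[OF tame_zcut_measurable[OF P]] by (auto simp: compact_imp_closed)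
qed

section \<open>Unboundedness near the axis\<close>

lemma norm_axis: "norm (axis i c :: real^'n) = \<bar>c\<bar>"
  by (simp add: norm_eq_sqrt_inner inner_axis_axis)

text \<open>At radius \<open>k^4\<close> all fractional powers become integral: \<open>Gr\<close> is
  at least of the order \<open>1 / k^10\<close>, so \<open>gg\<close> of the order
  \<open>1 / k^5\<close>, and the factor \<open>x1 = k^4\<close> leaves \<open>1 / k\<close>. The
  additional power of \<open>ee t\<close> and the number 20 come from
  \<open>ee t^2 \<le> ee t\<close>, the square root of 100, and
  \<open>1 - k^8 \<ge> 1/2\<close>.\<close>

lemma Wu_axis:
  assumes t: "t > 0" and k: "0 < k" "k \<le> 1 / 2"
  shows "(t, axis 1 (k^4)) \<in> cyl" "ee t^22 / (20 * k) \<le> Wu 2 (t, axis 1 (k^4))"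
proof -
  have r: "0 < k^4" "k^4 \<le> k" using k power_le_one[of k 3] by (auto simp: power4_eq_xxxx power3_eq_cube mult_le_one mult_left_le_one_le)
  have n: "norm (axis 1 (k^4) :: real^3) = k^4" "axis 1 (k^4) \<bullet> axis 1 (k^4) = (k^8 :: real)"
    by (simp_all add: norm_axis inner_axis_axis power_add[symmetric])
  show q: "(t, axis 1 (k^4)) \<in> cyl" using t r k by (simp add: in_cyl axis_eq_0_iff n)
  have e: "0 < ee t" "ee t \<le> 1" using ee_bounds(1)[OF t] ee_bounds(2)[of t] by auto
  have "(k^4) powr (- (5 / 2)) = 1 / k^10"
  proof -
    have "(k^4) powr (- (5 / 2)) = (k powr 4) powr (- (5 / 2))" using k(1) by (simp add: powr_numeral)
    also have "\<dots> = k powr (- 10)" by (simp only: powr_powr) simp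
    also have "\<dots> = 1 / k^10" using k(1) by (simp add: powr_minus_divide powr_numeral)
    finally show ?thesis .
  qed
  then have "ee t * (1 / k^10) / 100 \<le> L Gr (t, axis 1 (k^4))" using Gr_ge[OF q] by (simp add: n)
  moreover have "(ee t / (10 * k^5))^2 \<le> ee t * (1 / k^10) / 100"
  proof -
    have "(ee t / (10 * k^5))^2 = ee t * ee t * (1 / k^10) / 100"
      by (simp add: power_divide power_mult_distrib power2_eq_square power_add[symmetric])
    also have "\<dots> \<le> ee t * 1 * (1 / k^10) / 100"
      using e k by (intro divide_right_mono mult_right_mono mult_left_mono) auto
    finally show ?thesis by simp
  qed
  ultimately have g: "ee t / (10 * k^5) \<le> gg (t, axis 1 (k^4))"
    unfolding gg_def by (intro real_le_rsqrt) linarith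
  have "k^8 \<le> k^1" by (rule power_decreasing) (use k in auto)
  then have "1 / 2 * (ee t / (10 * k^5)) \<le> (1 - k^8) * gg (t, axis 1 (k^4))"
    using k e by (intro mult_mono g) auto
  then have "ee t^21 * (1 / 2 * (ee t / (10 * k^5))) * k^4 \<le> ee t^21 * ((1 - k^8) * gg (t, axis 1 (k^4))) * k^4"
    using e k by (intro mult_right_mono mult_left_mono) auto
  moreover have "ee t^21 * (1 / 2 * (ee t / (10 * k^5))) * k^4 = ee t^22 / (20 * k)"
    using k(1) by (simp add: field_simps power_numeral_reduce)
  moreover have "Wu 2 (t, axis 1 (k^4)) = ee t^21 * ((1 - k^8) * gg (t, axis 1 (k^4))) * k^4"
    by (simp add: Wu_def hh_def rot_def n)
  ultimately show "ee t^22 / (20 * k) \<le> Wu 2 (t, axis 1 (k^4))" by simp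
qed

text \<open>By continuity on \<open>cyl\<close>, a large value at one point near the axis persists
  on a nonempty open set, which is not negligible; so it refutes an essential bound.\<close>

lemma Wu_singular:
  assumes t: "t > 0" shows "(t, 0) \<in> singular_set ({0<..} \<times> ball 0 1) (vfield Wu)"
  unfolding singular_set_def regular_point_def
proof (intro CollectI conjI notI, use t in simp, elim exE conjE)
  fix U :: "spacetime set" and M
  assume U: "open U" "(t, 0) \<in> U" and M: "AE q in lebesgue. q \<in> U \<longrightarrow> norm (vfield Wu q) \<le> M"
  obtain d where d: "d > 0" "\<And>q. dist q (t, 0) < d \<Longrightarrow> q \<in> U" using U unfolding open_dist by blast
  \<comment> \<open>The three entries keep the point in the range of \<open>Wu_axis\<close>, place
    it in \<open>U\<close>, and push the value above \<open>M\<close>, since \<open>20 * |M|\<close>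
    is less than \<open>21 * (|M| + 1)\<close>.\<close>
  define k where "k = min (1 / 2) (min (d / 2) (ee t^22 / (21 * (\<bar>M\<bar> + 1))))"
  have e: "ee t > 0" by (rule ee_bounds(1)[OF t])
  have "k \<le> ee t^22 / (21 * (\<bar>M\<bar> + 1))" "k \<le> d / 2" "k \<le> 1 / 2"
    unfolding k_def by (meson min.cobounded1 min.cobounded2 order_trans)+
  then have k: "0 < k" "k \<le> 1 / 2" "k < d" "k * (21 * (\<bar>M\<bar> + 1)) \<le> ee t^22"
    using d(1) e by (simp_all add: pos_le_divide_eq) (simp_all add: k_def add_nonneg_pos)
  define q where "q = (t, axis 1 (k^4) :: real^3)"
  have "k^4 \<le> k^1" by (rule power_decreasing) (use k in auto)
  moreover have "dist q (t, 0) = norm (axis 1 (k^4) :: real^3)" by (simp add: q_def dist_Pair_Pair)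
  ultimately have "q \<in> U" using k by (intro d(2)) (simp add: norm_axis)
  moreover have "q \<in> cyl" "ee t^22 / (20 * k) \<le> Wu 2 q" using Wu_axis[OF t k(1,2)] by (simp_all add: q_def)
  moreover have "M < ee t^22 / (20 * k)"
  proof -
    have "M * (20 * k) \<le> \<bar>M\<bar> * (20 * k)" using k by (intro mult_right_mono) auto
    also have "\<dots> < k * (21 * (\<bar>M\<bar> + 1))" using k(1) by (simp add: algebra_simps add_nonneg_pos)
    also have "\<dots> \<le> ee t^22" by (rule k(4))
    finally show ?thesis using k(1) by (simp only: pos_less_divide_eq mult_pos_pos zero_less_numeral)
  qed
  moreover define A where "A = U \<inter> {q \<in> cyl. M < Wu 2 q}"
  ultimately have "q \<in> A" by simp
  have "continuous_on cyl (Wu 2)" using W_tame1(2) by (simp add: tame1_def tame_def)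
  then have "open {q \<in> cyl. M < Wu 2 q}"
    using continuous_on_open_vimage[OF open_cyl, of "Wu 2"] open_greaterThan[of M]
    by (auto simp: vimage_def Int_def conj_commute elim!: allE[of _ "{M<..}"])
  then have "open A" unfolding A_def using U(1) by blast
  moreover have "negligible A"
  proof -
    have "A \<subseteq> {q. \<not> (q \<in> U \<longrightarrow> norm (vfield Wu q) \<le> M)}"
    proof
      fix q assume "q \<in> A"
      then have "q \<in> U" "q \<in> cyl" "M < Wu 2 q" by (auto simp: A_def)
      moreover have "Wu 2 q \<le> norm (vfield Wu q)"
        using component_le_norm_cart[of "vfield Wu q" 2] \<open>q \<in> cyl\<close> by (simp add: vfield_def)
      ultimately show "q \<in> {q. \<not> (q \<in> U \<longrightarrow> norm (vfield Wu q) \<le> M)}" by simp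
    qed
    moreover have "negligible {q. \<not> (q \<in> U \<longrightarrow> norm (vfield Wu q) \<le> M)}"
    proof -
      obtain N where N: "N \<in> null_sets lebesgue" "{q. \<not> (q \<in> U \<longrightarrow> norm (vfield Wu q) \<le> M)} \<subseteq> N"
        using M unfolding eventually_ae_filter by auto
      from N(1) have "negligible N" by (simp only: negligible_iff_null_sets)
      then show ?thesis by (rule negligible_subset[OF _ N(2)])
    qed
    ultimately show ?thesis by (rule negligible_subset[rotated])
  qed
  ultimately show False using \<open>q \<in> A\<close> open_not_negligible by blast
qed

section \<open>Assembling the solution\<close>

lemma zero_vector_field: "vfield (\<lambda>i q. 0) = (\<lambda>q. 0)" "zcut (\<lambda>q. 0) = (\<lambda>q. 0)"
  by (simp_all add: vfield_def zcut_def vec_eq_iff fun_eq_iff)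

text \<open>Since \<open>body_force\<close> is the heat operator applied to \<open>Wz\<close>, the
  Stokes pressure is 0, and the pressures of \<open>u\<close> and \<open>v\<close> coincide.\<close>

lemma stokes_solution_Wz:
  "stokes_solution (ball 0 1) (vfield body_force) (vfield Wz) (mfield (\<lambda>i j. dx j (Wz i))) (\<lambda>q. 0)"
  unfolding stokes_solution_def Linf_loc_L2_def
proof (intro conjI allI impI)
  show "Linf_L2 {0<..<T} (ball 0 1) (vfield Wz)" for T
    by (rule vfield_Linf_L2[OF tame1D(1)[OF W_tame1(3)]]) auto
  have "momentum_eq ({0<..} \<times> ball 0 1) (vfield Wz) (zcut (\<lambda>q. 0)) (vfield body_force)"
    by (rule momentum_eq_vfield[OF W_tame1(3) _ _ _ tame1_const _ _ body_force_tame])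
      (use W_dx_tame1(3) in \<open>auto simp: body_force_def\<close>)
  then show "momentum_eq ({0<..} \<times> ball 0 1) (vfield Wz) (\<lambda>q. 0) (vfield body_force)"
    by (simp only: zero_vector_field)
  have "(\<Sum>i\<in>UNIV. dx i (Wz i) q) = 0" if q: "q \<in> cyl" for q
    using Wu_div[OF q] Wv_div[OF q] tame1D(2)[OF W_tame1(1) q] tame1D(2)[OF W_tame1(2) q]
    by (simp add: Wz_def[abs_def] dx_diff sum_subtractf)
  then show "div_free ({0<..} \<times> ball 0 1) (vfield Wz)"
    by (intro div_free_vfield[OF W_tame1(3)]) auto
  show "initial_value (ball 0 1) (vfield Wz) (\<lambda>x. 0)"
    by (rule initial_value_vfield[of "1 / 4", OF alg_weaken[OF W_alg(3)]]) auto
qed (rule W_L2_loc_H10)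

text \<open>Since \<open>v + z = u\<close>, the convective term is that of the pure swirl
  \<open>Wu\<close>. It has order \<open>5/4 + 1/4 = 3/2\<close>, hence is locally integrable across
  the axis.\<close>

lemma modified_NS_Wv:
  "modified_NS (ball 0 1) (\<lambda>x. 0) (vfield Wz) (mfield (\<lambda>i j. dx j (Wz i)))
     (vfield Wv) (mfield (\<lambda>i j. dx j (Wv i))) (zcut PI)"
  unfolding modified_NS_def
proof (intro conjI W_L2_loc_H10)
  let ?F = "\<lambda>i q. - (\<Sum>j\<in>UNIV. dx j (Wu i) q * Wu j q)"
  have dz: "dx j (Wz i) q = dx j (Wu i) q - dx j (Wv i) q" if q: "q \<in> cyl" for i j q
    using tame1D(2)[OF W_tame1(1) q] tame1D(2)[OF W_tame1(2) q] by (simp add: Wz_def[abs_def] dx_diff)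
  have "- ((mfield (\<lambda>i j. dx j (Wv i)) q + mfield (\<lambda>i j. dx j (Wz i)) q) *v (vfield Wv q + vfield Wz q)) = vfield ?F q" for q
    by (cases "q \<in> cyl") (simp_all add: vec_eq_iff vfield_def mfield_def matrix_vector_mult_def dz Wz_def)
  moreover have "tame (3 / 2) (?F i)" for i
    using tame_mult[OF tame1D(1)[OF W_dx_tame1(2)] tame1D(1)[OF W_tame1(2)]] by (intro tame_minus tame_sum) auto
  then have "momentum_eq ({0<..} \<times> ball 0 1) (vfield Wv) (zcut PI) (vfield ?F)"
    by (intro momentum_eq_vfield[OF W_tame1(1) _ _ _ W_tame1(4)])
      (use W_dx_tame1(1) momentum_pointwise in auto)
  ultimately show "momentum_eq ({0<..} \<times> ball 0 1) (vfield Wv) (zcut PI)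
      (\<lambda>q. - ((mfield (\<lambda>i j. dx j (Wv i)) q + mfield (\<lambda>i j. dx j (Wz i)) q) *v (vfield Wv q + vfield Wz q)))"
    by simp
  show "div_free ({0<..} \<times> ball 0 1) (vfield Wv)"
    by (rule div_free_vfield[OF W_tame1(1)]) (auto simp: Wv_div)
  show "initial_value (ball 0 1) (vfield Wv) (\<lambda>x. 0)"
    by (rule initial_value_vfield[of 0, OF alg_weaken[OF W_alg(1)]]) auto
qed

theorem theorem2p8:
  shows "\<exists>(u0 :: real^3 \<Rightarrow> real^3) (f :: real \<times> (real^3) \<Rightarrow> real^3) (D :: (real^3) set)
            (u :: real \<times> (real^3) \<Rightarrow> real^3) (P :: real \<times> (real^3) \<Rightarrow> real).
           locally_integrable_on ({0..} \<times> UNIV) f \<and>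
           regular_bounded_domain D \<and>
           suitable_weak_solution D u0 f u P \<and>
           hausdorff1 (singular_set ({0<..} \<times> D) u) > 0"
proof (intro exI conjI)
  show "locally_integrable_on ({0..} \<times> UNIV) (vfield body_force)"
    by (rule vfield_locally_integrable_closed_half_space[OF body_force_tame]) simp
  show "regular_bounded_domain (ball 0 1 :: (real^3) set)" by (rule regular_bounded_domain_ball)
  show "hausdorff1 (singular_set ({0<..} \<times> ball 0 1) (vfield Wu)) > 0"
    by (rule hausdorff1_segment_pos[of 0]) (auto intro: Wu_singular)
  show "suitable_weak_solution (ball 0 1) (\<lambda>x. 0) (vfield body_force) (vfield Wu) (zcut PI)"
    unfolding suitable_weak_solution_def Let_def
  proof (intro exI conjI allI impI)
    show "stokes_solution (ball 0 1) (vfield body_force) (vfield Wz) (mfield (\<lambda>i j. dx j (Wz i))) (\<lambda>q. 0)"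
      by (rule stokes_solution_Wz)
    show "Linf_L2 {0<..} (ball 0 1) (vfield Wu)"
      by (rule vfield_Linf_L2[OF tame1D(1)[OF W_tame1(2)]]) auto
    show "L2_loc_H10_with_grad (ball 0 1) (vfield Wu) (mfield (\<lambda>i j. dx j (Wu i)))" by (rule W_L2_loc_H10)
    show "Lp_loc (5/3) ({0<..<T} \<times> ball 0 1) (zcut PI)" for T
      \<comment> \<open>The pressure has order 1/2 at the origin, and
        \<open>1/2 * 5/3 < 3\<close>.\<close>
      by (rule zcut_Lp_loc[OF tame1D(1)[OF W_tame1(4)]]) auto
    have v: "(\<lambda>q. vfield Wu q - vfield Wz q) = vfield Wv"
      by (auto simp: fun_eq_iff vec_eq_iff vfield_def zcut_def Wz_def)
    have Gv: "(\<lambda>q. mfield (\<lambda>i j. dx j (Wu i)) q - mfield (\<lambda>i j. dx j (Wz i)) q) = mfield (\<lambda>i j. dx j (Wv i))"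
    proof
      fix q
      have "dx j (Wz i) q = dx j (Wu i) q - dx j (Wv i) q" if q: "q \<in> cyl" for i j
        using tame1D(2)[OF W_tame1(1) q] tame1D(2)[OF W_tame1(2) q] by (simp add: Wz_def[abs_def] dx_diff)
      then show "mfield (\<lambda>i j. dx j (Wu i)) q - mfield (\<lambda>i j. dx j (Wz i)) q = mfield (\<lambda>i j. dx j (Wv i)) q"
        by (cases "q \<in> cyl") (simp_all add: vec_eq_iff mfield_def)
    qed
    show "modified_NS (ball 0 1) (\<lambda>x. 0) (vfield Wz) (mfield (\<lambda>i j. dx j (Wz i)))
        (\<lambda>q. vfield Wu q - vfield Wz q) (\<lambda>q. mfield (\<lambda>i j. dx j (Wu i)) q - mfield (\<lambda>i j. dx j (Wz i)) q) (\<lambda>q. zcut PI q - 0)"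
      unfolding v Gv using modified_NS_Wv by simp
    have "local_energy_inequality (ball 0 1) (vfield (\<lambda>i q. Wu i q - Wv i q)) (vfield Wv) (mfield (\<lambda>i j. dx j (Wv i))) (zcut PI)"
      by (rule local_energy_vfield[OF W_tame1(1) W_dx_tame1(1) W_tame1(2,4) Wv_div Wu_div momentum_pointwise])
    then show "local_energy_inequality (ball 0 1) (vfield Wz)
        (\<lambda>q. vfield Wu q - vfield Wz q) (\<lambda>q. mfield (\<lambda>i j. dx j (Wu i)) q - mfield (\<lambda>i j. dx j (Wz i)) q) (\<lambda>q. zcut PI q - 0)"
      unfolding v Gv by (simp add: Wz_def[abs_def])
  qed
qed

end
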